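(* Let $L$ be a nonempty finite CW complex and let $$c_\infty L=(L\times[0,\infty))/(L\times\{0\})$$ be the infinite cone with apex $v$. There is a finite Borel–Moore cellular model $D$ of $c_\infty L$ with $$D_0=\mathbb Z\{v\},\qquad D_{k+1}=C_k(L)\quad(k\ge0),$$ whose differential in degree one is the cellular augmentation $\epsilon:C_0(L)\to\mathbb Z$ and in higher degrees is the shifted differential of $L$. Consequently $$H_i(D)\cong\widetilde H_{i-1}(L)\ \ (i\ge1),\qquad H_0(D)=0.$$ Equivalently, the one-point compactification $(c_\infty L)^+$ is the suspension $\Sigma L$.
   Context: $C_*(L)$ denotes integral cellular chains. Borel–Moore homology of $X$ is homology of locally finite singular chains; for the spaces here it is computed by the homology of the one-point compactification $X^+$ relative to the added point. A finite Borel–Moore cellular model of $X$ is the cellular chain complex of a finite CW structure on $X^+$ having the added point as a vertex, taken relative to that vertex. $\Sigma L$ is the unreduced suspension of $L$. *)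

theory Defs
  imports "HOL-Analysis.Analysis" "HOL-Homology.Homology"
begin

section \<open>Quotient spaces, infinite cone and suspension\<close>

definition final_topology :: "'a topology \<Rightarrow> ('a \<Rightarrow> 'b) \<Rightarrow> 'b topology" where
  "final_topology X f =
     topology (\<lambda>U. U \<subseteq> f ` topspace X \<and> openin X {x \<in> topspace X. f x \<in> U})"

lemma openin_final_topology:
  "openin (final_topology X f) U \<longleftrightarrow>
     U \<subseteq> f ` topspace X \<and> openin X {x \<in> topspace X. f x \<in> U}"
proof -
  have "istopology (\<lambda>U. U \<subseteq> f ` topspace X \<and> openin X {x \<in> topspace X. f x \<in> U})"
    unfolding istopology_def
  proof (intro conjI allI impI)
    fix S T
    assume S: "S \<subseteq> f ` topspace X \<and> openin X {x \<in> topspace X. f x \<in> S}"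
      and T: "T \<subseteq> f ` topspace X \<and> openin X {x \<in> topspace X. f x \<in> T}"
    show "S \<inter> T \<subseteq> f ` topspace X" using S by blast
    have "{x \<in> topspace X. f x \<in> S \<inter> T} =
          {x \<in> topspace X. f x \<in> S} \<inter> {x \<in> topspace X. f x \<in> T}" by blast
    then show "openin X {x \<in> topspace X. f x \<in> S \<inter> T}" using S T by auto
  next
    fix \<K>
    assume K: "\<forall>K\<in>\<K>. K \<subseteq> f ` topspace X \<and> openin X {x \<in> topspace X. f x \<in> K}"
    show "\<Union>\<K> \<subseteq> f ` topspace X" using K by blast
    have "{x \<in> topspace X. f x \<in> \<Union>\<K>} = (\<Union>K\<in>\<K>. {x \<in> topspace X. f x \<in> K})" by blast
    then show "openin X {x \<in> topspace X. f x \<in> \<Union>\<K>}" using K by auto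
  qed
  then show ?thesis
    by (simp add: final_topology_def)
qed

lemma topspace_final_topology: "topspace (final_topology X f) = f ` topspace X"
proof
  show "topspace (final_topology X f) \<subseteq> f ` topspace X"
    using openin_topspace [of "final_topology X f"] by (simp only: openin_final_topology)
  have "{x \<in> topspace X. f x \<in> f ` topspace X} = topspace X" by blast
  then have "openin (final_topology X f) (f ` topspace X)"
    by (simp add: openin_final_topology)
  then show "f ` topspace X \<subseteq> topspace (final_topology X f)"
    by (rule openin_subset)
qed

lemma quotient_map_final_topology: "quotient_map X (final_topology X f) f"
  unfolding quotient_map_def topspace_final_topology openin_final_topology by blast

text \<open>Points of the space obtained by collapsing each member of a family of pairwise disjoint
  subsets are equivalence classes: the collapsed sets themselves, and the remaining singletons.\<close>

definition collapse_class :: "'a topology \<Rightarrow> 'a set set \<Rightarrow> 'a \<Rightarrow> 'a set" where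
  "collapse_class X \<A> x = {y \<in> topspace X. y = x \<or> (\<exists>A\<in>\<A>. x \<in> A \<and> y \<in> A)}"

definition collapse_topology :: "'a topology \<Rightarrow> 'a set set \<Rightarrow> 'a set topology" where
  "collapse_topology X \<A> = final_topology X (collapse_class X \<A>)"

definition infinite_cone :: "'a topology \<Rightarrow> ('a \<times> real) set topology" where
  "infinite_cone L =
     collapse_topology (prod_topology L (top_of_set {0..})) {topspace L \<times> {0}}"

definition cone_apex :: "'a topology \<Rightarrow> ('a \<times> real) set" where
  "cone_apex L = topspace L \<times> {0}"

definition suspension :: "'a topology \<Rightarrow> ('a \<times> real) set topology" where
  "suspension L =
     collapse_topology (prod_topology L (top_of_set {0..1})) {topspace L \<times> {0}, topspace L \<times> {1}}"

lemma cone_apex_in_infinite_cone: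
  assumes "topspace L \<noteq> {}"
  shows "cone_apex L \<in> topspace (infinite_cone L)"
proof -
  let ?P = "prod_topology L (top_of_set {0::real..})"
  obtain x where x: "x \<in> topspace L" using assms by blast
  then have "cone_apex L = collapse_class ?P {topspace L \<times> {0}} (x, 0)"
    unfolding collapse_class_def cone_apex_def by auto
  moreover have "(x, 0) \<in> topspace ?P"
    using x by simp
  ultimately show ?thesis
    unfolding infinite_cone_def collapse_topology_def topspace_final_topology by (metis imageI)
qed

section \<open>Finite CW structures\<close>

definition disk :: "nat \<Rightarrow> (nat \<Rightarrow> real) topology" where
  "disk n = subtopology (Euclidean_space n) {x. (\<Sum>i<n. (x i)\<^sup>2) \<le> 1}"

definition disk_interior :: "nat \<Rightarrow> (nat \<Rightarrow> real) set" where
  "disk_interior n = {x \<in> topspace (Euclidean_space n). (\<Sum>i<n. (x i)\<^sup>2) < 1}"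

definition disk_boundary :: "nat \<Rightarrow> (nat \<Rightarrow> real) set" where
  "disk_boundary n = {x \<in> topspace (Euclidean_space n). (\<Sum>i<n. (x i)\<^sup>2) = 1}"

text \<open>A cell is its dimension together with its characteristic map.\<close>

type_synonym 'a cell = "nat \<times> ((nat \<Rightarrow> real) \<Rightarrow> 'a)"

definition open_cell :: "'a cell \<Rightarrow> 'a set" where
  "open_cell e = snd e ` disk_interior (fst e)"

text \<open>Skeleta are indexed by integers, so that the (-1)-skeleton is empty.\<close>

definition skeleton :: "'a cell set \<Rightarrow> int \<Rightarrow> 'a set" where
  "skeleton K p = (\<Union>e \<in> {e \<in> K. int (fst e) \<le> p}. open_cell e)"

text \<open>Closure finiteness and the weak topology need not be required separately: there are only
  finitely many cells, their closures are compact, and the space is Hausdorff.\<close>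

definition finite_CW_structure :: "'a topology \<Rightarrow> 'a cell set \<Rightarrow> bool" where
  "finite_CW_structure X K \<longleftrightarrow>
     Hausdorff_space X \<and> finite K \<and>
     (\<forall>(n, \<phi>) \<in> K. continuous_map (disk n) X \<phi> \<and> inj_on \<phi> (disk_interior n) \<and>
                   \<phi> ` disk_boundary n \<subseteq> skeleton K (int n - 1)) \<and>
     disjoint_family_on open_cell K \<and>
     (\<Union>e\<in>K. open_cell e) = topspace X"

section \<open>Cellular chains\<close>

text \<open>The cellular chain complex of \<open>X\<close> relative to a subcomplex \<open>A\<close>, in the form
  \<open>H\<^sub>p (X\<^sup>p \<union> A, X\<^sup>p\<^sup>-\<^sup>1 \<union> A)\<close> with the connecting map of the triple as differential.
  The absolute complex is the case \<open>A = {}\<close>; coefficients are integral.\<close>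

definition cellular_chain_group ::
    "'a topology \<Rightarrow> 'a cell set \<Rightarrow> 'a set \<Rightarrow> int \<Rightarrow> 'a chain set monoid" where
  "cellular_chain_group X K A p =
     relative_homology_group p (subtopology X (skeleton K p \<union> A)) (skeleton K (p - 1) \<union> A)"

definition cellular_boundary ::
    "'a topology \<Rightarrow> 'a cell set \<Rightarrow> 'a set \<Rightarrow> int \<Rightarrow> 'a chain set \<Rightarrow> 'a chain set" where
  "cellular_boundary X K A p =
     hom_induced (p - 1) (subtopology X (skeleton K (p - 1) \<union> A)) {}
                         (subtopology X (skeleton K (p - 1) \<union> A)) (skeleton K (p - 2) \<union> A) id \<circ>
     hom_boundary p (subtopology X (skeleton K p \<union> A)) (skeleton K (p - 1) \<union> A)"

lemma skeleton_mono: "p \<le> q \<Longrightarrow> skeleton K p \<subseteq> skeleton K q"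
  unfolding skeleton_def by (rule UN_mono) auto

lemma cellular_boundary_hom:
  "cellular_boundary X K A p \<in> hom (cellular_chain_group X K A p) (cellular_chain_group X K A (p - 1))"
proof -
  let ?X = "subtopology X (skeleton K p \<union> A)" and ?S = "skeleton K (p - 1) \<union> A"
  have "skeleton K (p - 1) \<subseteq> skeleton K p"
    by (rule skeleton_mono) simp
  then have "(skeleton K p \<union> A) \<inter> ?S = ?S"
    by blast
  then have "subtopology ?X ?S = subtopology X ?S"
    by (simp only: subtopology_subtopology)
  then have "hom_boundary p ?X ?S
     \<in> hom (relative_homology_group p ?X ?S) (homology_group (p - 1) (subtopology X ?S))"
    using hom_boundary_hom [of p ?X ?S] by (simp only:)
  moreover have "hom_induced (p - 1) (subtopology X ?S) {} (subtopology X ?S) (skeleton K (p - 2) \<union> A) id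
     \<in> hom (homology_group (p - 1) (subtopology X ?S))
            (relative_homology_group (p - 1) (subtopology X ?S) (skeleton K (p - 2) \<union> A))"
    by (rule hom_induced_hom)
  ultimately show ?thesis
    unfolding cellular_boundary_def cellular_chain_group_def diff_diff_add one_add_one
    by (rule hom_compose)
qed

definition complex_homology ::
    "(int \<Rightarrow> 'g monoid) \<Rightarrow> (int \<Rightarrow> 'g \<Rightarrow> 'g) \<Rightarrow> int \<Rightarrow> 'g set monoid" where
  "complex_homology C d p =
     subgroup_generated (C p) (kernel (C p) (C (p - 1)) (d p)) Mod (d (p + 1) ` carrier (C (p + 1)))"

text \<open>The class in degree 0 of a vertex \<open>x\<close>, represented by the singular 0-simplex at \<open>x\<close>.\<close>

definition vertex_class :: "'a topology \<Rightarrow> 'a cell set \<Rightarrow> 'a set \<Rightarrow> 'a \<Rightarrow> 'a chain set" where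
  "vertex_class X K A x =
     homologous_rel_set 0 (subtopology X (skeleton K 0 \<union> A)) (skeleton K (- 1) \<union> A)
       (frag_of (restrict (\<lambda>_. x) (standard_simplex 0)))"

text \<open>The augmentation of an absolute 0-dimensional class is the coefficient sum of any
  representative; that this is well defined, additive, and 1 on each vertex is verified below.\<close>

definition coefficient_sum :: "'a chain \<Rightarrow> int" where
  "coefficient_sum c = (\<Sum>f\<in>Poly_Mapping.keys c. Poly_Mapping.lookup c f)"

definition cellular_augmentation :: "'a chain set \<Rightarrow> int" where
  "cellular_augmentation h = the_elem (coefficient_sum ` h)"

lemma coefficient_sum_superset:
  "\<lbrakk>finite S; Poly_Mapping.keys c \<subseteq> S\<rbrakk> \<Longrightarrow> coefficient_sum c = (\<Sum>f\<in>S. Poly_Mapping.lookup c f)"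
  unfolding coefficient_sum_def by (rule sum.mono_neutral_left) (auto simp: in_keys_iff)

lemma coefficient_sum_0 [simp]: "coefficient_sum 0 = 0"
  by (simp add: coefficient_sum_def)

lemma coefficient_sum_of [simp]: "coefficient_sum (frag_of f) = 1"
  by (simp add: coefficient_sum_def)

lemma coefficient_sum_diff [simp]: "coefficient_sum (a - b) = coefficient_sum a - coefficient_sum b"
proof -
  let ?S = "Poly_Mapping.keys a \<union> Poly_Mapping.keys b"
  have "coefficient_sum (a - b) = (\<Sum>f\<in>?S. Poly_Mapping.lookup (a - b) f)"
    by (rule coefficient_sum_superset) (auto simp: keys_diff)
  also have "\<dots> = (\<Sum>f\<in>?S. Poly_Mapping.lookup a f) - (\<Sum>f\<in>?S. Poly_Mapping.lookup b f)"
    by (simp add: lookup_minus sum_subtractf)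
  also have "\<dots> = coefficient_sum a - coefficient_sum b"
    using coefficient_sum_superset [of ?S a] coefficient_sum_superset [of ?S b] by simp
  finally show ?thesis .
qed

lemma coefficient_sum_add [simp]: "coefficient_sum (a + b) = coefficient_sum a + coefficient_sum b"
  using coefficient_sum_diff [of a "0 - b"] coefficient_sum_diff [of 0 b] by simp

lemma coefficient_sum_boundary: "coefficient_sum (chain_boundary (Suc 0) c) = 0"
proof -
  have "Poly_Mapping.keys c \<subseteq> UNIV"
    by simp
  then show ?thesis
  proof (induction c rule: frag_induction)
    case (one f)
    have "chain_boundary (Suc 0) (frag_of f)
          = frag_of (singular_face (Suc 0) 0 f) - frag_of (singular_face (Suc 0) (Suc 0) f)"
      by (simp add: chain_boundary_of)
    then show ?case
      by (simp only: coefficient_sum_diff coefficient_sum_of diff_self)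
  qed (simp_all add: chain_boundary_diff)
qed

lemma coefficient_sum_homologous:
  assumes "homologous_rel 0 X {} c b"
  shows "coefficient_sum b = coefficient_sum c"
proof -
  obtain d where "chain_boundary (Suc 0) d = c - b"
    using assms unfolding homologous_rel_def singular_boundary by blast
  then show ?thesis
    using coefficient_sum_boundary [of d] by simp
qed

lemma coefficient_sum_class:
  "coefficient_sum ` homologous_rel_set 0 X {} c = {coefficient_sum c}"
proof -
  have "c \<in> homologous_rel_set 0 X {} c"
    by simp
  moreover have "coefficient_sum b = coefficient_sum c" if "b \<in> homologous_rel_set 0 X {} c" for b
    using that coefficient_sum_homologous by blast
  ultimately show ?thesis
    by blast
qed

lemma cellular_augmentation:
  "cellular_augmentation (homologous_rel_set 0 X {} c) = coefficient_sum c"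
  unfolding cellular_augmentation_def coefficient_sum_class by simp

lemma cellular_augmentation_hom:
  "cellular_augmentation \<in> hom (homology_group 0 X) integer_group"
proof (rule homI)
  fix h k
  assume "h \<in> carrier (homology_group 0 X)" "k \<in> carrier (homology_group 0 X)"
  then obtain a b where a: "h = homologous_rel_set 0 X {} a"
    and b: "k = homologous_rel_set 0 X {} b"
    by (auto simp: carrier_relative_homology_group_0)
  have "h \<otimes>\<^bsub>homology_group 0 X\<^esub> k = (\<Union>r\<in>h. \<Union>s\<in>k. {r + s})"
    using mult_relative_homology_group [of 0 X "{}"] by simp
  then have "coefficient_sum ` (h \<otimes>\<^bsub>homology_group 0 X\<^esub> k)
             = (\<Union>r\<in>coefficient_sum ` h. \<Union>s\<in>coefficient_sum ` k. {r + s})"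
    by (simp add: image_UN)
  also have "\<dots> = {coefficient_sum a + coefficient_sum b}"
    unfolding a b coefficient_sum_class by simp
  finally show "cellular_augmentation (h \<otimes>\<^bsub>homology_group 0 X\<^esub> k)
      = cellular_augmentation h \<otimes>\<^bsub>integer_group\<^esub> cellular_augmentation k"
    using cellular_augmentation [of X a] cellular_augmentation [of X b] a b
    by (simp add: cellular_augmentation_def)
qed auto

lemma cellular_augmentation_vertex_class:
  "cellular_augmentation (vertex_class X K {} x) = 1"
proof -
  have "skeleton K (-1) = {}"
    by (auto simp: skeleton_def)
  then show ?thesis
    by (simp add: vertex_class_def cellular_augmentation)
qed

section \<open>Borel--Moore cellular models\<close>

text \<open>The added point of the library's one-point compactification is \<open>None\<close>; the points of the
  0-skeleton are the vertices.\<close>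

definition finite_BM_structure :: "'a topology \<Rightarrow> 'a option cell set \<Rightarrow> bool" where
  "finite_BM_structure X M \<longleftrightarrow>
     finite_CW_structure (Alexandroff_compactification X) M \<and> None \<in> skeleton M 0"

definition BM_chain_group ::
    "'a topology \<Rightarrow> 'a option cell set \<Rightarrow> int \<Rightarrow> 'a option chain set monoid" where
  "BM_chain_group X M = cellular_chain_group (Alexandroff_compactification X) M {None}"

definition BM_boundary ::
    "'a topology \<Rightarrow> 'a option cell set \<Rightarrow> int \<Rightarrow> 'a option chain set \<Rightarrow> 'a option chain set" where
  "BM_boundary X M = cellular_boundary (Alexandroff_compactification X) M {None}"

end

theory Submission
  imports Defs
begin

text \<open>The one-point compactification of the infinite cone is a suspension: the point at distance
  \<open>r\<close> from the apex gets height \<open>r / (1 + r)\<close>, the apex has height 0, and the added point has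
  height 1. The locale \<open>suspension_coordinates\<close> records what such a description
  \<open>(x,t) \<mapsto> pt x t\<close> has to satisfy; \<open>suspension_coordinates_infinite_cone\<close> provides it for the compactified
  cone, and \<open>homeomorphic_suspension\<close> compares any two spaces with such coordinates by their quotient
  topologies.

  The cells of the model are the two poles together with \<open>e \<times> (0,1)\<close> for each cell \<open>e\<close> of \<open>L\<close>. So the
  \<open>(p+1)\<close>-skeleton is the suspension of the \<open>p\<close>-skeleton, and the chain groups of the model are the groups
  \<open>H\<^sub>k\<^sub>+\<^sub>1 (SA, SB)\<close> with \<open>A\<close>, \<open>B\<close> consecutive skeleta of \<open>L\<close>. The heart of the matter is the isomorphism
  \<open>H\<^sub>k (A, B) \<cong> H\<^sub>k\<^sub>+\<^sub>1 (SA, SB)\<close> in \<open>suspension_iso\<close>. It is a composite of excisions, homotopy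
  equivalences and the connecting map of a contractible cone, but on chains it is given by one formula:
  a singular simplex is coned off along the height coordinate, from the south pole up to the north pole.
  The boundary of that cone is a chain at the north pole minus the cone of the boundary. So the
  isomorphism anticommutes with the cellular differentials, and the signs \<open>(-1)\<^sup>k\<^sup>+\<^sup>1\<close> turn it into a
  chain isomorphism. In the lowest degree the cone of a vertex is a path from the south pole to the
  north pole; modulo the added point its boundary is minus the apex, which gives the augmentation.

  For the homology groups, \<open>cellular_homology\<close> identifies the homology of the cellular chains
  relative to some vertices with singular homology. It rests on the vanishing of
  \<open>H\<^sub>q (Z \<union> e, Z)\<close> for \<open>q\<close> different from the dimension of \<open>e\<close>. Singular homology relative to the north pole
  is the homology of a cone relative to its base, hence the reduced homology of \<open>L\<close> one degree lower
  (\<open>homology_suspension_mod_pole\<close>); in degree 0 this is the reduced homology of the nonempty space \<open>L\<close> in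
  degree \<open>-1\<close>, which vanishes.\<close>

section \<open>Tools from topology and relative homology\<close>

text \<open>Homotopies on a quotient space are defined upstairs. That the product of a quotient map with the interval
is again a quotient map is automatic for compact domains and Hausdorff targets.\<close>

lemma quotient_map_prod_interval:
  assumes "continuous_map X Y f" "compact_space X" "Hausdorff_space Y" "f ` topspace X = topspace Y"
  shows "quotient_map (prod_topology (top_of_set {0..1::real}) X) (prod_topology (top_of_set {0..1}) Y)
           (\<lambda>(s,x). (s, f x))"
proof (rule T1_Spaces.continuous_imp_quotient_map)
  show "continuous_map (prod_topology (top_of_set {0..1}) X) (prod_topology (top_of_set {0..1::real}) Y) (\<lambda>(s, x). (s, f x))"
    unfolding case_prod_beta
    by (intro continuous_map_pairedI continuous_map_fst continuous_map_compose [OF continuous_map_snd, unfolded o_def] assms)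
  show "compact_space (prod_topology (top_of_set {0..1::real}) X)"
    by (simp add: compact_space_prod_topology assms compact_space_subtopology)
  show "Hausdorff_space (prod_topology (top_of_set {0..1::real}) Y)"
    by (simp add: Hausdorff_space_prod_topology assms Hausdorff_space_subtopology)
  show "(\<lambda>(s, x). (s, f x)) ` topspace (prod_topology (top_of_set {0..1::real}) X)
      = topspace (prod_topology (top_of_set {0..1}) Y)"
    using assms(4) by (force simp: image_iff)
qed

lemma homotopic_with_pair_eq:
  fixes X :: "'a topology"
  assumes "homotopic_with (\<lambda>h. h \<in> T \<rightarrow> T) X X f g" and T: "T \<subseteq> topspace X"
    and "\<And>x. x \<in> topspace X \<Longrightarrow> f' x = f x" "\<And>x. x \<in> topspace X \<Longrightarrow> g' x = g x"
  shows "homotopic_with (\<lambda>h. h \<in> T \<rightarrow> T) X X f' g'"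
proof (rule homotopic_with_eq [OF assms(1) assms(3,4)])
  fix h k :: "'a \<Rightarrow> 'a" assume hk: "\<And>x. x \<in> topspace X \<Longrightarrow> h x = k x"
  have "h x = k x" if "x \<in> T" for x using hk that T by blast
  then show "(h \<in> T \<rightarrow> T) = (k \<in> T \<rightarrow> T)" by (simp add: Pi_iff)
qed

lemma nested_subtopology: "S \<subseteq> U \<Longrightarrow> subtopology (subtopology X U) S = subtopology X S"
  by (simp add: subtopology_subtopology Int_absorb1)

text \<open>All excisions below remove a closed set of levels of a real-valued function, so that the closure and
interior conditions of the excision axiom become conditions on sets of reals.\<close>

lemma excision_levels:
  assumes f: "continuous_map X euclideanreal f" and C: "closed C" "open V" "C \<subseteq> V"
    and T: "{x \<in> topspace X. f x \<in> V} \<subseteq> T" "T \<subseteq> topspace X"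
  shows "hom_induced p (subtopology X {x \<in> topspace X. f x \<notin> C}) {x \<in> T. f x \<notin> C} X T id
         \<in> iso (relative_homology_group p (subtopology X {x \<in> topspace X. f x \<notin> C}) {x \<in> T. f x \<notin> C})
               (relative_homology_group p X T)"
proof -
  let ?U = "{x \<in> topspace X. f x \<in> C}"
  have "closedin X ?U"
    using C by (intro closedin_continuous_map_preimage [OF f]) auto
  then have "X closure_of ?U = ?U" by (simp add: closure_of_eq)
  moreover have "openin X {x \<in> topspace X. f x \<in> V}"
    using C by (intro openin_continuous_map_preimage [OF f]) auto
  then have "{x \<in> topspace X. f x \<in> V} \<subseteq> X interior_of T"
    using T by (simp add: interior_of_maximal)
  ultimately have "X closure_of ?U \<subseteq> X interior_of T"
    using C by auto
  from homology_excision_axiom [OF this T(2), of p]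
  moreover have "topspace X - ?U = {x \<in> topspace X. f x \<notin> C}" "T - ?U = {x \<in> T. f x \<notin> C}"
    using T by auto
  ultimately show ?thesis by simp
qed

lemma homology_class_eqI:
  assumes "singular_chain p (subtopology X S) (a - b)"
  shows "homologous_rel_set p X S a = homologous_rel_set p X S b"
  unfolding homologous_rel_set_eq using singular_chain_imp_relboundary [OF assms] by (simp add: homologous_rel_def)

section \<open>Coordinates on a suspension\<close>

text \<open>These axioms describe \<open>W\<close> as an unreduced suspension without fixing a construction of it. The values at
heights 0 and 1 are constrained for all \<open>x\<close>, also outside \<open>L\<close>, so that formulas that
divide by zero at a pole still evaluate to the pole.\<close>

locale suspension_coordinates =
  fixes L :: "'a topology" and W :: "'w topology" and pt :: "'a \<Rightarrow> real \<Rightarrow> 'w" and south north :: 'w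
  assumes compact_base: "compact_space L" and Hausdorff_base: "Hausdorff_space L"
    and base_nonempty: "topspace L \<noteq> {}"
    and Hausdorff_W: "Hausdorff_space W"
    and continuous_pt: "continuous_map (prod_topology L (top_of_set {0..1})) W (\<lambda>(x,t). pt x t)"
    and surj_pt: "(\<lambda>(x,t). pt x t) ` (topspace L \<times> {0..1}) = topspace W"
    and pt_0 [simp]: "pt x 0 = south" and pt_1 [simp]: "pt x 1 = north"
    and south_ne_north [simp]: "south \<noteq> north"
    and pt_inj: "\<lbrakk>x \<in> topspace L; y \<in> topspace L; 0 < t; t < 1; 0 \<le> s; s \<le> 1; pt x t = pt y s\<rbrakk>
                   \<Longrightarrow> x = y \<and> t = s"
begin

text \<open>The height is determined everywhere, the base point only strictly between the poles; there \<open>base\<close> picks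
an arbitrary point of \<open>L\<close>.\<close>

definition height :: "'w \<Rightarrow> real" where
  "height w = (SOME t. \<exists>x\<in>topspace L. 0 \<le> t \<and> t \<le> 1 \<and> w = pt x t)"

definition base :: "'w \<Rightarrow> 'a" where
  "base w = (SOME x. x \<in> topspace L \<and> w = pt x (height w))"

lemma pt_in [simp]: "\<lbrakk>x \<in> topspace L; 0 \<le> t; t \<le> 1\<rbrakk> \<Longrightarrow> pt x t \<in> topspace W"
  using surj_pt by force

lemma height_pt [simp]:
  assumes "x \<in> topspace L" "0 \<le> t" "t \<le> 1" shows "height (pt x t) = t"
  unfolding height_def
proof (rule some_equality)
  fix s assume "\<exists>y\<in>topspace L. 0 \<le> s \<and> s \<le> 1 \<and> pt x t = pt y s"
  then obtain y where y: "y \<in> topspace L" "0 \<le> s" "s \<le> 1" "pt x t = pt y s" by blast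
  consider "0 < t" "t < 1" | "0 < s" "s < 1" | "t \<in> {0,1}" "s \<in> {0,1}" using assms y by fastforce
  then show "s = t"
  proof cases
    case 1 then show ?thesis using pt_inj [of x y t s] assms y by simp
  next
    case 2 then show ?thesis using pt_inj [of y x s t] assms y by simp
  next
    case 3 then show ?thesis using y south_ne_north by (auto simp del: south_ne_north)
  qed
qed (use assms in auto)

lemma height_base:
  assumes "w \<in> topspace W"
  shows "0 \<le> height w" "height w \<le> 1" "base w \<in> topspace L" "pt (base w) (height w) = w"
proof -
  have "\<exists>t. \<exists>x\<in>topspace L. 0 \<le> t \<and> t \<le> 1 \<and> w = pt x t"
    using assms surj_pt by (force simp: image_iff)
  from someI_ex [OF this] show "0 \<le> height w" "height w \<le> 1"
    unfolding height_def by auto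
  have "\<exists>x. x \<in> topspace L \<and> w = pt x (height w)"
    using assms surj_pt by (force simp: image_iff)
  from someI_ex [OF this] show "base w \<in> topspace L" "pt (base w) (height w) = w"
    unfolding base_def by auto
qed

lemma base_pt [simp]: "\<lbrakk>x \<in> topspace L; 0 < t; t < 1\<rbrakk> \<Longrightarrow> base (pt x t) = x"
  using pt_inj [of x "base (pt x t)" t "height (pt x t)"] height_base [of "pt x t"] by auto

lemma poles [simp]: "south \<in> topspace W" "north \<in> topspace W" "height south = 0" "height north = 1"
proof -
  obtain x where "x \<in> topspace L" using base_nonempty by blast
  then show "south \<in> topspace W" "north \<in> topspace W" "height south = 0" "height north = 1"
    using pt_in [of x 0] pt_in [of x 1] height_pt [of x 0] height_pt [of x 1] by auto
qed

lemma height_0: "w \<in> topspace W \<Longrightarrow> height w = 0 \<longleftrightarrow> w = south"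
  using height_base(4) [of w] by auto

lemma height_1: "w \<in> topspace W \<Longrightarrow> height w = 1 \<longleftrightarrow> w = north"
  using height_base(4) [of w] by auto

lemma quotient_pt: "quotient_map (prod_topology L (top_of_set {0..1})) W (\<lambda>(x,t). pt x t)"
  using continuous_pt surj_pt
  by (intro T1_Spaces.continuous_imp_quotient_map)
    (auto simp: compact_space_prod_topology compact_base compact_space_subtopology Hausdorff_W)

lemma continuous_height: "continuous_map W euclideanreal height"
proof (rule continuous_compose_quotient_map [OF quotient_pt])
  have "continuous_map (prod_topology L (top_of_set {0..1})) euclideanreal snd"
    using continuous_map_into_fulltopology continuous_map_snd by blast
  then show "continuous_map (prod_topology L (top_of_set {0..1})) euclideanreal (height \<circ> (\<lambda>(x,t). pt x t))"
    by (rule continuous_map_eq) auto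
qed

text \<open>Away from the poles the coordinates are unique, and the open part is a saturated open piece of the quotient.\<close>

lemma continuous_base: "continuous_map (subtopology W {w \<in> topspace W. 0 < height w \<and> height w < 1}) L base"
proof -
  let ?V = "{w \<in> topspace W. 0 < height w \<and> height w < 1}"
  have "openin W {w \<in> topspace W. height w \<in> {0<..<1}}"
    by (rule openin_continuous_map_preimage [OF continuous_height]) auto
  then have V: "openin W ?V" by simp
  have "quotient_map (subtopology (prod_topology L (top_of_set {0..1})) (topspace L \<times> {0<..<1}))
          (subtopology W ?V) (\<lambda>(x,t). pt x t)"
    by (rule quotient_map_restriction [OF quotient_pt]) (use V in auto)
  moreover have "continuous_map (subtopology (prod_topology L (top_of_set {0..1})) (topspace L \<times> {0<..<1})) L
      (base \<circ> (\<lambda>(x,t). pt x t))"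
    by (rule continuous_map_eq [OF continuous_map_from_subtopology [OF continuous_map_fst]]) auto
  ultimately show ?thesis
    by (rule continuous_compose_quotient_map)
qed

text \<open>A reparametrisation of the height that fixes 0 and 1 acts on \<open>W\<close>. All deformations of a suspension used
below are of this form.\<close>

definition slide :: "(real \<Rightarrow> real) \<Rightarrow> 'w \<Rightarrow> 'w" where
  "slide g w = pt (base w) (g (height w))"

text \<open>The suspension of a subset \<open>A\<close> of the base, always with both poles; in particular the suspension of the
empty set consists of the two poles.\<close>

definition sus :: "'a set \<Rightarrow> 'w set" where
  "sus A = {w \<in> topspace W. height w = 0 \<or> height w = 1 \<or> base w \<in> A}"

definition band :: "'a set \<Rightarrow> real set \<Rightarrow> 'w set" where
  "band A J = {w \<in> sus A. height w \<in> J}"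

lemma sus_subset [simp]: "sus A \<subseteq> topspace W"
  by (auto simp: sus_def)

lemma band_subset [simp]: "band A J \<subseteq> topspace W"
  by (auto simp: band_def sus_def)

lemma sus_topspace: "w \<in> sus A \<Longrightarrow> w \<in> topspace W"
  by (simp add: sus_def)

lemma sus_mono: "A \<subseteq> B \<Longrightarrow> sus A \<subseteq> sus B"
  by (auto simp: sus_def)

lemma sus_eq:
  assumes "A \<subseteq> topspace L"
  shows "sus A = {south, north} \<union> {pt x t | x t. x \<in> A \<and> 0 < t \<and> t < 1}"
proof (intro Set.set_eqI iffI)
  fix w assume w: "w \<in> sus A"
  then show "w \<in> {south, north} \<union> {pt x t | x t. x \<in> A \<and> 0 < t \<and> t < 1}"
    using height_base [of w] height_0 [of w] height_1 [of w] unfolding sus_def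
    by (smt (verit, best) Un_iff insert_iff mem_Collect_eq)
next
  fix w assume "w \<in> {south, north} \<union> {pt x t | x t. x \<in> A \<and> 0 < t \<and> t < 1}"
  then show "w \<in> sus A" using assms by (auto simp: sus_def subset_iff)
qed

lemma sus_empty: "sus {} = {south, north}"
  using sus_eq [of "{}"] by auto

lemma sus_all: "sus (topspace L) = topspace W"
  using height_base(3) by (auto simp: sus_def)

lemma slide_band:
  assumes "w \<in> band A J" and "g 0 = 0" "g 1 = 1" and "\<And>t. t \<in> J \<Longrightarrow> 0 \<le> t \<Longrightarrow> t \<le> 1 \<Longrightarrow> g t \<in> J' \<and> 0 \<le> g t \<and> g t \<le> 1"
  shows "slide g w \<in> band A J'"
proof -
  have w: "w \<in> topspace W" "height w \<in> J" "height w = 0 \<or> height w = 1 \<or> base w \<in> A"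
    using assms by (auto simp: band_def sus_def)
  have g: "g (height w) \<in> J'" "0 \<le> g (height w)" "g (height w) \<le> 1"
    using assms(4) w height_base [OF w(1)] by auto
  show ?thesis
    using g w assms(2,3) height_base [OF w(1)] unfolding slide_def band_def sus_def
    by (cases "g (height w) = 0 \<or> g (height w) = 1") auto
qed

lemma slide_id: "w \<in> topspace W \<Longrightarrow> g (height w) = height w \<Longrightarrow> slide g w = w"
  by (simp add: slide_def height_base)

lemma continuous_slide_homotopy:
  fixes g :: "real \<Rightarrow> real \<Rightarrow> real"
  assumes cont: "continuous_on ({0..1} \<times> {0..1}) (\<lambda>(s,t). g s t)"
    and range: "\<And>s t. \<lbrakk>0 \<le> s; s \<le> 1; 0 \<le> t; t \<le> 1\<rbrakk> \<Longrightarrow> 0 \<le> g s t \<and> g s t \<le> 1"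
    and ends: "\<And>s. \<lbrakk>0 \<le> s; s \<le> 1\<rbrakk> \<Longrightarrow> g s 0 = 0 \<and> g s 1 = 1"
  shows "continuous_map (prod_topology (top_of_set {0..1}) W) W (\<lambda>(s,w). slide (g s) w)"
proof -
  let ?I = "top_of_set {0..1::real}"
  let ?P = "prod_topology ?I (prod_topology L ?I)"
  have q: "quotient_map ?P (prod_topology ?I W) (\<lambda>(s,x). (s, (\<lambda>(x,t). pt x t) x))"
    by (rule quotient_map_prod_interval [OF continuous_pt _ Hausdorff_W])
      (use surj_pt in \<open>auto simp: compact_space_prod_topology compact_base compact_space_subtopology\<close>)
  have 1: "continuous_map ?P (top_of_set ({0..1} \<times> {0..1})) (\<lambda>z. (fst z, snd (snd z)))"
    by (simp add: subtopology_Times flip: prod_topology_subtopology_eu)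
       (intro continuous_map_pairedI continuous_map_fst
        continuous_map_compose [OF continuous_map_snd continuous_map_snd, unfolded o_def])
  have 2: "continuous_map (top_of_set ({0..1} \<times> {0..1})) ?I (\<lambda>(s,t). g s t)"
    using cont range by (auto simp: continuous_map_in_subtopology)
  have "continuous_map ?P ?I (\<lambda>z. g (fst z) (snd (snd z)))"
    using continuous_map_compose [OF 1 2] by (simp add: o_def)
  then have "continuous_map ?P (prod_topology L ?I) (\<lambda>z. (fst (snd z), g (fst z) (snd (snd z))))"
    by (intro continuous_map_pairedI continuous_map_compose [OF continuous_map_snd continuous_map_fst, unfolded o_def])
  from continuous_map_compose [OF this continuous_pt]
  have 3: "continuous_map ?P W (\<lambda>z. pt (fst (snd z)) (g (fst z) (snd (snd z))))"
    by (simp add: o_def)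
  have "continuous_map ?P W ((\<lambda>(s,w). slide (g s) w) \<circ> (\<lambda>(s,x). (s, (\<lambda>(x,t). pt x t) x)))"
  proof (rule continuous_map_eq [OF 3])
    fix z assume "z \<in> topspace ?P"
    then obtain s x t where z: "z = (s, x, t)" "0 \<le> s" "s \<le> 1" "x \<in> topspace L" "0 \<le> t" "t \<le> 1"
      by auto
    have "pt x (g s t) = slide (g s) (pt x t)"
      using z ends [of s] by (cases "t = 0 \<or> t = 1") (auto simp: slide_def)
    then show "pt (fst (snd z)) (g (fst z) (snd (snd z))) = ((\<lambda>(s,w). slide (g s) w) \<circ> (\<lambda>(s,x). (s, (\<lambda>(x,t). pt x t) x))) z"
      by (simp add: z)
  qed
  then show ?thesis
    by (rule continuous_compose_quotient_map [OF q])
qed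

text \<open>The homotopy interpolates linearly between the identity and \<open>c\<close> on the interval of heights. The last two
assumptions make it a homotopy of the pair \<open>(S, T)\<close>.\<close>

lemma slide_homotopic_id:
  assumes c: "continuous_on {0..1} c" "c 0 = 0" "c 1 = 1" "\<And>t. \<lbrakk>0 \<le> t; t \<le> 1\<rbrakk> \<Longrightarrow> 0 \<le> c t \<and> c t \<le> 1"
    and S: "S \<subseteq> topspace W" and T: "T \<subseteq> S"
    and mS: "\<And>s w. \<lbrakk>0 \<le> s; s \<le> 1; w \<in> S\<rbrakk> \<Longrightarrow> slide (\<lambda>t. (1 - s) * t + s * c t) w \<in> S"
    and mT: "\<And>s w. \<lbrakk>0 \<le> s; s \<le> 1; w \<in> T\<rbrakk> \<Longrightarrow> slide (\<lambda>t. (1 - s) * t + s * c t) w \<in> T"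
  shows "homotopic_with (\<lambda>h. h \<in> T \<rightarrow> T) (subtopology W S) (subtopology W S) (slide c) id"
proof (rule homotopic_with_symD)
  let ?g = "\<lambda>s t. (1 - s) * t + s * c t"
  have "continuous_on ({0..1} \<times> {0..1}) (\<lambda>(s,t). ?g s t)"
    unfolding case_prod_beta
    by (intro continuous_intros continuous_on_compose2 [OF c(1)]) auto
  then have cont: "continuous_map (prod_topology (top_of_set {0..1}) W) W (\<lambda>(s,w). slide (?g s) w)"
    by (rule continuous_slide_homotopy) (use c in \<open>auto simp: convex_bound_le\<close>)
  have "homotopic_with (\<lambda>h. h \<in> T \<rightarrow> T) (subtopology W S) (subtopology W S) (slide (?g 0)) (slide (?g 1))"
    unfolding homotopic_with_def
  proof (intro exI conjI)
    show "continuous_map (prod_topology (top_of_set {0..1}) (subtopology W S)) (subtopology W S) (\<lambda>(s,w). slide (?g s) w)"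
      using cont mS S by (auto simp: continuous_map_in_subtopology prod_topology_subtopology(2) intro: continuous_map_from_subtopology)
  qed (use mT in auto)
  then show "homotopic_with (\<lambda>h. h \<in> T \<rightarrow> T) (subtopology W S) (subtopology W S) id (slide c)"
    by (rule homotopic_with_eq) (use S T in \<open>auto simp: slide_id subset_iff Pi_iff\<close>)
qed

lemma continuous_slide:
  assumes c: "continuous_on {0..1} c" "c 0 = 0" "c 1 = 1" "\<And>t. \<lbrakk>0 \<le> t; t \<le> 1\<rbrakk> \<Longrightarrow> 0 \<le> c t \<and> c t \<le> 1"
  shows "continuous_map W W (slide c)"
proof -
  have "slide (\<lambda>t. (1 - s) * t + s * c t) w \<in> topspace W" if "0 \<le> s" "s \<le> 1" "w \<in> topspace W" for s w
    using c(4) [of "height w"] height_base [OF that(3)] that by (auto simp: slide_def convex_bound_le)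
  from slide_homotopic_id [OF c, where S = "topspace W" and T = "{}"] this
  show ?thesis using homotopic_with_imp_continuous_maps by fastforce
qed

end

section \<open>Coning singular chains\<close>

abbreviation simplex_space :: "nat \<Rightarrow> (nat \<Rightarrow> real) topology" where
  "simplex_space k \<equiv> subtopology (powertop_real UNIV) (standard_simplex k)"

text \<open>The simplex of dimension \<open>k + 1\<close> as the cone on the one of dimension \<open>k\<close>: vertex 0 is the cone point, and
\<open>u\<close> is the distance from it.\<close>

definition simplex_join :: "(nat \<Rightarrow> real) \<times> real \<Rightarrow> nat \<Rightarrow> real" where
  "simplex_join = (\<lambda>(y,u) i. case i of 0 \<Rightarrow> 1 - u | Suc j \<Rightarrow> u * y j)"

lemma opposite_face_coordinates:
  assumes "x \<in> standard_simplex (Suc k)" "x 0 < 1"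
  shows "(\<lambda>i. x (Suc i) / (1 - x 0)) \<in> standard_simplex k"
proof -
  have x: "\<And>i. 0 \<le> x i" "\<And>i. i > Suc k \<Longrightarrow> x i = 0" "sum x {..Suc k} = 1"
    using assms by (auto simp: standard_simplex_def)
  have s: "(\<Sum>i\<le>k. x (Suc i)) = 1 - x 0"
    using x(3) by (simp add: sum.atMost_Suc_shift del: sum.atMost_Suc)
  have "x (Suc i) \<le> 1 - x 0" for i
  proof (cases "i \<le> k")
    case True
    then have "x (Suc i) \<le> (\<Sum>i\<le>k. x (Suc i))"
      using x by (intro member_le_sum) auto
    then show ?thesis using s by simp
  qed (use x assms in auto)
  then show ?thesis
    using x s assms by (auto simp: standard_simplex_def simp flip: sum_divide_distrib)
qed

lemma simplex_join_in:
  assumes "y \<in> standard_simplex k" "0 \<le> u" "u \<le> 1"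
  shows "simplex_join (y,u) \<in> standard_simplex (Suc k)"
  using assms
  by (auto simp: standard_simplex_def simplex_join_def sum.atMost_Suc_shift mult_le_one
      simp flip: sum_distrib_left simp del: sum.atMost_Suc split: nat.splits)

lemma quotient_simplex_join:
  "quotient_map (prod_topology (simplex_space k) (top_of_set {0..1})) (simplex_space (Suc k)) simplex_join"
proof (rule T1_Spaces.continuous_imp_quotient_map)
  let ?P = "prod_topology (simplex_space k) (top_of_set {0..1::real})"
  have snd: "continuous_map ?P euclideanreal snd"
    using continuous_map_into_fulltopology continuous_map_snd by blast
  have fst: "continuous_map ?P (powertop_real UNIV) fst"
    using continuous_map_into_fulltopology continuous_map_fst by blast
  have "continuous_map ?P euclideanreal (\<lambda>z. fst z j)" for j
    using continuous_map_compose [OF fst continuous_map_product_projection [of j]] by (simp add: o_def)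
  then have "continuous_map ?P euclideanreal (\<lambda>z. simplex_join z i)" for i
    unfolding simplex_join_def case_prod_beta
    by (cases i) (auto intro!: continuous_intros snd)
  then have "continuous_map ?P (powertop_real UNIV) simplex_join"
    by (simp add: continuous_map_componentwise_UNIV del: euclidean_product_topology)
  then show "continuous_map ?P (simplex_space (Suc k)) simplex_join"
    by (auto simp: continuous_map_in_subtopology simplex_join_in)
  show "compact_space ?P"
    by (simp add: compact_space_prod_topology compact_space_subtopology compactin_standard_simplex
         del: euclidean_product_topology)
  show "Hausdorff_space (simplex_space (Suc k))"
    by (metis Hausdorff_space_euclidean Hausdorff_space_subtopology euclidean_product_topology)
  have "\<exists>z. z \<in> standard_simplex k \<times> {0..1} \<and> simplex_join z = x"
    if x: "x \<in> standard_simplex (Suc k)" for x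
  proof (cases "x 0 < 1")
    case True
    have "0 \<le> x 0" using x by (auto simp: standard_simplex_def)
    moreover have "simplex_join ((\<lambda>i. x (Suc i) / (1 - x 0)), 1 - x 0) = x"
      using True by (auto simp: simplex_join_def split: nat.splits)
    ultimately show ?thesis
      using opposite_face_coordinates [OF x True] True
      by (intro exI [of _ "((\<lambda>i. x (Suc i) / (1 - x 0)), 1 - x 0)"]) auto
  next
    case False
    then have x0: "x 0 = 1" using x by (auto simp: standard_simplex_def intro: antisym)
    have "x (Suc i) = 0" for i
    proof (cases "i \<le> k")
      case True
      have "(\<Sum>i\<le>k. x (Suc i)) = 0"
        using x x0 by (simp add: standard_simplex_def sum.atMost_Suc_shift del: sum.atMost_Suc)
      then show ?thesis using True x
        by (subst (asm) sum_nonneg_eq_0_iff) (auto simp: standard_simplex_def)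
    qed (use x in \<open>auto simp: standard_simplex_def\<close>)
    then have "simplex_join (y, 0) = x" for y
      using x0 by (auto simp: simplex_join_def split: nat.splits)
    then show ?thesis
      using nonempty_standard_simplex [of k] by fastforce
  qed
  then show "simplex_join ` topspace ?P = topspace (simplex_space (Suc k))"
    using simplex_join_in by (auto simp: image_iff) (metis mem_Sigma_iff atLeastAtMost_iff)
qed

lemma simplical_face_Suc_coordinates:
  "(\<lambda>j. simplical_face (Suc i) y (Suc j) / d) = simplical_face i (\<lambda>j. y (Suc j) / d)"
  for y :: "nat \<Rightarrow> real"
proof
  fix j
  have "Suc (j - 1) = j" if "i < j" using that by simp
  then show "simplical_face (Suc i) y (Suc j) / d = simplical_face i (\<lambda>j. y (Suc j) / d) j"
    by (cases j i rule: linorder_cases) (simp_all add: simplical_face_def)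
qed

context suspension_coordinates
begin

text \<open>The cone on a singular simplex of the base: vertex 0 goes to the south pole and the opposite face to
height \<open>c\<close>. For \<open>c = 1\<close> that face is collapsed to the north pole and the result is the suspension of
the simplex; for \<open>c = 1/2\<close> it is a cone inside the lower half. At vertex 0 the inner argument is a quotient
by zero, but the height is 0 there and the value is the south pole.\<close>

definition cone_simplex :: "real \<Rightarrow> nat \<Rightarrow> ((nat \<Rightarrow> real) \<Rightarrow> 'a) \<Rightarrow> (nat \<Rightarrow> real) \<Rightarrow> 'w" where
  "cone_simplex c k \<sigma> =
     restrict (\<lambda>x. pt (\<sigma> (\<lambda>i. x (Suc i) / (1 - x 0))) (c * (1 - x 0))) (standard_simplex (Suc k))"

definition cone_chain :: "real \<Rightarrow> nat \<Rightarrow> 'a chain \<Rightarrow> 'w chain" where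
  "cone_chain c k = frag_extend (frag_of \<circ> cone_simplex c k)"

lemma cone_chain_simps [simp]:
  "cone_chain c k 0 = 0" "cone_chain c k (frag_of \<sigma>) = frag_of (cone_simplex c k \<sigma>)"
  "cone_chain c k (a - b) = cone_chain c k a - cone_chain c k b"
  "cone_chain c k (frag_cmul n a) = frag_cmul n (cone_chain c k a)"
  by (simp_all add: cone_chain_def frag_extend_diff frag_extend_cmul)

lemma continuous_pt_at: "\<lbrakk>0 \<le> c; c \<le> 1\<rbrakk> \<Longrightarrow> continuous_map L W (\<lambda>x. pt x c)"
  using continuous_map_compose [OF _ continuous_pt, of L "\<lambda>x. (x, c)"] by (simp add: o_def continuous_map_paired)

text \<open>Continuity at the cone vertex holds because the simplex is a quotient of a cylinder.\<close>

lemma singular_simplex_cone: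
  assumes \<sigma>: "singular_simplex k (subtopology L A) \<sigma>" and c: "0 < c" "c \<le> 1"
  shows "singular_simplex (Suc k) (subtopology W (band A {0..c})) (cone_simplex c k \<sigma>)"
proof -
  let ?I = "top_of_set {0..1::real}" and ?D = "prod_topology (simplex_space k) (top_of_set {0..1::real})"
  have cs: "continuous_map (simplex_space k) L \<sigma>"
    using \<sigma> by (simp add: singular_simplex_def continuous_map_in_subtopology)
  have im: "\<sigma> y \<in> topspace L \<inter> A" if "y \<in> standard_simplex k" for y
    using \<sigma> continuous_map_image_subset_topspace [OF cs] that
    by (auto simp: singular_simplex_subtopology)
  have snd: "continuous_map ?D euclideanreal snd"
    using continuous_map_into_fulltopology continuous_map_snd by blast
  have "continuous_map ?D ?I (\<lambda>z. c * snd z)"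
    using c by (auto simp: continuous_map_in_subtopology mult_le_one intro!: continuous_intros snd)
  then have "continuous_map ?D (prod_topology L ?I) (\<lambda>z. (\<sigma> (fst z), c * snd z))"
    using continuous_map_compose [OF continuous_map_fst cs] by (intro continuous_map_pairedI) (auto simp: o_def)
  from continuous_map_compose [OF this continuous_pt]
  have cont: "continuous_map ?D W (\<lambda>z. pt (\<sigma> (fst z)) (c * snd z))"
    by (simp add: o_def)
  have "continuous_map ?D W (cone_simplex c k \<sigma> \<circ> simplex_join)"
  proof (rule continuous_map_eq [OF cont])
    fix z assume "z \<in> topspace ?D"
    then obtain y u where z: "z = (y,u)" "y \<in> standard_simplex k" "0 \<le> u" "u \<le> 1" by auto
    have "(\<lambda>i. simplex_join (y,u) (Suc i) / (1 - simplex_join (y,u) 0)) = y" if "u \<noteq> 0"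
      using that by (simp add: simplex_join_def)
    moreover have "1 - simplex_join (y,u) 0 = u" by (simp add: simplex_join_def)
    ultimately show "pt (\<sigma> (fst z)) (c * snd z) = (cone_simplex c k \<sigma> \<circ> simplex_join) z"
      using z simplex_join_in [of y k u] by (cases "u = 0") (simp_all add: cone_simplex_def)
  qed
  then have 1: "continuous_map (simplex_space (Suc k)) W (cone_simplex c k \<sigma>)"
    by (rule continuous_compose_quotient_map [OF quotient_simplex_join])
  have "cone_simplex c k \<sigma> x \<in> band A {0..c}" if x: "x \<in> standard_simplex (Suc k)" for x
  proof (cases "x 0 = 1")
    case True
    then show ?thesis using x c by (simp add: cone_simplex_def band_def sus_def)
  next
    case False
    then have x0: "x 0 < 1" "0 \<le> x 0" using x by (auto simp: standard_simplex_def order_less_le)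
    let ?y = "\<lambda>i. x (Suc i) / (1 - x 0)"
    have y: "\<sigma> ?y \<in> topspace L" "\<sigma> ?y \<in> A"
      using im opposite_face_coordinates [OF x] x0 by auto
    define t where "t = c * (1 - x 0)"
    have t: "0 < t" "t \<le> c" using x0 c by (auto simp: t_def mult_left_le)
    have "base (pt (\<sigma> ?y) t) = \<sigma> ?y" if "t \<noteq> 1"
      using t c y that by (intro base_pt) auto
    then have "pt (\<sigma> ?y) t \<in> band A {0..c}" using t c y by (cases "t = 1") (auto simp: band_def sus_def)
    then show ?thesis using x by (simp add: cone_simplex_def t_def)
  qed
  then show ?thesis
    using 1 by (auto simp: singular_simplex_def continuous_map_in_subtopology)
      (auto simp: cone_simplex_def)
qed

lemma singular_chain_cone:
  assumes "singular_chain k (subtopology L A) a" "0 < c" "c \<le> 1"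
  shows "singular_chain (Suc k) (subtopology W (band A {0..c})) (cone_chain c k a)"
  using assms unfolding cone_chain_def
  by (auto simp: singular_chain_def [of k] subset_iff singular_chain_of intro!: singular_chain_extend singular_simplex_cone)

lemma face_0_cone_simplex: "singular_face (Suc k) 0 (cone_simplex c k \<sigma>) = simplex_map k (\<lambda>x. pt x c) \<sigma>"
  using simplical_face_in_standard_simplex [of "Suc k" 0]
  by (auto simp: singular_face_def simplex_map_def cone_simplex_def simplical_face_def fun_eq_iff)

text \<open>Faces that contain the cone vertex are cones on the faces of the simplex. Together with the facts on the
remaining faces this yields the boundary formulas.\<close>

lemma face_Suc_cone_simplex:
  assumes "i \<le> Suc m"
  shows "singular_face (Suc (Suc m)) (Suc i) (cone_simplex c (Suc m) \<sigma>)
         = cone_simplex c m (singular_face (Suc m) i \<sigma>)"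
proof
  fix y :: "nat \<Rightarrow> real"
  show "singular_face (Suc (Suc m)) (Suc i) (cone_simplex c (Suc m) \<sigma>) y
         = cone_simplex c m (singular_face (Suc m) i \<sigma>) y"
  proof (cases "y \<in> standard_simplex (Suc m)")
    case y: True
    have f: "simplical_face (Suc i) y \<in> standard_simplex (Suc (Suc m))"
      using simplical_face_in_standard_simplex [of "Suc (Suc m)" "Suc i" y] y assms by simp
    have y0: "simplical_face (Suc i) y 0 = y 0" by (simp add: simplical_face_def)
    show ?thesis
    proof (cases "y 0 = 1")
      case True
      then show ?thesis using y f y0 by (simp add: singular_face_def cone_simplex_def)
    next
      case False
      then have "y 0 < 1" using y by (auto simp: standard_simplex_def order_less_le)
      from opposite_face_coordinates [OF y this] show ?thesis
        using y f y0 by (simp add: singular_face_def cone_simplex_def simplical_face_Suc_coordinates)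
    qed
  qed (simp add: singular_face_def cone_simplex_def)
qed

lemma face_1_cone_vertex:
  "singular_face (Suc 0) (Suc 0) (cone_simplex c 0 \<sigma>) = simplex_map 0 (\<lambda>_. south) \<sigma>"
  using simplical_face_in_standard_simplex [of "Suc 0" "Suc 0"]
  by (auto simp: singular_face_def simplex_map_def cone_simplex_def simplical_face_def standard_simplex_0 fun_eq_iff)

lemma boundary_cone_chain_0:
  "chain_boundary (Suc 0) (cone_chain c 0 a) = chain_map 0 (\<lambda>x. pt x c) a - chain_map 0 (\<lambda>_. south) a"
proof -
  have "Poly_Mapping.keys a \<subseteq> UNIV" by simp
  then show ?thesis
  proof (induction a rule: frag_induction)
    case (one \<sigma>)
    then show ?case
      by (simp add: chain_boundary_of face_0_cone_simplex face_1_cone_vertex)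
  qed (simp_all add: chain_boundary_diff chain_map_diff)
qed

lemma boundary_cone_chain_Suc:
  "chain_boundary (Suc (Suc m)) (cone_chain c (Suc m) a)
     = chain_map (Suc m) (\<lambda>x. pt x c) a - cone_chain c m (chain_boundary (Suc m) a)"
proof -
  have "Poly_Mapping.keys a \<subseteq> UNIV" by simp
  then show ?thesis
  proof (induction a rule: frag_induction)
    case (one \<sigma>)
    have "chain_boundary (Suc (Suc m)) (cone_chain c (Suc m) (frag_of \<sigma>))
       = frag_of (singular_face (Suc (Suc m)) 0 (cone_simplex c (Suc m) \<sigma>)) +
         (\<Sum>i\<le>Suc m. frag_cmul ((-1) ^ Suc i) (frag_of (singular_face (Suc (Suc m)) (Suc i) (cone_simplex c (Suc m) \<sigma>))))"
      by (simp add: chain_boundary_of sum.atMost_Suc_shift del: sum.atMost_Suc power_Suc)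
    also have "(\<Sum>i\<le>Suc m. frag_cmul ((-1) ^ Suc i) (frag_of (singular_face (Suc (Suc m)) (Suc i) (cone_simplex c (Suc m) \<sigma>))))
       = (\<Sum>i\<le>Suc m. - cone_chain c m (frag_cmul ((-1) ^ i) (frag_of (singular_face (Suc m) i \<sigma>))))"
      by (rule sum.cong) (auto simp: face_Suc_cone_simplex)
    also have "\<dots> = - cone_chain c m (chain_boundary (Suc m) (frag_of \<sigma>))"
      by (simp add: chain_boundary_of sum_negf cone_chain_def frag_extend_sum o_def del: sum.atMost_Suc)
    finally show ?case by (simp add: face_0_cone_simplex)
  qed (simp_all add: chain_boundary_diff chain_map_diff)
qed

text \<open>Degree 0, where the subtracted term sits at the south pole, and positive degree, where it is the cone of
the boundary, are treated uniformly: in either case it lies over \<open>B\<close>.\<close>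

lemma boundary_cone_relcycle:
  assumes "singular_relcycle k (subtopology L A) B a" "0 < c" "c \<le> 1"
  obtains e where "chain_boundary (Suc k) (cone_chain c k a) = chain_map k (\<lambda>x. pt x c) a - e"
    "singular_chain k (subtopology W (band B {0..c})) e"
proof (cases k)
  case 0
  have "singular_chain 0 (subtopology W (band B {0..c})) (chain_map 0 (\<lambda>_. south) a)"
    using assms by (intro singular_chain_chain_map [of 0 "subtopology L A"])
     (auto simp: singular_relcycle 0 continuous_map_in_subtopology band_def sus_def)
  then show ?thesis using that boundary_cone_chain_0 [of c a] by (simp add: 0)
next
  case (Suc m)
  have "singular_chain m (subtopology L B) (chain_boundary (Suc m) a)"
    using assms unfolding singular_relcycle Suc
    by (metis (no_types, lifting) diff_Suc_1 inf_le2 singular_chain_mono subtopology_subtopology)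
  then show ?thesis using that boundary_cone_chain_Suc [of m c a] singular_chain_cone assms by (simp add: Suc)
qed

lemma pt_sus: "\<lbrakk>x \<in> topspace L; x \<in> A; 0 \<le> t; t \<le> 1\<rbrakk> \<Longrightarrow> pt x t \<in> sus A"
  by (cases "t = 0 \<or> t = 1") (auto simp: sus_def)

section \<open>The suspension isomorphism\<close>

text \<open>Under \<open>stretch\<close> a cone of height 1/2 becomes a suspension. Flattening a band with \<open>clamp\<close> retracts it
to the base at height 1/2, and \<open>shrink\<close> contracts the open cone of height 3/4 to the south pole.\<close>

definition stretch :: "real \<Rightarrow> real" where "stretch t = min 1 (2 * t)"
definition clamp :: "real \<Rightarrow> real" where "clamp t = max (min (2 * t) (1/2)) (2 * t - 1)"
definition shrink :: "real \<Rightarrow> real" where "shrink t = max 0 (4 * t - 3)"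

lemma stretch: "continuous_on {0..1} stretch" "stretch 0 = 0" "stretch 1 = 1"
   "\<lbrakk>0 \<le> t; t \<le> 1\<rbrakk> \<Longrightarrow> 0 \<le> stretch t \<and> stretch t \<le> 1"
  and clamp: "continuous_on {0..1} clamp" "clamp 0 = 0" "clamp 1 = 1"
   "\<lbrakk>0 \<le> t; t \<le> 1\<rbrakk> \<Longrightarrow> 0 \<le> clamp t \<and> clamp t \<le> 1"
  and shrink: "continuous_on {0..1} shrink" "shrink 0 = 0" "shrink 1 = 1"
   "\<lbrakk>0 \<le> t; t \<le> 1\<rbrakk> \<Longrightarrow> 0 \<le> shrink t \<and> shrink t \<le> 1"
  unfolding stretch_def clamp_def shrink_def by (auto intro!: continuous_intros)

lemma slide_mix_band:
  assumes w: "w \<in> band A J" and s: "0 \<le> s" "s \<le> 1" and c: "c 0 = 0" "c 1 = 1"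
    "\<And>t. \<lbrakk>0 \<le> t; t \<le> 1\<rbrakk> \<Longrightarrow> 0 \<le> c t \<and> c t \<le> 1"
    and J: "convex J" "\<And>t. \<lbrakk>t \<in> J; 0 \<le> t; t \<le> 1\<rbrakk> \<Longrightarrow> c t \<in> J"
  shows "slide (\<lambda>t. (1 - s) * t + s * c t) w \<in> band A J"
proof (rule slide_band [OF w])
  fix t :: real assume t: "t \<in> J" "0 \<le> t" "t \<le> 1"
  have "(1 - s) * t + s * c t \<in> J"
    using convexD_alt [OF J(1) t(1) J(2) [OF t] s] by simp
  then show "(1 - s) * t + s * c t \<in> J \<and> 0 \<le> (1 - s) * t + s * c t \<and> (1 - s) * t + s * c t \<le> 1"
    using t s c by (auto simp: convex_bound_le)
qed (use c in auto)

lemma slide_mix_sus: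
  assumes "w \<in> sus A" "0 \<le> s" "s \<le> 1" "c 0 = 0" "c 1 = 1"
    "\<And>t. \<lbrakk>0 \<le> t; t \<le> 1\<rbrakk> \<Longrightarrow> 0 \<le> c t \<and> c t \<le> 1"
  shows "slide (\<lambda>t. (1 - s) * t + s * c t) w \<in> sus A"
  using slide_mix_band [of w A UNIV s c] assms by (auto simp: band_def)

lemma continuous_map_slide_band:
  assumes "continuous_on {0..1} c" "c 0 = 0" "c 1 = 1" "\<And>t. \<lbrakk>0 \<le> t; t \<le> 1\<rbrakk> \<Longrightarrow> 0 \<le> c t \<and> c t \<le> 1"
    and "S \<subseteq> topspace W" "slide c \<in> S \<rightarrow> T"
  shows "continuous_map (subtopology W S) (subtopology W T) (slide c)"
  using continuous_slide [OF assms(1-4)] assms(5,6)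
  by (auto simp: continuous_map_in_subtopology continuous_map_from_subtopology)

lemma continuous_map_subtopology_id: "S \<subseteq> T \<Longrightarrow> continuous_map (subtopology W S) (subtopology W T) id"
  by (auto simp: continuous_map_in_subtopology)

text \<open>Stretching is inverse to the inclusion \<open>(SA, T) \<subseteq> (SA, T')\<close> up to homotopy of pairs, provided that
\<open>T'\<close> is pushed into \<open>T\<close>.\<close>

lemma iso_stretch:
  assumes T: "T \<subseteq> T'" "T' \<subseteq> sus A" "slide stretch \<in> T' \<rightarrow> T"
    and mT: "\<And>s w. \<lbrakk>0 \<le> s; s \<le> 1; w \<in> T\<rbrakk> \<Longrightarrow> slide (\<lambda>t. (1 - s) * t + s * stretch t) w \<in> T"
    and mT': "\<And>s w. \<lbrakk>0 \<le> s; s \<le> 1; w \<in> T'\<rbrakk> \<Longrightarrow> slide (\<lambda>t. (1 - s) * t + s * stretch t) w \<in> T'"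
  shows "hom_induced p (subtopology W (sus A)) T' (subtopology W (sus A)) T (slide stretch)
     \<in> iso (relative_homology_group p (subtopology W (sus A)) T') (relative_homology_group p (subtopology W (sus A)) T)"
proof (rule homotopy_equivalence_relative_homology_group_isomorphism [where g = id])
  have mS: "slide (\<lambda>t. (1 - s) * t + s * stretch t) w \<in> sus A" if "0 \<le> s" "s \<le> 1" "w \<in> sus A" for s w
    by (rule slide_mix_sus) (use that stretch in auto)
  have "slide stretch w \<in> sus A" if "w \<in> sus A" for w
    using mS [of 1 w] that by simp
  then show "continuous_map (subtopology W (sus A)) (subtopology W (sus A)) (slide stretch)"
    by (intro continuous_map_slide_band stretch) auto
  show "homotopic_with (\<lambda>h. h \<in> T' \<rightarrow> T') (subtopology W (sus A)) (subtopology W (sus A)) (id \<circ> slide stretch) id"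
    unfolding id_o using T mS mT' by (intro slide_homotopic_id stretch) auto
  show "homotopic_with (\<lambda>h. h \<in> T \<rightarrow> T) (subtopology W (sus A)) (subtopology W (sus A)) (slide stretch \<circ> id) id"
    unfolding o_id using T mS mT by (intro slide_homotopic_id stretch) auto
qed (use T in auto)

lemma contractible_lower: "contractible_space (subtopology W (band A {..<3/4}))"
proof -
  let ?P = "band A {..<3/4}"
  have "homotopic_with (\<lambda>h. h \<in> {} \<rightarrow> {}) (subtopology W ?P) (subtopology W ?P) (slide shrink) id"
    by (intro slide_homotopic_id shrink slide_mix_band) (auto simp: shrink_def)
  then have "homotopic_with (\<lambda>h. True) (subtopology W ?P) (subtopology W ?P) (slide shrink) id"
    by simp
  then have "homotopic_with (\<lambda>h. True) (subtopology W ?P) (subtopology W ?P) (\<lambda>_. south) id"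
    by (rule homotopic_with_eq) (auto simp: slide_def shrink_def band_def sus_def)
  then show ?thesis
    unfolding contractible_space_def using homotopic_with_symD by blast
qed

lemma iso_base_in_middle_band:
  assumes B: "B \<subseteq> A" and A: "A \<subseteq> topspace L"
  shows "hom_induced p (subtopology L A) B
           (subtopology W (band B {1/4<..<3/4} \<union> band A {1/2..<3/4})) (band B {1/4<..<3/4}) (\<lambda>x. pt x (1/2))
     \<in> iso (relative_homology_group p (subtopology L A) B)
           (relative_homology_group p (subtopology W (band B {1/4<..<3/4} \<union> band A {1/2..<3/4})) (band B {1/4<..<3/4}))"
proof (rule homotopy_equivalence_relative_homology_group_isomorphism [where g = base])
  let ?E = "band B {1/4<..<3/4} \<union> band A {1/2..<3/4}" and ?EB = "band B {1/4<..<3/4}"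
  have E: "?E \<subseteq> {w \<in> topspace W. 0 < height w \<and> height w < 1}" by (auto simp: band_def sus_def)
  have bA: "base w \<in> A" if "w \<in> ?E" for w using that B by (auto simp: band_def sus_def)
  show "continuous_map (subtopology L A) (subtopology W ?E) (\<lambda>x. pt x (1/2))"
    by (auto simp: continuous_map_in_subtopology continuous_map_from_subtopology continuous_pt_at band_def sus_def)
  show "(\<lambda>x. pt x (1/2)) \<in> B \<rightarrow> ?EB"
    using A B by (auto simp: band_def sus_def subset_iff)
  have "continuous_map (subtopology W ?E) L base"
    using continuous_map_from_subtopology_mono [OF continuous_base E] .
  then show "continuous_map (subtopology W ?E) (subtopology L A) base"
    unfolding continuous_map_in_subtopology using bA by simp
  show "base \<in> ?EB \<rightarrow> B" by (auto simp: band_def sus_def)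
  show "homotopic_with (\<lambda>h. h \<in> B \<rightarrow> B) (subtopology L A) (subtopology L A) (base \<circ> (\<lambda>x. pt x (1/2))) id"
  proof (rule homotopic_with_pair_eq)
    show "homotopic_with (\<lambda>h. h \<in> B \<rightarrow> B) (subtopology L A) (subtopology L A) id id" by simp
    show "B \<subseteq> topspace (subtopology L A)" using A B by auto
  qed auto
  have "homotopic_with (\<lambda>k. k \<in> ?EB \<rightarrow> ?EB) (subtopology W ?E) (subtopology W ?E) (slide clamp) id"
  proof (intro slide_homotopic_id clamp)
    fix s :: real and w assume s: "0 \<le> s" "s \<le> 1"
    have 1: "slide (\<lambda>t. (1 - s) * t + s * clamp t) w \<in> ?EB" if "w \<in> ?EB"
      using that s clamp by (intro slide_mix_band) (auto simp: clamp_def)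
    have 2: "slide (\<lambda>t. (1 - s) * t + s * clamp t) w \<in> band A {1/2..<3/4}" if "w \<in> band A {1/2..<3/4}"
      using that s clamp by (intro slide_mix_band) (auto simp: clamp_def)
    show "slide (\<lambda>t. (1 - s) * t + s * clamp t) w \<in> ?E" if "w \<in> ?E" using that 1 2 by blast
    show "slide (\<lambda>t. (1 - s) * t + s * clamp t) w \<in> ?EB" if "w \<in> ?EB" using that 1 by blast
  qed auto
  then show "homotopic_with (\<lambda>k. k \<in> ?EB \<rightarrow> ?EB) (subtopology W ?E) (subtopology W ?E) ((\<lambda>x. pt x (1/2)) \<circ> base) id"
  proof (rule homotopic_with_pair_eq)
    fix w assume "w \<in> topspace (subtopology W ?E)"
    then have "clamp (height w) = 1/2" by (auto simp: band_def clamp_def)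
    then show "((\<lambda>x. pt x (1/2)) \<circ> base) w = slide clamp w" by (simp only: slide_def o_def)
  qed (use band_subset in auto)
qed

text \<open>Excising the lower part of the cone on \<open>B\<close> leaves a collar of \<open>B\<close> below a band over \<open>A\<close>. The collar makes the
excision legitimate for an arbitrary subset \<open>B\<close>, without a neighbourhood of \<open>B\<close> in \<open>A\<close>.\<close>

lemma iso_include_base:
  assumes B: "B \<subseteq> A" and A: "A \<subseteq> topspace L"
  shows "hom_induced p (subtopology L A) B
           (subtopology W (band B {..<3/4} \<union> band A {1/2..<3/4})) (band B {..<3/4}) (\<lambda>x. pt x (1/2))
     \<in> iso (relative_homology_group p (subtopology L A) B)
           (relative_homology_group p (subtopology W (band B {..<3/4} \<union> band A {1/2..<3/4})) (band B {..<3/4}))"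
    (is "hom_induced p _ _ (subtopology W ?Y) ?PB ?m \<in> _")
proof -
  let ?E = "band B {1/4<..<3/4} \<union> band A {1/2..<3/4}" and ?EB = "band B {1/4<..<3/4}"
  let ?X = "subtopology W ?Y"
  have "hom_induced p (subtopology ?X {w \<in> topspace ?X. height w \<notin> {..1/4}}) {w \<in> ?PB. height w \<notin> {..1/4}} ?X ?PB id
         \<in> iso (relative_homology_group p (subtopology ?X {w \<in> topspace ?X. height w \<notin> {..1/4}}) {w \<in> ?PB. height w \<notin> {..1/4}})
               (relative_homology_group p ?X ?PB)"
  proof (rule excision_levels [where V = "{..<1/2}"])
    show "continuous_map ?X euclideanreal height"
      by (rule continuous_map_from_subtopology [OF continuous_height])
    show "{w \<in> topspace ?X. height w \<in> {..<1/2}} \<subseteq> ?PB" "?PB \<subseteq> topspace ?X"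
      using band_subset by (auto simp: band_def)
  qed auto
  moreover have "{w \<in> ?PB. height w \<notin> {..1/4}} = ?EB" by (auto simp: band_def)
  moreover have "subtopology ?X {w \<in> topspace ?X. height w \<notin> {..1/4}} = subtopology W ?E"
  proof -
    have "?Y \<inter> {w \<in> topspace ?X. height w \<notin> {..1/4}} = ?E" by (auto simp: band_def dest: sus_topspace)
    then show ?thesis by (simp only: subtopology_subtopology)
  qed
  ultimately have exc: "hom_induced p (subtopology W ?E) ?EB ?X ?PB id
         \<in> iso (relative_homology_group p (subtopology W ?E) ?EB) (relative_homology_group p ?X ?PB)"
    by (simp only:)
  have "hom_induced p (subtopology L A) B ?X ?PB (id \<circ> ?m)
       = hom_induced p (subtopology W ?E) ?EB ?X ?PB id \<circ> hom_induced p (subtopology L A) B (subtopology W ?E) ?EB ?m"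
  proof (rule hom_induced_compose)
    show "continuous_map (subtopology L A) (subtopology W ?E) ?m"
      by (auto simp: continuous_map_in_subtopology continuous_map_from_subtopology continuous_pt_at band_def sus_def)
    have "B \<subseteq> topspace L" using A B by blast
    then show "?m \<in> B \<rightarrow> ?EB" by (auto simp: band_def sus_def subset_iff)
    show "continuous_map (subtopology W ?E) (subtopology W ?Y) id"
      by (rule continuous_map_subtopology_id) (auto simp: band_def)
  qed (auto simp: band_def)
  then show ?thesis
    using iso_set_trans [OF iso_base_in_middle_band [OF assms] exc] by (simp only: id_o)
qed

lemma iso_excise_top:
  assumes B: "T \<subseteq> sus A" "band A {1/2..} \<subseteq> T"
  shows "hom_induced p (subtopology W (band A {..<3/4})) {w \<in> T. height w < 3/4} (subtopology W (sus A)) T id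
    \<in> iso (relative_homology_group p (subtopology W (band A {..<3/4})) {w \<in> T. height w < 3/4})
          (relative_homology_group p (subtopology W (sus A)) T)"
proof -
  let ?X = "subtopology W (sus A)"
  have "hom_induced p (subtopology ?X {w \<in> topspace ?X. height w \<notin> {3/4..}}) {w \<in> T. height w \<notin> {3/4..}} ?X T id
         \<in> iso (relative_homology_group p (subtopology ?X {w \<in> topspace ?X. height w \<notin> {3/4..}}) {w \<in> T. height w \<notin> {3/4..}})
               (relative_homology_group p ?X T)"
    proof (rule excision_levels [where V = "{1/2<..}"])
    show "{w \<in> topspace ?X. height w \<in> {1/2<..}} \<subseteq> T" using assms(2) by (force simp: band_def sus_def)
    show "T \<subseteq> topspace ?X" using assms(1) by (force simp: band_def sus_def)
  qed (auto simp: continuous_map_from_subtopology continuous_height)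
  moreover have "{w \<in> T. height w \<notin> {3/4..}} = {w \<in> T. height w < 3/4}" by auto
  moreover have "subtopology ?X {w \<in> topspace ?X. height w \<notin> {3/4..}} = subtopology W (band A {..<3/4})"
  proof -
    have "sus A \<inter> {w \<in> topspace ?X. height w \<notin> {3/4..}} = band A {..<3/4}" by (auto simp: band_def dest: sus_topspace)
    then show ?thesis by (simp only: subtopology_subtopology)
  qed
  ultimately show ?thesis by simp
qed

text \<open>This relates the cone that lives in the lower half, where the isomorphisms are visible, to the
suspension of the chain.\<close>

lemma stretch_cone_chain:
  assumes "singular_chain k (subtopology L A) a"
  shows "chain_map (Suc k) (slide stretch) (cone_chain (1/2) k a) = cone_chain 1 k a"
  using assms unfolding singular_chain_def
proof (induction a rule: frag_induction)
  case (one \<sigma>)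
  have im: "\<sigma> y \<in> topspace L" if "y \<in> standard_simplex k" for y
    using one that by (auto simp: singular_simplex_def continuous_map_in_subtopology continuous_map_def Pi_iff)
  have "simplex_map (Suc k) (slide stretch) (cone_simplex (1/2) k \<sigma>) x = cone_simplex 1 k \<sigma> x" for x
  proof (cases "x \<in> standard_simplex (Suc k)")
    case x: True
    show ?thesis
    proof (cases "x 0 = 1")
      case True
      then show ?thesis using x by (simp add: simplex_map_def cone_simplex_def slide_def stretch_def)
    next
      case False
      then have x0: "x 0 < 1" "0 \<le> x 0" using x by (auto simp: standard_simplex_def order_less_le)
      have "\<sigma> (\<lambda>i. x (Suc i) / (1 - x 0)) \<in> topspace L"
        using im opposite_face_coordinates [OF x x0(1)] by blast
      then show ?thesis
        using x x0 by (simp add: simplex_map_def cone_simplex_def slide_def stretch_def flip: right_diff_distrib_numeral)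
    qed
  qed (simp add: simplex_map_def cone_simplex_def)
  then have "simplex_map (Suc k) (slide stretch) (cone_simplex (1/2) k \<sigma>) = cone_simplex 1 k \<sigma>" by (rule ext)
  then show ?case by simp
qed (simp_all add: chain_map_diff)

text \<open>The isomorphism is the composite
\<open>H\<^sub>k (A, B) \<cong> H\<^sub>k (C, P\<^sub>B) \<cong> H\<^sub>k\<^sub>+\<^sub>1 (P\<^sub>A, C) \<cong> H\<^sub>k\<^sub>+\<^sub>1 (SA, SB \<union> Q) \<cong> H\<^sub>k\<^sub>+\<^sub>1 (SA, SB)\<close>.
Here \<open>P\<^sub>A\<close>, \<open>P\<^sub>B\<close> are the open cones on \<open>A\<close>, \<open>B\<close> of height 3/4, \<open>Q\<close> is the upper half of \<open>SA\<close>, and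
\<open>C\<close> is the union of \<open>P\<^sub>B\<close> with the part of \<open>P\<^sub>A\<close> in the upper half. The maps are inclusion of the base at height 1/2, the inverse
of the connecting map (an isomorphism because the cones are contractible), excision of the top, and
stretching. The formula on chains is what makes it compatible with boundary maps: the connecting map
sends the half-height cone of \<open>c\<close> to \<open>c\<close> at height 1/2.\<close>

theorem suspension_iso:
  assumes B: "B \<subseteq> A" and A: "A \<subseteq> topspace L"
  obtains \<Phi> where "\<Phi> \<in> iso (relative_homology_group (int k) (subtopology L A) B)
                              (relative_homology_group (int k + 1) (subtopology W (sus A)) (sus B))"
    "\<And>c. singular_relcycle k (subtopology L A) B c \<Longrightarrow>
       \<Phi> (homologous_rel_set k (subtopology L A) B c)
         = homologous_rel_set (Suc k) (subtopology W (sus A)) (sus B) (cone_chain 1 k c)"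
proof -
  let ?LA = "subtopology L A" and ?SA = "subtopology W (sus A)"
  let ?P = "band A {..<3/4}" and ?PB = "band B {..<3/4}" and ?R = "band A {1/2..<3/4}" and ?Q = "band A {1/2..}"
  let ?Y = "?PB \<union> ?R" and ?q = "int k + 1"
  let ?m = "\<lambda>x. pt x (1/2)"
  have YP: "?Y \<subseteq> ?P" "?PB \<subseteq> ?P" using sus_mono [OF B] by (auto simp: band_def)
  have subs: "subtopology (subtopology W ?P) ?Y = subtopology W ?Y" "subtopology (subtopology W ?P) ?PB = subtopology W ?PB"
    using YP by (simp_all add: subtopology_subtopology Int_absorb1)
  let ?\<psi> = "hom_induced ?q ?SA (sus B \<union> ?Q) ?SA (sus B) (slide stretch)"
  let ?e = "hom_induced ?q (subtopology W ?P) ?Y ?SA (sus B \<union> ?Q) id"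
  let ?d = "hom_relboundary ?q (subtopology W ?P) ?Y ?PB"
  let ?j = "hom_induced (int k) ?LA B (subtopology W ?Y) ?PB ?m"
  have sB: "sus B \<subseteq> sus A" using sus_mono [OF B] by blast
  have mixB: "slide (\<lambda>t. (1 - s) * t + s * stretch t) w \<in> sus B" if "0 \<le> s" "s \<le> 1" "w \<in> sus B" for s w
    using that stretch by (intro slide_mix_sus) auto
  have mixQ: "slide (\<lambda>t. (1 - s) * t + s * stretch t) w \<in> ?Q" if "0 \<le> s" "s \<le> 1" "w \<in> ?Q" for s w
    using that stretch by (intro slide_mix_band) (auto simp: stretch_def)
  have psi: "?\<psi> \<in> iso (relative_homology_group ?q ?SA (sus B \<union> ?Q)) (relative_homology_group ?q ?SA (sus B))"
  proof (rule iso_stretch)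
    show "slide stretch \<in> sus B \<union> ?Q \<rightarrow> sus B"
    proof (rule Pi_I)
      fix w assume "w \<in> sus B \<union> ?Q"
      then show "slide stretch w \<in> sus B"
        using mixB [of 1 w] by (auto simp: slide_def stretch_def band_def sus_def)
    qed
  qed (use sB mixB mixQ in \<open>auto simp: band_def\<close>)
  have "{w \<in> sus B \<union> ?Q. height w < 3/4} = ?Y" by (auto simp: band_def)
  with iso_excise_top [of "sus B \<union> ?Q" A ?q] sB
  have e: "?e \<in> iso (relative_homology_group ?q (subtopology W ?P) ?Y) (relative_homology_group ?q ?SA (sus B \<union> ?Q))"
    by (simp add: band_def)
  have d: "?d \<in> iso (relative_homology_group ?q (subtopology W ?P) ?Y) (relative_homology_group (int k) (subtopology W ?Y) ?PB)"
  proof -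
    have "?d \<in> iso (relative_homology_group ?q (subtopology W ?P) ?Y)
                   (relative_homology_group (?q - 1) (subtopology (subtopology W ?P) ?Y) ?PB)"
    proof (rule iso_hom_relboundary_contractible)
      show "contractible_space (subtopology (subtopology W ?P) ?PB)"
        unfolding subs by (rule contractible_lower)
      have "south \<in> ?PB" "south \<in> ?P" by (simp_all add: band_def sus_def)
      then have "south \<in> topspace (subtopology W ?P) \<inter> ?PB" by simp
      then show "topspace (subtopology W ?P) \<inter> ?PB \<noteq> {}" by blast
    qed (rule contractible_lower, rule Un_upper1)
    then show ?thesis unfolding subs by (simp only: add_diff_cancel_right')
  qed
  have j: "?j \<in> iso (relative_homology_group (int k) ?LA B) (relative_homology_group (int k) (subtopology W ?Y) ?PB)"
    by (rule iso_include_base [OF assms])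
  let ?D = "inv_into (carrier (relative_homology_group ?q (subtopology W ?P) ?Y)) ?d"
  have D: "?D \<in> iso (relative_homology_group (int k) (subtopology W ?Y) ?PB) (relative_homology_group ?q (subtopology W ?P) ?Y)"
    using d by (rule group.iso_set_sym [OF group_relative_homology_group])
  define \<Phi> where "\<Phi> = ?\<psi> \<circ> (?e \<circ> (?D \<circ> ?j))"
  show thesis
  proof
    show "\<Phi> \<in> iso (relative_homology_group (int k) ?LA B) (relative_homology_group ?q ?SA (sus B))"
      unfolding \<Phi>_def by (rule iso_set_trans [OF iso_set_trans [OF iso_set_trans [OF j D] e] psi])
    fix c assume c: "singular_relcycle k ?LA B c"
    then have cc: "singular_chain k ?LA c" by (simp add: singular_relcycle)
    let ?z = "cone_chain (1/2) k c"
    obtain e' where e': "chain_boundary (Suc k) ?z = chain_map k ?m c - e'"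
      "singular_chain k (subtopology W (band B {0..1/2})) e'"
      using boundary_cone_relcycle [OF c, of "1/2"] by auto
    have e'B: "singular_chain k (subtopology W ?PB) e'"
      using e'(2) by (rule singular_chain_mono) (auto simp: band_def)
    have cm: "continuous_map ?LA (subtopology W ?R) ?m"
      by (auto simp: continuous_map_in_subtopology continuous_map_from_subtopology continuous_pt_at band_def sus_def)
    have mc: "singular_chain k (subtopology W ?R) (chain_map k ?m c)"
      using singular_chain_chain_map [OF cc cm] .
    have bz: "singular_chain k (subtopology W ?Y) (chain_boundary (Suc k) ?z)"
      unfolding e'(1) using mc e'B
      by (meson Un_upper1 Un_upper2 singular_chain_diff singular_chain_mono)
    have "singular_chain (Suc k) (subtopology W (band A {0..1/2})) ?z"
      by (rule singular_chain_cone [OF cc]) auto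
    then have "singular_chain (Suc k) (subtopology W ?P) ?z"
      by (rule singular_chain_mono) (auto simp: band_def)
    then have z: "singular_relcycle (Suc k) (subtopology W ?P) ?Y ?z"
      unfolding singular_relcycle using bz by (simp add: subs)
    then have zcar: "homologous_rel_set (Suc k) (subtopology W ?P) ?Y ?z \<in> carrier (relative_homology_group ?q (subtopology W ?P) ?Y)"
    proof -
      have "?q = int (Suc k)" by simp
      then show ?thesis using z by (simp only: carrier_relative_homology_group) blast
    qed
    have ccyc: "singular_relcycle k (subtopology W ?Y) {} (chain_boundary (Suc k) ?z)"
      using bz z chain_boundary_boundary [of "Suc k" "subtopology W ?P" ?z] by (simp add: singular_cycle singular_relcycle)
    have "?d (homologous_rel_set (Suc k) (subtopology W ?P) ?Y ?z)
        = homologous_rel_set k (subtopology W ?Y) ?PB (chain_boundary (Suc k) ?z)"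
      using hom_boundary_chain_boundary [OF z] ccyc
      by (simp add: hom_relboundary_def subs add.commute hom_induced_chain_map_gen chain_map_ident [OF bz])
    also have "\<dots> = homologous_rel_set k (subtopology W ?Y) ?PB (chain_map k ?m c)"
    proof -
      have "subtopology (subtopology W ?Y) ?PB = subtopology W ?PB"
        by (simp add: subtopology_subtopology Int_absorb1)
      then show ?thesis
        unfolding e'(1) using e'B by (intro homology_class_eqI) (simp add: singular_chain_minus)
    qed
    also have "\<dots> = ?j (homologous_rel_set k ?LA B c)"
    proof (rule hom_induced_chain_map [symmetric])
      show "continuous_map ?LA (subtopology W ?Y) ?m" using cm by (auto simp: continuous_map_in_subtopology)
      show "?m \<in> B \<rightarrow> ?PB" using A B by (auto simp: band_def sus_def subset_iff)
    qed (rule c)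
    \<comment> \<open>The cone of height 1/2 therefore represents the preimage under the connecting map.\<close>
    finally have dz: "?d (homologous_rel_set (Suc k) (subtopology W ?P) ?Y ?z) = ?j (homologous_rel_set k ?LA B c)" .
    have "inj_on ?d (carrier (relative_homology_group ?q (subtopology W ?P) ?Y))"
      using d unfolding iso_iff by blast
    then have "?D (?j (homologous_rel_set k ?LA B c)) = homologous_rel_set (Suc k) (subtopology W ?P) ?Y ?z"
      unfolding dz [symmetric] using zcar by (rule inv_into_f_f)
    moreover have "?e (homologous_rel_set (Suc k) (subtopology W ?P) ?Y ?z) = homologous_rel_set (Suc k) ?SA (sus B \<union> ?Q) ?z"
    proof -
      have "?e (homologous_rel_set (Suc k) (subtopology W ?P) ?Y ?z) = homologous_rel_set (Suc k) ?SA (sus B \<union> ?Q) (chain_map (Suc k) id ?z)"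
        using hom_induced_chain_map [OF continuous_map_subtopology_id [of ?P "sus A"], of ?Y "sus B \<union> ?Q", OF _ _ z]
        by (auto simp: band_def add.commute)
      then show ?thesis using z chain_map_ident singular_relcycle by metis
    qed
    moreover have "?\<psi> (homologous_rel_set (Suc k) ?SA (sus B \<union> ?Q) ?z) = homologous_rel_set (Suc k) ?SA (sus B) (cone_chain 1 k c)"
    proof -
      have "singular_relcycle (Suc k) ?SA (sus B \<union> ?Q) (chain_map (Suc k) id ?z)"
        by (rule singular_relcycle_chain_map [OF z continuous_map_subtopology_id]) (auto simp: band_def)
      then have z': "singular_relcycle (Suc k) ?SA (sus B \<union> ?Q) ?z"
        using z chain_map_ident singular_relcycle by metis
      have 1: "slide stretch \<in> sus B \<union> ?Q \<rightarrow> sus B"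
        using mixB [of 1] by (auto simp: slide_def stretch_def band_def sus_def)
      have "slide stretch w \<in> sus A" if "w \<in> sus A" for w
        using slide_mix_sus [of w A 1 stretch] that stretch by simp
      then have 2: "continuous_map ?SA ?SA (slide stretch)"
        by (intro continuous_map_slide_band stretch) auto
      show ?thesis
        using hom_induced_chain_map [OF 2 1 z'] stretch_cone_chain [OF cc] by (simp add: add.commute)
    qed
    ultimately show "\<Phi> (homologous_rel_set k ?LA B c) = homologous_rel_set (Suc k) ?SA (sus B) (cone_chain 1 k c)"
      unfolding \<Phi>_def by simp
  qed
qed

end

section \<open>Disks\<close>

text \<open>The carrier of the disk inside the function space, so that its topology is that of a subset of a topological
type and continuity can be argued coordinatewise.\<close>

definition disk_set :: "nat \<Rightarrow> (nat \<Rightarrow> real) set" where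
  "disk_set n = {x. (\<forall>i\<ge>n. x i = 0) \<and> L2_set x {..<n} \<le> 1}"

lemma disk_eq: "disk n = top_of_set (disk_set n)"
proof -
  have "{x. \<forall>i\<ge>n. x i = 0} \<inter> {x. (\<Sum>i<n. (x i)\<^sup>2) \<le> 1} = disk_set n"
    by (auto simp: disk_set_def L2_set_def)
  then show ?thesis
    by (simp add: disk_def Euclidean_space_def subtopology_subtopology euclidean_product_topology)
qed

lemma topspace_disk [simp]: "topspace (disk n) = disk_set n"
  by (simp add: disk_eq)

lemma disk_interior_eq: "disk_interior n = {x \<in> disk_set n. L2_set x {..<n} < 1}"
  by (auto simp: disk_interior_def disk_set_def topspace_Euclidean_space L2_set_def)

lemma disk_boundary_eq: "disk_boundary n = {x \<in> disk_set n. L2_set x {..<n} = 1}"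
  by (auto simp: disk_boundary_def disk_set_def topspace_Euclidean_space L2_set_def)

lemma disk_dichotomy:
  "x \<in> disk_set n \<Longrightarrow> L2_set x {..<n} = 1 \<and> x \<in> disk_boundary n \<or> L2_set x {..<n} < 1 \<and> x \<in> disk_interior n"
  by (auto simp: disk_interior_eq disk_boundary_eq disk_set_def)

lemma disk_set_eq: "disk_set n = disk_interior n \<union> disk_boundary n"
  using disk_dichotomy by (auto simp: disk_interior_eq disk_boundary_eq)

lemma continuous_on_L2_set:
  assumes "\<And>i. i \<in> I \<Longrightarrow> continuous_on S (\<lambda>x. f x i)"
  shows "continuous_on S (\<lambda>x. L2_set (f x) I)"
  unfolding L2_set_def by (rule continuous_on_real_sqrt, rule continuous_on_sum, rule continuous_on_power, rule assms)

lemma continuous_on_coordinate: "continuous_on S (\<lambda>x::nat \<Rightarrow> real. x i)"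
  by (rule continuous_on_subset [OF continuous_on_product_coordinates]) simp

lemma compact_disk_set: "compact (disk_set n)"
proof -
  have "closed {x::nat \<Rightarrow> real. x i = 0}" for i
    by (rule closed_Collect_eq [OF continuous_on_coordinate continuous_on_const])
  then have "closed ((\<Inter>i\<in>{n..}. {x::nat \<Rightarrow> real. x i = 0}) \<inter> {x. L2_set x {..<n} \<le> 1})"
    by (intro closed_Int closed_INT ballI closed_Collect_le continuous_on_L2_set continuous_on_coordinate continuous_on_const)
  also have "(\<Inter>i\<in>{n..}. {x::nat \<Rightarrow> real. x i = 0}) \<inter> {x. L2_set x {..<n} \<le> 1} = disk_set n"
    by (auto simp: disk_set_def)
  finally have cl: "closed (disk_set n)" .
  have "compactin (powertop_real UNIV) (UNIV \<rightarrow>\<^sub>E {-1..1})"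
    by (simp add: compactin_PiE)
  then have "compact (UNIV \<rightarrow>\<^sub>E {-1..1::real} :: (nat \<Rightarrow> real) set)"
    by (simp add: euclidean_product_topology)
  moreover have "x i \<in> {-1..1}" if "x \<in> disk_set n" for x i
  proof (cases "i < n")
    case True
    have "\<bar>x i\<bar> \<le> L2_set (\<lambda>i. \<bar>x i\<bar>) {..<n}"
      using True by (intro member_le_L2_set) auto
    also have "\<dots> = L2_set x {..<n}" by (simp add: L2_set_def)
    finally show ?thesis using that by (auto simp: disk_set_def)
  qed (use that in \<open>auto simp: disk_set_def\<close>)
  then have "disk_set n \<subseteq> (UNIV \<rightarrow>\<^sub>E {-1..1})" by auto
  ultimately show ?thesis using cl compact_Int_closed by (metis inf.absorb_iff2)
qed

lemma compact_disk: "compact_space (disk n)"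
  by (simp add: disk_eq compact_space_subtopology compact_disk_set)

lemma Hausdorff_disk: "Hausdorff_space (disk n)"
  by (simp add: disk_eq Hausdorff_space_subtopology)

lemma L2_set_scale: "L2_set (\<lambda>i. c * x i) A = \<bar>c\<bar> * L2_set x A"
  using L2_set_right_distrib [of "\<bar>c\<bar>" x A] by (simp add: L2_set_def abs_mult power_mult_distrib)

lemma contractible_disk: "contractible_space (disk n)"
proof -
  have "homotopic_with (\<lambda>x. True) (disk n) (disk n) id (\<lambda>x. (\<lambda>i. 0))"
    unfolding homotopic_with_def
  proof (intro exI conjI)
    have "(\<lambda>i. (1 - s) * x i) \<in> disk_set n" if "0 \<le> s" "s \<le> 1" "x \<in> disk_set n" for s x
      using that by (auto simp: disk_set_def L2_set_scale mult_le_one)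
    moreover have "continuous_on ({0..1} \<times> disk_set n) (\<lambda>z i. (1 - fst z) * snd z i)"
      by (intro continuous_on_coordinatewise_then_product continuous_on_mult continuous_on_diff continuous_on_const
          continuous_on_fst continuous_on_id continuous_on_product_then_coordinatewise [OF continuous_on_snd])
    ultimately show "continuous_map (prod_topology (top_of_set {0..1::real}) (disk n)) (disk n) (\<lambda>z i. (1 - fst z) * snd z i)"
      by (auto simp: disk_eq continuous_map_in_subtopology simp flip: subtopology_Times)
  qed auto
  then show ?thesis unfolding contractible_space_def by blast
qed

lemma disk_boundary_0: "disk_boundary 0 = {}"
  by (auto simp: disk_boundary_def)

text \<open>The disk is contractible, so this is the reduced homology of the sphere one degree lower. In dimension 0
the boundary is empty and the disk is a point.\<close>

lemma trivial_homology_disk_mod_boundary: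
  assumes "p \<noteq> int n"
  shows "trivial_group (relative_homology_group p (disk n) (disk_boundary n))"
proof (cases n)
  case 0
  have "topspace (disk 0) = {\<lambda>_. 0}" by (auto simp: disk_set_def)
  then show ?thesis
    using homology_dimension_axiom [of "disk 0"] assms by (simp add: 0 disk_boundary_0)
next
  case (Suc m)
  have "{x. (\<Sum>i<n. (x i)\<^sup>2) \<le> 1} \<inter> disk_boundary n
        = topspace (Euclidean_space n) \<inter> {x. (\<Sum>i\<le>m. (x i)\<^sup>2) = 1}"
    by (auto simp: disk_boundary_def Suc lessThan_Suc_atMost)
  then have "subtopology (disk n) (disk_boundary n) = nsphere m"
    by (simp add: disk_def nsphere_def subtopology_subtopology subtopology_restrict Suc)
  moreover have "(\<lambda>i. if i = 0 then 1 else 0) \<in> disk_boundary n"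
    by (auto simp: disk_boundary_def topspace_Euclidean_space Suc sum.lessThan_Suc_shift simp del: sum.lessThan_Suc)
  then have "topspace (disk n) \<inter> disk_boundary n \<noteq> {}"
    by (auto simp: disk_set_eq)
  ultimately have "relative_homology_group p (disk n) (disk_boundary n) \<cong> reduced_homology_group (p - 1) (nsphere m)"
    using isomorphic_group_relative_homology_of_contractible [OF contractible_disk] by metis
  moreover have "trivial_group (reduced_homology_group (p - 1) (nsphere m))"
    using assms by (simp add: trivial_reduced_homology_group_nsphere Suc)
  ultimately show ?thesis
    using isomorphic_group_triviality by (metis group_reduced_homology_group group_relative_homology_group)
qed

section \<open>Attaching a cell\<close>

text \<open>The topology of a space obtained by attaching a cell: it is the quotient of the closed part and the disk.\<close>

lemma continuous_map_closed_image_cover: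
  assumes Z: "closedin T Z" and f: "continuous_map D T f" "compact_space D" "Hausdorff_space T"
    and cover: "topspace T = Z \<union> f ` topspace D"
    and g: "continuous_map (subtopology T Z) Y g" "continuous_map D Y (g \<circ> f)"
  shows "continuous_map T Y g"
  unfolding continuous_map_closedin
proof (intro conjI strip)
  show "g \<in> topspace T \<rightarrow> topspace Y"
  proof (rule Pi_I)
    fix w assume w: "w \<in> topspace T"
    show "g w \<in> topspace Y"
    proof (cases "w \<in> Z")
      case True
      then show ?thesis using continuous_map_image_subset_topspace [OF g(1)] w by auto
    next
      case False
      then show ?thesis using continuous_map_image_subset_topspace [OF g(2)] w cover by auto
    qed
  qed
  fix C assume C: "closedin Y C"
  have "closedin T {x \<in> Z. g x \<in> C}"
  proof -
    have "closedin T {x \<in> topspace (subtopology T Z). g x \<in> C}"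
      by (rule closedin_trans_full [OF closedin_continuous_map_preimage [OF g(1) C] Z])
    then show ?thesis using closedin_subset [OF Z] by (simp add: Int_absorb1)
  qed
  moreover have "closed_map D T f" using continuous_imp_closed_map f by blast
  then have "closedin T (f ` {x \<in> topspace D. g (f x) \<in> C})"
    using closedin_continuous_map_preimage [OF g(2) C] by (simp add: closed_map_def)
  moreover have "{x \<in> topspace T. g x \<in> C} = {x \<in> Z. g x \<in> C} \<union> f ` {x \<in> topspace D. g (f x) \<in> C}"
    unfolding cover by auto
  ultimately show "closedin T {x \<in> topspace T. g x \<in> C}" by (simp add: closedin_Un)
qed

text \<open>\<open>T\<close> arises from the closed subset \<open>Z\<close> by attaching one cell of dimension \<open>n\<close>.\<close>

locale cell_attachment =
  fixes T :: "'a topology" and Z :: "'a set" and n :: nat and \<phi> :: "(nat \<Rightarrow> real) \<Rightarrow> 'a"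
  assumes Hausdorff: "Hausdorff_space T" and closed: "closedin T Z"
    and characteristic: "continuous_map (disk n) T \<phi>" "inj_on \<phi> (disk_interior n)"
    and boundary: "\<phi> ` disk_boundary n \<subseteq> Z"
    and disjoint: "\<phi> ` disk_interior n \<inter> Z = {}"
    and cover: "topspace T = Z \<union> \<phi> ` disk_interior n"
begin

abbreviation rad :: "(nat \<Rightarrow> real) \<Rightarrow> real" where "rad x \<equiv> L2_set x {..<n}"

definition coords :: "'a \<Rightarrow> nat \<Rightarrow> real" where "coords = the_inv_into (disk_interior n) \<phi>"

text \<open>The distance from the centre of the cell, extended by 1 over \<open>Z\<close>, and the radial push that moves everything
at radius at least 1/2 into \<open>Z\<close>.\<close>

definition radius :: "'a \<Rightarrow> real" where "radius w = (if w \<in> Z then 1 else rad (coords w))"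

definition scale :: "real \<Rightarrow> (nat \<Rightarrow> real) \<Rightarrow> nat \<Rightarrow> real" where
  "scale s x = (\<lambda>i. ((1 - s) + s / max (rad x) (1/2)) * x i)"

definition push :: "real \<Rightarrow> 'a \<Rightarrow> 'a" where
  "push s w = (if w \<in> Z then w else \<phi> (scale s (coords w)))"

lemma cover': "topspace T = Z \<union> \<phi> ` topspace (disk n)"
  using cover boundary by (auto simp: disk_set_eq)

lemma point_off_Z:
  assumes "w \<in> topspace T" "w \<notin> Z" obtains x where "x \<in> disk_set n" "w = \<phi> x"
proof -
  have "w \<in> Z \<union> \<phi> ` disk_set n" using assms(1) unfolding cover' topspace_disk .
  then show thesis using assms(2) that by blast
qed

lemma coords: "x \<in> disk_interior n \<Longrightarrow> coords (\<phi> x) = x"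
  unfolding coords_def by (rule the_inv_into_f_f [OF characteristic(2)])

lemma in_Z_iff: "x \<in> disk_set n \<Longrightarrow> \<phi> x \<in> Z \<longleftrightarrow> rad x = 1"
  using boundary disjoint disk_dichotomy [of x n] by auto

lemma radius: "x \<in> disk_set n \<Longrightarrow> radius (\<phi> x) = rad x"
  using in_Z_iff [of x] coords [of x] disk_dichotomy [of x n] by (auto simp: radius_def)

text \<open>With \<open>r\<close> the radius of \<open>x\<close>, the new radius interpolates between \<open>r\<close> and the minimum of 1 and \<open>2 * r\<close>. The maximum with 1/2
in the definition keeps the scaling factor continuous at the centre.\<close>

lemma rad_scale:
  assumes "0 \<le> s" "s \<le> 1" "rad x \<le> 1"
  shows "rad x \<le> rad (scale s x)" "rad (scale s x) \<le> 1"
proof -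
  define r where "r = rad x"
  have r: "0 \<le> r" "r \<le> 1" using assms by (auto simp: r_def)
  define q where "q = r / max r (1/2)"
  have q: "r \<le> q" "q \<le> 1" using r by (auto simp: q_def field_simps max_def)
  have "rad (scale s x) = \<bar>(1 - s) + s / max r (1/2)\<bar> * r"
    unfolding scale_def L2_set_scale r_def ..
  also have "\<bar>(1 - s) + s / max r (1/2)\<bar> = (1 - s) + s / max r (1/2)" using assms by simp
  also have "\<dots> * r = (1 - s) * r + s * q" by (simp add: q_def algebra_simps)
  finally have eq: "rad (scale s x) = (1 - s) * r + s * q" .
  have "(1 - s) * r + s * r \<le> (1 - s) * r + s * q"
    using q assms by (intro add_left_mono mult_left_mono)
  then show "rad x \<le> rad (scale s x)" unfolding eq by (simp add: r_def algebra_simps)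
  show "rad (scale s x) \<le> 1" unfolding eq using r q assms by (simp add: convex_bound_le)
qed

lemma scale_in: "\<lbrakk>0 \<le> s; s \<le> 1; x \<in> disk_set n\<rbrakk> \<Longrightarrow> scale s x \<in> disk_set n"
  using rad_scale [of s x] by (auto simp: disk_set_def scale_def)

lemma push: "\<lbrakk>x \<in> disk_set n\<rbrakk> \<Longrightarrow> push s (\<phi> x) = \<phi> (scale s x)"
proof (cases "rad x = 1")
  case True
  then have "scale s x = x" by (simp add: scale_def)
  then show "x \<in> disk_set n \<Longrightarrow> ?thesis" using in_Z_iff [of x] True by (simp add: push_def)
next
  case False
  then show "x \<in> disk_set n \<Longrightarrow> ?thesis" using in_Z_iff [of x] coords [of x] disk_dichotomy [of x n]
    by (auto simp: push_def)
qed

lemma continuous_radius: "continuous_map T euclideanreal radius"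
proof (rule continuous_map_closed_image_cover [OF closed characteristic(1) compact_disk Hausdorff cover'])
  show "continuous_map (subtopology T Z) euclideanreal radius"
    by (rule continuous_map_eq [where f = "\<lambda>_. 1"]) (auto simp: radius_def)
  have "continuous_on (disk_set n) (\<lambda>x. rad x)"
    by (intro continuous_on_L2_set continuous_on_coordinate)
  then have "continuous_map (disk n) euclideanreal (\<lambda>x. rad x)" by (simp add: disk_eq)
  then show "continuous_map (disk n) euclideanreal (radius \<circ> \<phi>)"
    by (rule continuous_map_eq) (simp add: radius)
qed

lemma continuous_push: "continuous_map (prod_topology (top_of_set {0..1}) T) T (\<lambda>(s,w). push s w)"
proof (rule continuous_map_closed_image_cover)
  let ?I = "top_of_set {0..1::real}"
  show "closedin (prod_topology ?I T) ({0..1} \<times> Z)"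
    using closed by (simp add: closedin_prod_Times_iff)
  show "continuous_map (prod_topology ?I (disk n)) (prod_topology ?I T) (\<lambda>z. (fst z, \<phi> (snd z)))"
    using continuous_map_compose [OF continuous_map_snd characteristic(1)]
    by (intro continuous_map_pairedI continuous_map_fst) (simp add: o_def)
  show "compact_space (prod_topology ?I (disk n))"
    by (simp add: compact_space_prod_topology compact_disk compact_space_subtopology)
  show "Hausdorff_space (prod_topology ?I T)"
    by (simp add: Hausdorff_space_prod_topology Hausdorff Hausdorff_space_subtopology)
  show "topspace (prod_topology ?I T) = {0..1} \<times> Z \<union> (\<lambda>z. (fst z, \<phi> (snd z))) ` topspace (prod_topology ?I (disk n))"
    using cover' by force
  have "continuous_map (subtopology (prod_topology ?I T) ({0..1} \<times> Z)) T snd"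
    by (rule continuous_map_from_subtopology [OF continuous_map_snd])
  then show "continuous_map (subtopology (prod_topology ?I T) ({0..1} \<times> Z)) T (\<lambda>(s,w). push s w)"
    by (rule continuous_map_eq) (auto simp: push_def)
  have rad: "continuous_on ({0..1} \<times> disk_set n) (\<lambda>z. L2_set (snd z) {..<n})"
    by (intro continuous_on_L2_set continuous_on_product_then_coordinatewise [OF continuous_on_snd] continuous_on_id)
  have "continuous_on ({0..1} \<times> disk_set n) (\<lambda>z. scale (fst z) (snd z))"
    unfolding scale_def
    by (intro continuous_on_coordinatewise_then_product continuous_on_mult continuous_on_add continuous_on_diff continuous_on_divide
        continuous_on_const continuous_on_fst continuous_on_id continuous_on_max rad
        continuous_on_product_then_coordinatewise [OF continuous_on_snd]) (auto simp: max_def)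
  then have "continuous_map (prod_topology ?I (disk n)) (disk n) (\<lambda>z. scale (fst z) (snd z))"
    using scale_in by (auto simp: disk_eq continuous_map_in_subtopology simp flip: subtopology_Times)
  from continuous_map_compose [OF this characteristic(1)]
  have "continuous_map (prod_topology ?I (disk n)) T (\<lambda>z. \<phi> (scale (fst z) (snd z)))"
    by (simp add: o_def)
  then show "continuous_map (prod_topology ?I (disk n)) T ((\<lambda>(s,w). push s w) \<circ> (\<lambda>z. (fst z, \<phi> (snd z))))"
    by (rule continuous_map_eq) (auto simp: push)
qed

text \<open>The right-hand side does not mention \<open>Z\<close>: the radial push enlarges \<open>Z\<close> by the outer half of the cell, and
excising everything of radius at least 3/4 leaves a piece of the open cell, on which the characteristic map is
an embedding.\<close>

lemma homology_isomorphic_annulus: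
  "relative_homology_group p T Z
     \<cong> relative_homology_group p (subtopology (disk n) {x \<in> disk_set n. rad x < 3/4}) {x \<in> disk_set n. 1/2 \<le> rad x \<and> rad x < 3/4}"
proof -
  let ?Z' = "{w \<in> topspace T. 1/2 \<le> radius w}"
  have ZT: "Z \<subseteq> topspace T" using cover by blast
  have ZZ': "Z \<subseteq> ?Z'" using ZT by (auto simp: radius_def)
  have push_T: "push s w \<in> topspace T" and push_radius: "radius w \<le> radius (push s w)"
    if "0 \<le> s" "s \<le> 1" and wT: "w \<in> topspace T" for s w
  proof -
    have "push s w \<in> topspace T \<and> radius w \<le> radius (push s w)"
    proof (cases "w \<in> Z")
      case False
      then obtain x where x: "x \<in> disk_set n" "w = \<phi> x" using point_off_Z [of w] wT by auto
      then show ?thesis using scale_in [of s x] that cover' rad_scale [of s x]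
        by (auto simp: push radius disk_set_def)
    qed (use that in \<open>auto simp: push_def\<close>)
    then show "push s w \<in> topspace T" "radius w \<le> radius (push s w)" by auto
  qed
  have push1: "push 1 w \<in> Z" if wT: "w \<in> ?Z'" for w
  proof (cases "w \<in> Z")
    case False
    then obtain x where x: "x \<in> disk_set n" "w = \<phi> x" using point_off_Z [of w] wT by auto
    then have "1/2 \<le> rad x" using wT by (simp add: radius)
    moreover have "rad (scale 1 x) = \<bar>(1 - 1) + 1 / max (rad x) (1/2)\<bar> * rad x"
      unfolding scale_def L2_set_scale ..
    ultimately have "rad (scale 1 x) = 1" by (simp add: max_absorb1)
    then show ?thesis using x in_Z_iff scale_in [of 1 x] by (simp add: push)
  qed (auto simp: push_def)
  have hom: "homotopic_with (\<lambda>h. h \<in> S \<rightarrow> S) T T (push 1) id"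
    if "\<And>s w. \<lbrakk>0 \<le> s; s \<le> 1; w \<in> S\<rbrakk> \<Longrightarrow> push s w \<in> S" "S \<subseteq> topspace T" for S
  proof (rule homotopic_with_symD)
    have 1: "homotopic_with (\<lambda>h. h \<in> S \<rightarrow> S) T T (push 0) (push 1)"
      unfolding homotopic_with_def
      using continuous_push that by (intro exI [of _ "\<lambda>(s,w). push s w"]) auto
    have 0: "push 0 w = w" if wT: "w \<in> topspace T" for w
    proof (cases "w \<in> Z")
      case False
      then obtain x where x: "x \<in> disk_set n" "w = \<phi> x" using point_off_Z [of w] wT by auto
      then show ?thesis by (simp add: push) (simp add: scale_def)
    qed (simp add: push_def)
    show "homotopic_with (\<lambda>h. h \<in> S \<rightarrow> S) T T id (push 1)"
      by (rule homotopic_with_pair_eq [OF 1]) (use that 0 in auto)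
  qed
  have a: "relative_homology_group p T ?Z' \<cong> relative_homology_group p T Z"
  proof (rule homotopy_equivalent_space_imp_isomorphic_relative_homology_groups)
    show "homotopic_with (\<lambda>h. h \<in> ?Z' \<rightarrow> ?Z') T T (id \<circ> push 1) id"
      unfolding id_o using push_T push_radius by (intro hom) (auto intro: order_trans)
    show h: "homotopic_with (\<lambda>h. h \<in> Z \<rightarrow> Z) T T (push 1 \<circ> id) id"
      unfolding o_id using ZT by (intro hom) (auto simp: push_def)
    show "continuous_map T T (push 1)"
      using homotopic_with_imp_continuous_maps [OF h] by simp
  qed (use push1 ZZ' in auto)
  have b: "relative_homology_group p (subtopology T {w \<in> topspace T. radius w \<notin> {3/4..}}) {w \<in> ?Z'. radius w \<notin> {3/4..}}
     \<cong> relative_homology_group p T ?Z'"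
    by (rule is_isoI, rule excision_levels [OF continuous_radius, where V = "{1/2<..}"]) auto
  let ?N = "{w \<in> topspace T. radius w \<notin> {3/4..}}" and ?A = "{x \<in> disk_set n. 1/2 \<le> rad x \<and> rad x < 3/4}"
  let ?D = "subtopology (disk n) {x \<in> disk_set n. rad x < 3/4}"
  have N_eq: "?N = \<phi> ` {x \<in> disk_set n. rad x < 3/4}"
  proof
    show "?N \<subseteq> \<phi> ` {x \<in> disk_set n. rad x < 3/4}"
    proof
      fix w assume w: "w \<in> ?N"
      then have "w \<notin> Z" by (auto simp: radius_def)
      moreover have "w \<in> topspace T" using w by simp
      ultimately obtain x where "x \<in> disk_set n" "w = \<phi> x" using point_off_Z by blast
      then show "w \<in> \<phi> ` {x \<in> disk_set n. rad x < 3/4}" using w by (auto simp: radius)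
    qed
  qed (use cover' in \<open>auto simp: radius\<close>)
  have "homeomorphic_map ?D (subtopology T ?N) \<phi>"
  proof (rule bijective_closed_imp_homeomorphic_map)
    show "continuous_map ?D (subtopology T ?N) \<phi>"
      unfolding continuous_map_in_subtopology
      using N_eq continuous_map_from_subtopology [OF characteristic(1)] by (auto simp: image_subset_iff)
    have "closed_map (disk n) T \<phi>"
      by (rule continuous_imp_closed_map [OF characteristic(1) compact_disk Hausdorff])
    then show "closed_map ?D (subtopology T ?N) \<phi>"
      by (rule closed_map_restriction)
        (use continuous_map_image_subset_topspace [OF characteristic(1)] in \<open>auto simp: radius\<close>)
    show "\<phi> ` topspace ?D = topspace (subtopology T ?N)"
      using N_eq by (simp add: Int_absorb1 Collect_mono) auto
    show "inj_on \<phi> (topspace ?D)"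
      by (rule inj_on_subset [OF characteristic(2)]) (auto simp: disk_interior_eq)
  qed
  then have "hom_induced p ?D ?A (subtopology T ?N) (\<phi> ` ?A) \<phi>
     \<in> iso (relative_homology_group p ?D ?A) (relative_homology_group p (subtopology T ?N) (\<phi> ` ?A))"
    by (rule homeomorphic_map_relative_homology_iso) auto
  then have d: "relative_homology_group p ?D ?A \<cong> relative_homology_group p (subtopology T ?N) (\<phi> ` ?A)"
    by (rule is_isoI)
  have "\<phi> ` ?A = {w \<in> ?Z'. radius w \<notin> {3/4..}}"
  proof -
    have "{w \<in> ?Z'. radius w \<notin> {3/4..}} = {w \<in> ?N. 1/2 \<le> radius w}" by auto
    also have "\<dots> = \<phi> ` ?A" unfolding N_eq by (auto simp: radius)
    finally show ?thesis by simp
  qed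
  from iso_trans [OF d [unfolded this] iso_trans [OF b a]]
  have "relative_homology_group p ?D ?A \<cong> relative_homology_group p T Z" .
  then show ?thesis
    by (rule group.iso_sym [OF group_relative_homology_group])
qed

text \<open>The disk is itself obtained from its boundary by attaching a cell, so both pairs have the homology of the
same annular pair.\<close>

lemma homology_isomorphic_disk:
  "relative_homology_group p T Z \<cong> relative_homology_group p (disk n) (disk_boundary n)"
proof -
  interpret D: cell_attachment "disk n" "disk_boundary n" n "\<lambda>x. x"
  proof
    have "continuous_map (disk n) euclideanreal (\<lambda>x. rad x)"
      unfolding disk_eq by (simp add: continuous_on_L2_set continuous_on_coordinate)
    then have "closedin (disk n) {x \<in> topspace (disk n). rad x \<in> {1}}"
      by (rule closedin_continuous_map_preimage) auto
    then show "closedin (disk n) (disk_boundary n)"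
      by (simp add: disk_boundary_eq)
    show "topspace (disk n) = disk_boundary n \<union> (\<lambda>x. x) ` disk_interior n"
      by (auto simp: disk_set_eq)
  qed (auto simp: Hausdorff_disk disk_interior_eq disk_boundary_eq)
  have "relative_homology_group p (disk n) (disk_boundary n)
     \<cong> relative_homology_group p (subtopology (disk n) {x \<in> disk_set n. rad x < 3/4}) {x \<in> disk_set n. 1/2 \<le> rad x \<and> rad x < 3/4}"
    by (rule D.homology_isomorphic_annulus)
  then show ?thesis
    using homology_isomorphic_annulus iso_trans group.iso_sym [OF group_relative_homology_group] by blast
qed

lemma trivial_homology_attachment:
  assumes "p \<noteq> int n" shows "trivial_group (relative_homology_group p T Z)"
  using homology_isomorphic_disk [of p] trivial_homology_disk_mod_boundary [OF assms]
  by (simp add: isomorphic_group_triviality)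

end

section \<open>Cellular homology of finite CW complexes\<close>

lemma triple_exact:
  assumes TS: "T \<subseteq> S" and SU: "S \<subseteq> U"
  shows triple_exact_1: "kernel (relative_homology_group p (subtopology X U) S)
           (relative_homology_group (p - 1) (subtopology X S) T) (hom_relboundary p (subtopology X U) S T)
         = hom_induced p (subtopology X U) T (subtopology X U) S id ` carrier (relative_homology_group p (subtopology X U) T)"
    and triple_exact_2: "kernel (relative_homology_group (p - 1) (subtopology X S) T)
           (relative_homology_group (p - 1) (subtopology X U) T) (hom_induced (p - 1) (subtopology X S) T (subtopology X U) T id)
         = hom_relboundary p (subtopology X U) S T ` carrier (relative_homology_group p (subtopology X U) S)"
    and triple_exact_3: "kernel (relative_homology_group p (subtopology X U) T)
           (relative_homology_group p (subtopology X U) S) (hom_induced p (subtopology X U) T (subtopology X U) S id)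
         = hom_induced p (subtopology X S) T (subtopology X U) T id ` carrier (relative_homology_group p (subtopology X S) T)"
  using homology_exactness_triple_1 [OF TS, of p "subtopology X U"]
    homology_exactness_triple_2 [OF TS, of p "subtopology X U"]
    homology_exactness_triple_3 [OF TS, of p "subtopology X U"]
  by (simp_all add: nested_subtopology [OF SU])

lemma hom_induced_group_hom:
  "group_hom (relative_homology_group p X S) (relative_homology_group p Y T) (hom_induced p X S Y T f)"
  by (simp add: group_hom_def group_hom_axioms_def hom_induced_hom)

lemma trivial_relative_homology_trans:
  assumes TS: "T \<subseteq> S" and SU: "S \<subseteq> U"
    and 1: "trivial_group (relative_homology_group p (subtopology X U) S)"
    and 2: "trivial_group (relative_homology_group p (subtopology X S) T)"
  shows "trivial_group (relative_homology_group p (subtopology X U) T)"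
proof -
  let ?UT = "relative_homology_group p (subtopology X U) T" and ?US = "relative_homology_group p (subtopology X U) S"
  let ?ST = "relative_homology_group p (subtopology X S) T"
  interpret i: group_hom ?ST ?UT "hom_induced p (subtopology X S) T (subtopology X U) T id"
    by (rule hom_induced_group_hom)
  have "carrier ?UT = kernel ?UT ?US (hom_induced p (subtopology X U) T (subtopology X U) S id)"
    by (rule group_hom.kernel_to_trivial_group [OF hom_induced_group_hom 1, symmetric])
  also have "\<dots> = hom_induced p (subtopology X S) T (subtopology X U) T id ` carrier ?ST"
    by (rule triple_exact_3 [OF TS SU])
  also have "\<dots> = {\<one>\<^bsub>?UT\<^esub>}"
    using 2 i.hom_one by (simp add: trivial_group_def)
  finally show ?thesis by (simp add: trivial_group_def)
qed

lemma open_cell_subset_skeleton: "\<lbrakk>e \<in> K; int (fst e) \<le> p\<rbrakk> \<Longrightarrow> open_cell e \<subseteq> skeleton K p"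
  by (auto simp: skeleton_def)

lemma skeleton_negative: "p < 0 \<Longrightarrow> skeleton K p = {}"
  by (auto simp: skeleton_def)

lemma finite_CW_structureD:
  assumes "finite_CW_structure X K"
  shows "Hausdorff_space X" "finite K" "disjoint_family_on open_cell K" "(\<Union>e\<in>K. open_cell e) = topspace X"
    and "(n,\<phi>) \<in> K \<Longrightarrow> continuous_map (disk n) X \<phi>" "(n,\<phi>) \<in> K \<Longrightarrow> inj_on \<phi> (disk_interior n)"
    "(n,\<phi>) \<in> K \<Longrightarrow> \<phi> ` disk_boundary n \<subseteq> skeleton K (int n - 1)"
proof -
  show "Hausdorff_space X" "finite K" "disjoint_family_on open_cell K" "(\<Union>e\<in>K. open_cell e) = topspace X"
    using assms unfolding finite_CW_structure_def by blast+
  assume "(n,\<phi>) \<in> K"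
  moreover have "\<forall>(n,\<phi>) \<in> K. continuous_map (disk n) X \<phi> \<and> inj_on \<phi> (disk_interior n) \<and>
                   \<phi> ` disk_boundary n \<subseteq> skeleton K (int n - 1)"
    using assms unfolding finite_CW_structure_def by blast
  ultimately show "continuous_map (disk n) X \<phi>" "inj_on \<phi> (disk_interior n)"
    "\<phi> ` disk_boundary n \<subseteq> skeleton K (int n - 1)"
    by blast+
qed

lemma skeleton_subset:
  assumes "finite_CW_structure X K" shows "skeleton K p \<subseteq> topspace X"
  using finite_CW_structureD(4) [OF assms] by (auto simp: skeleton_def)

lemma compactin_closed_cell:
  assumes "finite_CW_structure X K" "(n,\<phi>) \<in> K"
  shows "compactin X (\<phi> ` disk_set n)"
  using image_compactin [OF _ finite_CW_structureD(5) [OF assms]] compact_disk [of n]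
  by (simp add: compact_space_def)

lemma compactin_skeleton:
  assumes K: "finite_CW_structure X K" shows "compactin X (skeleton K p)"
proof -
  have "skeleton K p = (\<Union>e \<in> {e \<in> K. int (fst e) \<le> p}. snd e ` disk_set (fst e))"
  proof
    show "skeleton K p \<subseteq> (\<Union>e \<in> {e \<in> K. int (fst e) \<le> p}. snd e ` disk_set (fst e))"
      unfolding skeleton_def open_cell_def disk_set_eq by blast
    have "snd e ` disk_set (fst e) \<subseteq> skeleton K p" if e: "e \<in> K" "int (fst e) \<le> p" for e
    proof -
      have "snd e ` disk_boundary (fst e) \<subseteq> skeleton K (int (fst e) - 1)"
        using finite_CW_structureD(7) [OF K, of "fst e" "snd e"] e by simp
      also have "\<dots> \<subseteq> skeleton K p" using e by (intro skeleton_mono) simp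
      finally show ?thesis
        using open_cell_subset_skeleton [OF e] by (auto simp: disk_set_eq open_cell_def image_Un)
    qed
    then show "(\<Union>e \<in> {e \<in> K. int (fst e) \<le> p}. snd e ` disk_set (fst e)) \<subseteq> skeleton K p" by auto
  qed
  moreover have "compactin X (\<Union>e \<in> {e \<in> K. int (fst e) \<le> p}. snd e ` disk_set (fst e))"
    using finite_CW_structureD(2) [OF K] compactin_closed_cell [OF K] by (intro compactin_Union) auto
  ultimately show ?thesis by simp
qed

lemma closedin_skeleton: "finite_CW_structure X K \<Longrightarrow> closedin X (skeleton K p)"
  using compactin_skeleton compactin_imp_closedin finite_CW_structureD(1) by blast

lemma skeleton_top:
  assumes "finite_CW_structure X K" "\<And>e. e \<in> K \<Longrightarrow> int (fst e) \<le> p"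
  shows "skeleton K p = topspace X"
proof -
  have "{e \<in> K. int (fst e) \<le> p} = K" using assms(2) by blast
  then show ?thesis using finite_CW_structureD(4) [OF assms(1)] by (simp add: skeleton_def)
qed

lemma finite_CW_structure_top:
  assumes "finite_CW_structure X K"
  obtains N where "\<And>e. e \<in> K \<Longrightarrow> int (fst e) \<le> N"
proof
  fix e assume "e \<in> K"
  then show "int (fst e) \<le> int (Max (fst ` K))"
    using finite_CW_structureD(2) [OF assms] by simp
qed

lemma compact_space_finite_CW:
  assumes K: "finite_CW_structure X K" shows "compact_space X"
  using finite_CW_structure_top [OF K] skeleton_top [OF K] compactin_skeleton [OF K]
  unfolding compact_space_def by metis

lemma open_cell_0: "fst e = 0 \<Longrightarrow> open_cell e = {snd e (\<lambda>_. 0)}"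
proof -
  have "disk_interior 0 = {\<lambda>_. 0}" by (auto simp: disk_interior_def topspace_Euclidean_space)
  then show "fst e = 0 \<Longrightarrow> ?thesis" by (simp add: open_cell_def)
qed

text \<open>The cells of one dimension are attached one at a time. A vertex that already lies in \<open>A\<close> adds
nothing; every other cell is disjoint from what is there.\<close>

lemma trivial_homology_add_cells:
  assumes K: "finite_CW_structure X K" and A: "closedin X A" "A \<subseteq> skeleton K 0"
    and F: "finite F" "F \<subseteq> {e \<in> K. fst e = n}" and q: "q \<noteq> int n"
  shows "closedin X (skeleton K (int n - 1) \<union> A \<union> (\<Union>e\<in>F. open_cell e)) \<and>
         trivial_group (relative_homology_group q (subtopology X (skeleton K (int n - 1) \<union> A \<union> (\<Union>e\<in>F. open_cell e)))
                          (skeleton K (int n - 1) \<union> A))"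
  using F
proof (induction F rule: finite_induct)
  case empty
  let ?Y = "skeleton K (int n - 1) \<union> A"
  have Y: "closedin X ?Y" by (simp add: closedin_Un closedin_skeleton [OF K] A)
  then have "topspace (subtopology X ?Y) = ?Y" using closedin_subset by fastforce
  then show ?case
    using Y trivial_relative_homology_group_topspace [of q "subtopology X ?Y"] by simp
next
  case (insert e F)
  let ?B = "skeleton K (int n - 1) \<union> A"
  let ?Y = "?B \<union> (\<Union>e\<in>F. open_cell e)"
  let ?Z = "?B \<union> (\<Union>e\<in>insert e F. open_cell e)"
  obtain \<phi> where e: "e = (n,\<phi>)" "(n,\<phi>) \<in> K" using insert.prems by (cases e) auto
  have IH: "closedin X ?Y" "trivial_group (relative_homology_group q (subtopology X ?Y) ?B)"
    using insert by auto
  have Z: "?Z = ?Y \<union> open_cell e" by auto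
  have dis: "open_cell e \<inter> open_cell e' = {}" if "e' \<in> K" "e' \<noteq> e" for e'
    using finite_CW_structureD(3) [OF K] e that by (auto simp: disjoint_family_on_def)
  have "open_cell e \<inter> (\<Union>e\<in>F. open_cell e) = {}"
    using dis insert by blast
  moreover have dB: "open_cell e \<inter> skeleton K (int n - 1) = {}"
  proof -
    have "open_cell e \<inter> open_cell e' = {}" if "e' \<in> K" "int (fst e') \<le> int n - 1" for e'
    proof (rule dis [OF that(1)])
      have "fst e' \<noteq> fst e" using that e by auto
      then show "e' \<noteq> e" by auto
    qed
    then show ?thesis unfolding skeleton_def by blast
  qed
  moreover have "open_cell e \<inter> A = {} \<or> open_cell e \<subseteq> A"
  proof (cases "n = 0")
    case True
    then show ?thesis using open_cell_0 [of e] e by auto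
  next
    case False
    then have "skeleton K 0 \<subseteq> skeleton K (int n - 1)" by (intro skeleton_mono) simp
    then show ?thesis using A dB by blast
  qed
  ultimately consider "open_cell e \<subseteq> ?Y" | "open_cell e \<inter> ?Y = {}" by blast
  then show ?case
  proof cases
    case 1
    then have "?Z = ?Y" using Z by blast
    then show ?thesis using IH by (simp only:)
  next
    case 2
    have cell: "open_cell e \<subseteq> topspace X" using finite_CW_structureD(4) [OF K] e by blast
    have bd: "\<phi> ` disk_boundary n \<subseteq> ?Y" using finite_CW_structureD(7) [OF K e(2)] by blast
    have int: "\<phi> ` disk_interior n = open_cell e" by (simp add: open_cell_def e)
    have "?Z = ?Y \<union> \<phi> ` disk_set n" using bd int Z by (auto simp: disk_set_eq image_Un)
    moreover have "closedin X (\<phi> ` disk_set n)"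
      using compactin_imp_closedin [OF finite_CW_structureD(1) [OF K] compactin_closed_cell [OF K e(2)]] .
    ultimately have clZ: "closedin X ?Z" using IH(1) by (simp only: closedin_Un)
    have "cell_attachment (subtopology X ?Z) ?Y n \<phi>"
    proof
      show "Hausdorff_space (subtopology X ?Z)"
        by (intro Hausdorff_space_subtopology finite_CW_structureD(1) [OF K])
      show "closedin (subtopology X ?Z) ?Y"
        using IH(1) Z by (intro closedin_subset_topspace) auto
      show "continuous_map (disk n) (subtopology X ?Z) \<phi>"
        using finite_CW_structureD(5) [OF K e(2)] \<open>?Z = ?Y \<union> \<phi> ` disk_set n\<close>
        by (auto simp: continuous_map_in_subtopology)
      show "topspace (subtopology X ?Z) = ?Y \<union> \<phi> ` disk_interior n"
        using closedin_subset [OF clZ] Z int by auto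
    qed (use 2 bd int finite_CW_structureD(6) [OF K e(2)] in auto)
    then have "trivial_group (relative_homology_group q (subtopology X ?Z) ?Y)"
      by (rule cell_attachment.trivial_homology_attachment [OF _ q])
    then have "trivial_group (relative_homology_group q (subtopology X ?Z) ?B)"
      by (rule trivial_relative_homology_trans [rotated 2]) (use IH(2) in auto)
    then show ?thesis using clZ by blast
  qed
qed

text \<open>Attaching cells whose dimensions differ from \<open>q\<close> does not create relative homology in degree \<open>q\<close>.\<close>

lemma trivial_homology_skeleta:
  assumes K: "finite_CW_structure X K" and A: "closedin X A" "A \<subseteq> skeleton K 0"
    and "p \<le> r" and dims: "\<And>e. \<lbrakk>e \<in> K; p < int (fst e); int (fst e) \<le> r\<rbrakk> \<Longrightarrow> int (fst e) \<noteq> q"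
  shows "trivial_group (relative_homology_group q (subtopology X (skeleton K r \<union> A)) (skeleton K p \<union> A))"
  using \<open>p \<le> r\<close> dims
proof (induction r rule: int_ge_induct)
  case base
  have "topspace (subtopology X (skeleton K p \<union> A)) = skeleton K p \<union> A"
    using skeleton_subset [OF K] closedin_subset [OF A(1)] by auto
  then show ?case using trivial_relative_homology_group_topspace [of q "subtopology X (skeleton K p \<union> A)"] by simp
next
  case (step r)
  have IH: "trivial_group (relative_homology_group q (subtopology X (skeleton K r \<union> A)) (skeleton K p \<union> A))"
    using step by auto
  have "trivial_group (relative_homology_group q (subtopology X (skeleton K (r + 1) \<union> A)) (skeleton K r \<union> A))"
  proof (cases "\<exists>e\<in>K. int (fst e) = r + 1")
    case True
    then obtain e where e: "e \<in> K" "int (fst e) = r + 1" by blast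
    then have q: "q \<noteq> int (fst e)" using step.prems [of e] step.hyps by auto
    have r: "int (fst e) - 1 = r" using e by simp
    let ?F = "{e' \<in> K. fst e' = fst e}"
    have "finite ?F" using finite_CW_structureD(2) [OF K] by simp
    from trivial_homology_add_cells [OF K A this _ q]
    have "trivial_group (relative_homology_group q (subtopology X (skeleton K r \<union> A \<union> (\<Union>e\<in>?F. open_cell e))) (skeleton K r \<union> A))"
      unfolding r by blast
    moreover have "skeleton K (r + 1) = skeleton K r \<union> (\<Union>e\<in>?F. open_cell e)"
    proof -
      have "{e' \<in> K. int (fst e') \<le> r + 1} = {e' \<in> K. int (fst e') \<le> r} \<union> ?F" using e by auto
      then show ?thesis by (simp add: skeleton_def UN_Un)
    qed
    then have "skeleton K (r + 1) \<union> A = skeleton K r \<union> A \<union> (\<Union>e\<in>?F. open_cell e)" by blast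
    ultimately show ?thesis by (simp only:)
  next
    case False
    have "{e \<in> K. int (fst e) \<le> r + 1} = {e \<in> K. int (fst e) \<le> r}" using False by force
    then have "skeleton K (r + 1) = skeleton K r" by (simp add: skeleton_def)
    moreover have "topspace (subtopology X (skeleton K r \<union> A)) = skeleton K r \<union> A"
      using skeleton_subset [OF K] closedin_subset [OF A(1)] by auto
    ultimately show ?thesis
      using trivial_relative_homology_group_topspace [of q "subtopology X (skeleton K r \<union> A)"] by simp
  qed
  then show ?case
    by (rule trivial_relative_homology_trans [rotated 2])
      (use IH skeleton_mono [of r "r + 1" K] skeleton_mono [OF step(1), of K] in auto)
qed

text \<open>The algebra of the comparison theorem: \<open>j\<close> identifies \<open>H\<close> with the cycles, and \<open>f\<close> presents the
homology as a quotient of \<open>H\<close>.\<close>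

lemma iso_subquotient:
  assumes gr: "group H" "group C" "group Q" and j: "j \<in> hom H C" "inj_on j (carrier H)"
    and f: "f \<in> hom H Q" "f ` carrier H = carrier Q"
  shows "group (subgroup_generated C (j ` carrier H) Mod (j ` kernel H Q f)) \<and>
         subgroup_generated C (j ` carrier H) Mod (j ` kernel H Q f) \<cong> Q"
proof -
  let ?S = "subgroup_generated C (j ` carrier H)"
  interpret j: group_hom H C j using gr j by (simp add: group_hom_def group_hom_axioms_def)
  have carS: "carrier ?S = j ` carrier H"
    by (rule subgroup.carrier_subgroup_generated_subgroup [OF j.img_is_subgroup])
  have gS: "group ?S" using gr(2) by (rule group.group_subgroup_generated)
  have jS: "j \<in> iso H ?S"
    using j by (auto simp: iso_def bij_betw_def carS hom_def)
  let ?i = "inv_into (carrier H) j"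
  have i: "?i \<in> iso ?S H" by (rule group.iso_set_sym [OF gr(1) jS])
  have ij: "?i (j x) = x" if "x \<in> carrier H" for x using j(2) that by simp
  have g: "f \<circ> ?i \<in> hom ?S Q" using i f(1) by (auto simp: iso_def intro: hom_compose)
  have im: "(f \<circ> ?i) ` carrier ?S = carrier Q"
    using f(2) ij unfolding carS by (auto simp: image_comp image_iff)
  have ker: "kernel ?S Q (f \<circ> ?i) = j ` kernel H Q f"
    using ij unfolding kernel_def carS by auto
  interpret g: group_hom ?S Q "f \<circ> ?i"
    using gS gr g by (simp add: group_hom_def group_hom_axioms_def)
  show ?thesis
    using g.FactGroup_iso [OF im] normal.factorgroup_is_group [OF g.normal_kernel] unfolding ker by blast
qed

text \<open>Write \<open>X\<^sub>p\<close> for the \<open>p\<close>-skeleton together with \<open>A\<close>. As \<open>H\<^sub>p (X\<^sub>p\<^sub>-\<^sub>1, A) = 0\<close>, the map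
\<open>H\<^sub>p (X\<^sub>p, A) \<rightarrow> H\<^sub>p (X\<^sub>p, X\<^sub>p\<^sub>-\<^sub>1)\<close> is injective, and its image is the group of cellular cycles. As
\<open>H\<^sub>p (X, X\<^sub>p) = 0\<close> and \<open>H\<^sub>p\<^sub>+\<^sub>1 (X, X\<^sub>p\<^sub>+\<^sub>1) = 0\<close>, the map \<open>H\<^sub>p (X\<^sub>p, A) \<rightarrow> H\<^sub>p (X, A)\<close> is surjective, and its
kernel corresponds to the cellular boundaries. That the homology of the complex is a group is part
of the conclusion because isomorphism with a group alone would not provide its group laws.\<close>

theorem cellular_homology:
  assumes K: "finite_CW_structure X K" and A: "closedin X A" "A \<subseteq> skeleton K 0"
  shows "group (complex_homology (cellular_chain_group X K A) (cellular_boundary X K A) p) \<and>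
         complex_homology (cellular_chain_group X K A) (cellular_boundary X K A) p \<cong> relative_homology_group p X A"
proof -
  let ?X = "\<lambda>p. skeleton K p \<union> A"
  let ?T = "\<lambda>p. subtopology X (?X p)"
  let ?C = "\<lambda>p. cellular_chain_group X K A p"
  let ?H = "\<lambda>p. relative_homology_group p (?T p) A"
  let ?j = "\<lambda>p. hom_induced p (?T p) A (?T p) (?X (p - 1)) id"
  let ?d = "\<lambda>p. hom_relboundary p (?T p) (?X (p - 1)) A"
  let ?f = "hom_induced p (?T p) A X A id"
  have mono: "?X p \<subseteq> ?X q" if "p \<le> q" for p q using skeleton_mono [OF that, of K] by blast
  have C: "?C p = relative_homology_group p (?T p) (?X (p - 1))" for p
    by (simp add: cellular_chain_group_def)
  obtain N0 where N0: "\<And>e. e \<in> K \<Longrightarrow> int (fst e) \<le> N0" using finite_CW_structure_top [OF K] by blast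
  have topX: "subtopology X (?X N) = X" if "N \<ge> N0" for N
  proof -
    have "skeleton K N = topspace X" using N0 that by (intro skeleton_top [OF K]) fastforce
    then show ?thesis using closedin_subset [OF A(1)] by (simp add: Un_absorb2)
  qed
  \<comment> \<open>Start from the \<open>p\<close> with empty skeleton, where the pair is \<open>(A, A)\<close>; the minimum covers \<open>p < 0\<close>.\<close>
  have low: "trivial_group (relative_homology_group p (?T (p - 1)) A)" for p
  proof -
    have "trivial_group (relative_homology_group p (?T (p - 1)) (?X (min (- 1) (p - 1))))"
      by (rule trivial_homology_skeleta [OF K A]) auto
    then show ?thesis by (simp add: skeleton_negative)
  qed
  have high: "trivial_group (relative_homology_group p X (?X p))" for p
    using trivial_homology_skeleta [OF K A, of p "max N0 p" p] topX [of "max N0 p"] by simp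
  have j_hom: "?j p \<in> hom (?H p) (?C p)" for p unfolding C by (rule hom_induced_hom)
  have j_inj: "inj_on (?j p) (carrier (?H p))" for p
  proof -
    interpret g: group_hom "?H p" "?C p" "?j p" unfolding C by (rule hom_induced_group_hom)
    have "kernel (?H p) (?C p) (?j p) = hom_induced p (?T (p - 1)) A (?T p) A id ` carrier (relative_homology_group p (?T (p - 1)) A)"
      unfolding C by (rule triple_exact_3) (use mono [of "p - 1" p] in auto)
    also have "\<dots> = {\<one>\<^bsub>?H p\<^esub>}"
      using low [of p] group_hom.hom_one [OF hom_induced_group_hom] by (simp add: trivial_group_def)
    finally show ?thesis by (simp add: g.inj_iff_trivial_ker)
  qed
  have T_le: "continuous_map (?T (p - 1)) (?T p) id" for p
    using mono [of "p - 1" p] by (auto simp: continuous_map_in_subtopology)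
  have boundary: "cellular_boundary X K A p = ?j (p - 1) \<circ> ?d p" for p
  proof -
    have "hom_induced (p - 1) (?T (p - 1)) {} (?T (p - 1)) (?X (p - 2)) (id \<circ> id)
       = ?j (p - 1) \<circ> hom_induced (p - 1) (?T (p - 1)) {} (?T (p - 1)) A id"
      by (simp only: diff_diff_add one_add_one) (rule hom_induced_compose; auto)
    then show ?thesis
      using nested_subtopology [OF mono [of "p - 1" p], of X]
      by (simp add: cellular_boundary_def hom_relboundary_def o_assoc)
  qed
  have d_im: "?d p x \<in> carrier (?H (p - 1))" for p x
    using hom_relboundary [of p "?T p" "?X (p - 1)" A x] nested_subtopology [OF mono [of "p - 1" p], of X] by simp
  have ker: "kernel (?C p) (?C (p - 1)) (cellular_boundary X K A p) = ?j p ` carrier (?H p)" for p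
  proof -
    have "cellular_boundary X K A p x = \<one>\<^bsub>?C (p - 1)\<^esub> \<longleftrightarrow> ?d p x = \<one>\<^bsub>?H (p - 1)\<^esub>" for x
    proof -
      interpret g: group_hom "?H (p - 1)" "?C (p - 1)" "?j (p - 1)" unfolding C by (rule hom_induced_group_hom)
      show ?thesis unfolding boundary o_def
        using j_inj [of "p - 1"] d_im g.hom_one by (metis g.G.one_closed inj_onD)
    qed
    then have "kernel (?C p) (?C (p - 1)) (cellular_boundary X K A p) = kernel (?C p) (?H (p - 1)) (?d p)"
      by (simp add: kernel_def)
    also have "\<dots> = ?j p ` carrier (?H p)"
      unfolding C by (rule triple_exact_1) (use mono [of "p - 1" p] in auto)
    finally show ?thesis .
  qed
  have topX': "subtopology X (topspace X) = X" by simp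
  have XpT: "?X p \<subseteq> topspace X" for p using skeleton_subset [OF K] closedin_subset [OF A(1)] by blast
  have f_surj: "?f ` carrier (?H p) = carrier (relative_homology_group p X A)"
  proof -
    have "kernel (relative_homology_group p X A) (relative_homology_group p X (?X p)) (hom_induced p X A X (?X p) id)
          = ?f ` carrier (?H p)"
      using triple_exact_3 [OF _ XpT [of p], of A p X] by simp
    then show ?thesis using group_hom.kernel_to_trivial_group [OF hom_induced_group_hom high] by metis
  qed
  have f_ker: "kernel (?H p) (relative_homology_group p X A) ?f = ?d (p + 1) ` carrier (?C (p + 1))"
  proof -
    let ?R = "relative_homology_group (p + 1) X (?X p)"
    let ?g = "hom_induced (p + 1) (?T (p + 1)) (?X p) X (?X p) id"
    let ?D = "hom_relboundary (p + 1) X (?X p) A"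
    have "kernel ?R (relative_homology_group (p + 1) X (?X (p + 1))) (hom_induced (p + 1) X (?X p) X (?X (p + 1)) id)
        = ?g ` carrier (?C (p + 1))"
      using triple_exact_3 [OF _ XpT [of "p + 1"], of "?X p" "p + 1" X] mono [of p "p + 1"] by (simp add: C)
    then have g_surj: "?g ` carrier (?C (p + 1)) = carrier ?R"
      using group_hom.kernel_to_trivial_group [OF hom_induced_group_hom high] by metis
    have "kernel (?H p) (relative_homology_group p X A) ?f = ?D ` carrier ?R"
      using triple_exact_2 [OF _ XpT [of p], of A "p + 1" X] by simp
    also have "\<dots> = (?D \<circ> ?g) ` carrier (?C (p + 1))"
      unfolding g_surj [symmetric] by (simp only: image_comp)
    also have "?D \<circ> ?g = hom_induced p (subtopology (?T (p + 1)) (?X p)) A (?T p) A id \<circ> ?d (p + 1)"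
      using naturality_hom_induced_relboundary [of "?T (p + 1)" X id "?X p" "?X p" A A "p + 1"] by simp
    also have "\<dots> ` carrier (?C (p + 1)) = ?d (p + 1) ` carrier (?C (p + 1))"
    proof -
      have "subtopology (?T (p + 1)) (?X p) = ?T p" by (rule nested_subtopology) (rule mono, simp)
      then show ?thesis
        using d_im [of "p + 1"] by (auto simp: image_iff hom_induced_id)
    qed
    finally show ?thesis .
  qed
  have im: "cellular_boundary X K A (p + 1) ` carrier (?C (p + 1)) = ?j p ` kernel (?H p) (relative_homology_group p X A) ?f"
    unfolding f_ker boundary by (simp add: image_comp)
  show ?thesis
    unfolding complex_homology_def ker im
  proof (rule iso_subquotient)
    show "group (?C p)" by (simp add: C)
    show "?f \<in> hom (?H p) (relative_homology_group p X A)" by (rule hom_induced_hom)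
  qed (simp_all add: j_hom j_inj f_surj)
qed

section \<open>The suspended cell structure\<close>

lemma L2_set_le_1_iff: "L2_set x A \<le> 1 \<longleftrightarrow> (\<Sum>i\<in>A. (x i)\<^sup>2) \<le> 1"
  and L2_set_less_1_iff: "L2_set x A < 1 \<longleftrightarrow> (\<Sum>i\<in>A. (x i)\<^sup>2) < 1"
  and L2_set_eq_1_iff: "L2_set x A = 1 \<longleftrightarrow> (\<Sum>i\<in>A. (x i)\<^sup>2) = 1"
  by (simp_all add: L2_set_def)

text \<open>The disk of dimension \<open>n + 1\<close> as a cylinder over the disk of dimension \<open>n\<close> with both ends collapsed; coordinate \<open>n\<close> is the
cylinder parameter \<open>t\<close>, and the slice at \<open>t\<close> is a disk of radius \<open>sqrt (1 - t\<^sup>2)\<close>.\<close>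

definition disk_join :: "nat \<Rightarrow> (nat \<Rightarrow> real) \<times> real \<Rightarrow> nat \<Rightarrow> real" where
  "disk_join n = (\<lambda>(x,t) i. if i < n then sqrt (1 - t\<^sup>2) * x i else if i = n then t else 0)"

text \<open>The inverse of \<open>disk_join\<close> on the open range of \<open>t\<close>: the position within a slice, rescaled to the unit disk.\<close>

definition slice_coords :: "nat \<Rightarrow> (nat \<Rightarrow> real) \<Rightarrow> nat \<Rightarrow> real" where
  "slice_coords n x = (\<lambda>i. if i < n then x i / sqrt (1 - (x n)\<^sup>2) else 0)"

lemma norm_disk_join:
  assumes "\<bar>t\<bar> \<le> 1"
  shows "(\<Sum>i<Suc n. (disk_join n (x,t) i)\<^sup>2) = (1 - t\<^sup>2) * (\<Sum>i<n. (x i)\<^sup>2) + t\<^sup>2"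
proof -
  have "0 \<le> 1 - t\<^sup>2" using assms by (simp add: abs_square_le_1)
  then have "(\<Sum>i<n. (disk_join n (x,t) i)\<^sup>2) = (\<Sum>i<n. (1 - t\<^sup>2) * (x i)\<^sup>2)"
    by (intro sum.cong) (auto simp: disk_join_def power_mult_distrib)
  then show ?thesis by (simp add: disk_join_def flip: sum_distrib_left)
qed

lemma norm_slice_coords:
  assumes "\<bar>x n\<bar> < 1"
  shows "(\<Sum>i<n. (slice_coords n x i)\<^sup>2) = (\<Sum>i<n. (x i)\<^sup>2) / (1 - (x n)\<^sup>2)"
proof -
  have "(x n)\<^sup>2 < 1" using assms by (simp add: abs_square_less_1)
  then have "(\<Sum>i<n. (slice_coords n x i)\<^sup>2) = (\<Sum>i<n. (x i)\<^sup>2 / (1 - (x n)\<^sup>2))"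
    by (intro sum.cong) (auto simp: slice_coords_def power_divide)
  then show ?thesis by (simp add: sum_divide_distrib)
qed

lemma disk_join_in: "\<lbrakk>x \<in> disk_set n; \<bar>t\<bar> \<le> 1\<rbrakk> \<Longrightarrow> disk_join n (x,t) \<in> disk_set (Suc n)"
proof -
  assume x: "x \<in> disk_set n" and t: "\<bar>t\<bar> \<le> 1"
  have "(1 - t\<^sup>2) * (\<Sum>i<n. (x i)\<^sup>2) \<le> (1 - t\<^sup>2) * 1"
    using x t by (intro mult_left_mono) (auto simp: disk_set_def L2_set_le_1_iff abs_square_le_1)
  then show ?thesis using norm_disk_join [OF t, of n x]
    by (auto simp: disk_set_def L2_set_le_1_iff disk_join_def simp del: sum.lessThan_Suc)
qed

lemma disk_join_interior: "\<lbrakk>x \<in> disk_interior n; \<bar>t\<bar> < 1\<rbrakk> \<Longrightarrow> disk_join n (x,t) \<in> disk_interior (Suc n)"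
proof -
  assume x: "x \<in> disk_interior n" and t: "\<bar>t\<bar> < 1"
  have "(1 - t\<^sup>2) * (\<Sum>i<n. (x i)\<^sup>2) < (1 - t\<^sup>2) * 1"
    using x t by (intro mult_strict_left_mono) (auto simp: disk_interior_eq L2_set_less_1_iff abs_square_less_1)
  then show ?thesis using norm_disk_join [of t n x] disk_join_in [of x n t] x t
    by (auto simp: disk_interior_eq L2_set_less_1_iff simp del: sum.lessThan_Suc)
qed

lemma last_coordinate:
  assumes "x \<in> disk_set (Suc n)"
  shows "\<bar>x n\<bar> \<le> 1" "x \<in> disk_interior (Suc n) \<Longrightarrow> \<bar>x n\<bar> < 1"
proof -
  have le: "(x n)\<^sup>2 \<le> (\<Sum>i<Suc n. (x i)\<^sup>2)" by (rule member_le_sum) auto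
  have "(\<Sum>i<Suc n. (x i)\<^sup>2) \<le> 1"
    using assms unfolding disk_set_def L2_set_le_1_iff by blast
  then show "\<bar>x n\<bar> \<le> 1" using le by (simp only: abs_square_le_1 [symmetric])
  assume "x \<in> disk_interior (Suc n)"
  then have "(\<Sum>i<Suc n. (x i)\<^sup>2) < 1"
    unfolding disk_interior_eq L2_set_less_1_iff by blast
  then show "\<bar>x n\<bar> < 1" using le by (simp only: abs_square_less_1 [symmetric])
qed

lemma slice_coords_cases:
  assumes x: "x \<in> disk_set (Suc n)" and t: "\<bar>x n\<bar> < 1"
  shows "slice_coords n x \<in> disk_set n" "x \<in> disk_interior (Suc n) \<Longrightarrow> slice_coords n x \<in> disk_interior n"
    "x \<in> disk_boundary (Suc n) \<Longrightarrow> slice_coords n x \<in> disk_boundary n" "disk_join n (slice_coords n x, x n) = x"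
proof -
  have p: "0 < 1 - (x n)\<^sup>2" using t by (simp add: abs_square_less_1)
  let ?S = "\<Sum>i<n. (x i)\<^sup>2"
  have "(\<Sum>i<Suc n. (x i)\<^sup>2) \<le> 1" using x unfolding disk_set_def L2_set_le_1_iff by blast
  then have S: "?S + (x n)\<^sup>2 \<le> 1" by simp
  have tail: "\<forall>i\<ge>n. slice_coords n x i = 0" by (simp add: slice_coords_def)
  have "?S / (1 - (x n)\<^sup>2) \<le> 1" using S by (simp only: pos_divide_le_eq [OF p]) simp
  then show e: "slice_coords n x \<in> disk_set n"
    using tail by (simp add: disk_set_def L2_set_le_1_iff norm_slice_coords [of x n, OF t])
  show "slice_coords n x \<in> disk_interior n" if "x \<in> disk_interior (Suc n)"
  proof -
    have "(\<Sum>i<Suc n. (x i)\<^sup>2) < 1" using that unfolding disk_interior_eq L2_set_less_1_iff by blast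
    then have "?S + (x n)\<^sup>2 < 1" by simp
    then have "?S / (1 - (x n)\<^sup>2) < 1" by (simp only: pos_divide_less_eq [OF p]) simp
    then show ?thesis using e by (simp add: disk_interior_eq L2_set_less_1_iff norm_slice_coords [of x n, OF t])
  qed
  show "slice_coords n x \<in> disk_boundary n" if "x \<in> disk_boundary (Suc n)"
  proof -
    have "(\<Sum>i<Suc n. (x i)\<^sup>2) = 1" using that unfolding disk_boundary_eq L2_set_eq_1_iff by blast
    then have "?S + (x n)\<^sup>2 = 1" by simp
    then have "?S = 1 - (x n)\<^sup>2" by simp
    then have "?S / (1 - (x n)\<^sup>2) = 1" using p by simp
    then show ?thesis using e by (simp add: disk_boundary_eq L2_set_eq_1_iff norm_slice_coords [of x n, OF t])
  qed
  show "disk_join n (slice_coords n x, x n) = x"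
  proof
    fix i show "disk_join n (slice_coords n x, x n) i = x i"
    proof -
      have "sqrt (1 - (x n)\<^sup>2) \<noteq> 0" using p by simp
      moreover have "x i = 0" if "i > n"
      proof -
        have "\<forall>i\<ge>Suc n. x i = 0" using x unfolding disk_set_def by blast
        then show ?thesis using that by (simp only: Suc_le_eq)
      qed
      ultimately show ?thesis
        by (cases i n rule: linorder_cases) (simp_all add: disk_join_def slice_coords_def)
    qed
  qed
qed

lemma slice_coords_disk_join:
  assumes "x \<in> disk_set n" "\<bar>t\<bar> < 1" shows "slice_coords n (disk_join n (x,t)) = x" "disk_join n (x,t) n = t"
proof -
  have p: "0 < 1 - t\<^sup>2" using assms by (simp add: abs_square_less_1)
  show n: "disk_join n (x,t) n = t" by (simp add: disk_join_def)
  show "slice_coords n (disk_join n (x,t)) = x"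
  proof
    fix i
    have "x i = 0" if "i \<ge> n" using assms(1) that by (simp add: disk_set_def)
    then show "slice_coords n (disk_join n (x,t)) i = x i"
      unfolding slice_coords_def n using p by (simp add: disk_join_def)
  qed
qed

lemma quotient_disk_join:
  "quotient_map (prod_topology (disk n) (top_of_set {-1..1})) (disk (Suc n)) (disk_join n)"
proof (rule T1_Spaces.continuous_imp_quotient_map)
  let ?P = "prod_topology (disk n) (top_of_set {-1..1::real})"
  have "continuous_on (disk_set n \<times> {-1..1}) (\<lambda>z. disk_join n z i)" for i
  proof -
    have prod: "continuous_on (disk_set n \<times> {-1..1}) (\<lambda>z::(nat \<Rightarrow> real) \<times> real. sqrt (1 - (snd z)\<^sup>2) * fst z i)"
      by (intro continuous_on_mult continuous_on_real_sqrt continuous_on_diff continuous_on_power continuous_on_snd continuous_on_const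
          continuous_on_id continuous_on_product_then_coordinatewise [OF continuous_on_fst])
    consider "i < n" | "i = n" | "i > n" by linarith
    then show ?thesis
    proof cases
      case 1 then show ?thesis using prod by (simp add: disk_join_def case_prod_beta)
    qed (auto simp: disk_join_def case_prod_beta intro: continuous_on_snd continuous_on_id)
  qed
  then have "continuous_on (disk_set n \<times> {-1..1}) (disk_join n)"
    by (rule continuous_on_coordinatewise_then_product)
  then show "continuous_map ?P (disk (Suc n)) (disk_join n)"
    using disk_join_in by (auto simp: disk_eq continuous_map_in_subtopology simp flip: subtopology_Times)
  show "compact_space ?P"
    by (simp add: compact_space_prod_topology compact_disk compact_space_subtopology)
  show "Hausdorff_space (disk (Suc n))" by (rule Hausdorff_disk)
  have "\<exists>z. z \<in> disk_set n \<times> {-1..1} \<and> disk_join n z = x" if x: "x \<in> disk_set (Suc n)" for x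
  proof (cases "\<bar>x n\<bar> < 1")
    case True
    have "x n \<in> {-1..1}" using True by auto
    then show ?thesis using slice_coords_cases(1,4) [of x n, OF x True] by blast
  next
    case False
    then have n: "\<bar>x n\<bar> = 1" using last_coordinate [OF x] by simp
    then have "(x n)\<^sup>2 = 1" by (metis power2_abs one_power2)
    then have "(\<Sum>i<n. (x i)\<^sup>2) = 0"
    proof -
      have "(\<Sum>i<Suc n. (x i)\<^sup>2) \<le> 1" using x unfolding disk_set_def L2_set_le_1_iff by blast
      then show ?thesis using \<open>(x n)\<^sup>2 = 1\<close> sum_nonneg [of "{..<n}" "\<lambda>i. (x i)\<^sup>2"] by simp
    qed
    then have "x i = 0" if "i < n" for i using that by (subst (asm) sum_nonneg_eq_0_iff) auto
    then have "disk_join n (\<lambda>_. 0, x n) = x"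
      using x by (auto simp: disk_join_def disk_set_def fun_eq_iff)
    moreover have "(\<lambda>_. 0) \<in> disk_set n" by (simp add: disk_set_def L2_set_le_1_iff)
    moreover have "x n \<in> {-1..1}" using last_coordinate [OF x] by auto
    ultimately show ?thesis by blast
  qed
  then have "disk_set (Suc n) \<subseteq> disk_join n ` (disk_set n \<times> {-1..1})" by blast
  moreover have "disk_join n ` (disk_set n \<times> {-1..1}) \<subseteq> disk_set (Suc n)"
    using disk_join_in by auto
  ultimately show "disk_join n ` topspace ?P = topspace (disk (Suc n))" by simp
qed

context suspension_coordinates
begin

text \<open>The suspended characteristic map. Coordinate \<open>n\<close> of the disk runs over the interval from \<open>-1\<close> to \<open>1\<close> and
becomes the height; at both ends the slice coordinates degenerate, but the value is a pole anyway.\<close>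

definition sus_cell :: "'a cell \<Rightarrow> 'w cell" where
  "sus_cell e = (Suc (fst e), \<lambda>x. pt (snd e (slice_coords (fst e) x)) ((1 + x (fst e)) / 2))"

definition sus_cells :: "'a cell set \<Rightarrow> 'w cell set" where
  "sus_cells K = {(0, \<lambda>_. south), (0, \<lambda>_. north)} \<union> sus_cell ` K"

lemma continuous_sus_cell:
  assumes \<phi>: "continuous_map (disk n) L \<phi>"
  shows "continuous_map (disk (Suc n)) W (snd (sus_cell (n,\<phi>)))"
proof (rule continuous_compose_quotient_map [OF quotient_disk_join])
  let ?P = "prod_topology (disk n) (top_of_set {-1..1::real})"
  have snd: "continuous_map ?P euclideanreal snd"
    using continuous_map_into_fulltopology continuous_map_snd by blast
  have "continuous_map ?P (top_of_set {0..1}) (\<lambda>z. (1 + snd z) / 2)"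
    by (auto simp: continuous_map_in_subtopology intro!: continuous_intros snd)
  then have "continuous_map ?P (prod_topology L (top_of_set {0..1})) (\<lambda>z. (\<phi> (fst z), (1 + snd z) / 2))"
    using continuous_map_compose [OF continuous_map_fst \<phi>] by (intro continuous_map_pairedI) (auto simp: o_def)
  from continuous_map_compose [OF this continuous_pt]
  have cont: "continuous_map ?P W (\<lambda>z. pt (\<phi> (fst z)) ((1 + snd z) / 2))" by (simp add: o_def)
  show "continuous_map ?P W (snd (sus_cell (n,\<phi>)) \<circ> disk_join n)"
  proof (rule continuous_map_eq [OF cont])
    fix z assume "z \<in> topspace ?P"
    then obtain x t where z: "z = (x,t)" "x \<in> disk_set n" "-1 \<le> t" "t \<le> 1" by auto
    have n: "disk_join n (x,t) n = t" by (simp add: disk_join_def)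
    show "pt (\<phi> (fst z)) ((1 + snd z) / 2) = (snd (sus_cell (n,\<phi>)) \<circ> disk_join n) z"
    proof (cases "\<bar>t\<bar> < 1")
      case True
      then show ?thesis using z slice_coords_disk_join [of x n t] by (simp add: sus_cell_def)
    next
      case False
      then have "t = 1 \<or> t = -1" using z by auto
      then show ?thesis using z n by (auto simp: sus_cell_def)
    qed
  qed
qed

context
  fixes K :: "'a cell set"
  assumes K: "finite_CW_structure L K"
begin

lemma cell_in_base: "\<lbrakk>(n,\<phi>) \<in> K; x \<in> disk_set n\<rbrakk> \<Longrightarrow> \<phi> x \<in> topspace L"
  using continuous_map_image_subset_topspace [OF finite_CW_structureD(5) [OF K]] by fastforce

lemma open_cell_sus_cell:
  assumes "(n,\<phi>) \<in> K"
  shows "open_cell (sus_cell (n,\<phi>)) = {pt y t | y t. y \<in> open_cell (n,\<phi>) \<and> 0 < t \<and> t < 1}"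
proof (intro Set.set_eqI iffI)
  fix w assume "w \<in> open_cell (sus_cell (n,\<phi>))"
  then obtain x where x: "x \<in> disk_interior (Suc n)" "w = pt (\<phi> (slice_coords n x)) ((1 + x n) / 2)"
    by (auto simp: open_cell_def sus_cell_def)
  then have x': "x \<in> disk_set (Suc n)" by (simp add: disk_interior_eq)
  note t = last_coordinate(2) [OF x' x(1)]
  have "\<phi> (slice_coords n x) \<in> open_cell (n,\<phi>)"
    using slice_coords_cases(2) [of x n, OF x' t x(1)] by (simp add: open_cell_def)
  then show "w \<in> {pt y t | y t. y \<in> open_cell (n,\<phi>) \<and> 0 < t \<and> t < 1}"
  proof -
    have "0 < (1 + x n) / 2" "(1 + x n) / 2 < 1" using t by auto
    then show ?thesis using x(2) \<open>\<phi> (slice_coords n x) \<in> open_cell (n,\<phi>)\<close> by blast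
  qed
next
  fix w assume "w \<in> {pt y t | y t. y \<in> open_cell (n,\<phi>) \<and> 0 < t \<and> t < 1}"
  then obtain z t where z: "w = pt (\<phi> z) t" "z \<in> disk_interior n" "0 < t" "t < 1"
    by (auto simp: open_cell_def)
  then have z': "z \<in> disk_set n" "\<bar>2 * t - 1\<bar> < 1" by (auto simp: disk_interior_eq)
  show "w \<in> open_cell (sus_cell (n,\<phi>))"
    unfolding open_cell_def
  proof (rule image_eqI)
    show "w = snd (sus_cell (n,\<phi>)) (disk_join n (z, 2 * t - 1))"
      using z(1) slice_coords_disk_join [OF z'] by (simp add: sus_cell_def)
    show "disk_join n (z, 2 * t - 1) \<in> disk_interior (fst (sus_cell (n,\<phi>)))"
      using disk_join_interior [OF z(2) z'(2)] by (simp add: sus_cell_def)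
  qed
qed

lemma open_cells_poles: "open_cell (0, \<lambda>_. south) = {south}" "open_cell (0, \<lambda>_. north) = {north}"
  by (simp_all add: open_cell_0)

text \<open>Raising dimensions by one and adding two vertices turns skeleta into suspensions of skeleta. For
\<open>p = 0\<close> the skeleton of \<open>K\<close> in degree \<open>-1\<close> is empty and only the poles remain.\<close>

lemma skeleton_sus_cells:
  assumes "0 \<le> p" shows "skeleton (sus_cells K) p = sus (skeleton K (p - 1))"
proof -
  have cells: "{e \<in> sus_cells K. int (fst e) \<le> p} = {(0, \<lambda>_. south), (0, \<lambda>_. north)} \<union> sus_cell ` {e \<in> K. int (fst e) \<le> p - 1}"
    using assms by (auto simp: sus_cells_def sus_cell_def)
  have "skeleton (sus_cells K) p = {south, north} \<union> (\<Union>e\<in>{e \<in> K. int (fst e) \<le> p - 1}. open_cell (sus_cell e))"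
    unfolding skeleton_def cells by (simp only: UN_Un UN_insert UN_empty open_cells_poles image_image Un_empty_right insert_is_Un [symmetric])
  also have "\<dots> = {south, north} \<union> {pt x t | x t. x \<in> skeleton K (p - 1) \<and> 0 < t \<and> t < 1}"
  proof -
    have "(\<Union>e\<in>{e \<in> K. int (fst e) \<le> p - 1}. open_cell (sus_cell e))
       = (\<Union>e\<in>{e \<in> K. int (fst e) \<le> p - 1}. {pt y t | y t. y \<in> open_cell e \<and> 0 < t \<and> t < 1})"
    proof (rule SUP_cong [OF refl])
      fix e assume "e \<in> {e \<in> K. int (fst e) \<le> p - 1}"
      then show "open_cell (sus_cell e) = {pt y t | y t. y \<in> open_cell e \<and> 0 < t \<and> t < 1}"
        using open_cell_sus_cell [of "fst e" "snd e"] by simp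
    qed
    also have "\<dots> = {pt x t | x t. x \<in> skeleton K (p - 1) \<and> 0 < t \<and> t < 1}"
      unfolding skeleton_def by blast
    finally show ?thesis by simp
  qed
  also have "\<dots> = sus (skeleton K (p - 1))"
    by (rule sus_eq [symmetric]) (rule skeleton_subset [OF K])
  finally show ?thesis .
qed

lemma finite_CW_sus_cells: "finite_CW_structure W (sus_cells K)"
proof -
  have pole: "continuous_map (disk 0) W \<phi> \<and> inj_on \<phi> (disk_interior 0) \<and> \<phi> ` disk_boundary 0 \<subseteq> skeleton (sus_cells K) (int 0 - 1)"
    if "\<phi> = (\<lambda>_. south) \<or> \<phi> = (\<lambda>_. north)" for \<phi>
  proof -
    have "inj_on \<phi> (disk_interior 0)"
      by (auto simp: inj_on_def disk_interior_def topspace_Euclidean_space)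
    then show ?thesis using that by (auto simp: disk_boundary_0)
  qed
  have cell: "continuous_map (disk (Suc n)) W \<psi> \<and> inj_on \<psi> (disk_interior (Suc n)) \<and>
        \<psi> ` disk_boundary (Suc n) \<subseteq> skeleton (sus_cells K) (int (Suc n) - 1)"
    if e: "(n,\<phi>) \<in> K" and \<psi>: "\<psi> = snd (sus_cell (n,\<phi>))" for n \<phi> \<psi>
  proof (intro conjI)
    show "continuous_map (disk (Suc n)) W \<psi>"
      unfolding \<psi> by (rule continuous_sus_cell [OF finite_CW_structureD(5) [OF K e]])
    show "inj_on \<psi> (disk_interior (Suc n))"
    proof (rule inj_onI)
      fix x y assume x: "x \<in> disk_interior (Suc n)" and y: "y \<in> disk_interior (Suc n)" and eq: "\<psi> x = \<psi> y"
      have x': "x \<in> disk_set (Suc n)" and y': "y \<in> disk_set (Suc n)" using x y by (auto simp: disk_interior_eq)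
      note t = last_coordinate(2) [OF x' x] last_coordinate(2) [OF y' y]
      note ex = slice_coords_cases [of x n, OF x' t(1)] and ey = slice_coords_cases [of y n, OF y' t(2)]
      have "pt (\<phi> (slice_coords n x)) ((1 + x n) / 2) = pt (\<phi> (slice_coords n y)) ((1 + y n) / 2)"
        using eq by (simp add: \<psi> sus_cell_def)
      then have "\<phi> (slice_coords n x) = \<phi> (slice_coords n y) \<and> (1 + x n) / 2 = (1 + y n) / 2"
        by (rule pt_inj [rotated -1]) (use t ex(1) ey(1) cell_in_base [OF e] in auto)
      then have "slice_coords n x = slice_coords n y" "x n = y n"
        using finite_CW_structureD(6) [OF K e] ex(2) [OF x] ey(2) [OF y] by (auto dest: inj_onD)
      then show "x = y" using ex(4) ey(4) by metis
    qed
    show "\<psi> ` disk_boundary (Suc n) \<subseteq> skeleton (sus_cells K) (int (Suc n) - 1)"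
    proof
      fix w assume "w \<in> \<psi> ` disk_boundary (Suc n)"
      then obtain x where x: "x \<in> disk_boundary (Suc n)" "w = pt (\<phi> (slice_coords n x)) ((1 + x n) / 2)"
        by (auto simp: \<psi> sus_cell_def)
      then have x': "x \<in> disk_set (Suc n)" by (simp add: disk_boundary_eq)
      have "w \<in> sus (skeleton K (int n - 1))"
      proof (cases "\<bar>x n\<bar> < 1")
        case True
        have "slice_coords n x \<in> disk_boundary n" using slice_coords_cases(3) [of x n, OF x' True x(1)] .
        then have "\<phi> (slice_coords n x) \<in> skeleton K (int n - 1)" using finite_CW_structureD(7) [OF K e] by blast
        then show ?thesis using True skeleton_subset [OF K] unfolding x(2) by (intro pt_sus) auto
      next
        case False
        then have "x n = 1 \<or> x n = -1" using last_coordinate(1) [OF x'] by auto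
        then show ?thesis using x(2) by (auto simp: sus_def)
      qed
      then show "w \<in> skeleton (sus_cells K) (int (Suc n) - 1)" by (simp add: skeleton_sus_cells)
    qed
  qed
  have "case e of (n,\<phi>) \<Rightarrow> continuous_map (disk n) W \<phi> \<and> inj_on \<phi> (disk_interior n) \<and>
          \<phi> ` disk_boundary n \<subseteq> skeleton (sus_cells K) (int n - 1)" if e: "e \<in> sus_cells K" for e
  proof -
    consider "e = (0, \<lambda>_. south)" | "e = (0, \<lambda>_. north)" | n \<phi> where "(n,\<phi>) \<in> K" "e = sus_cell (n,\<phi>)"
      using e unfolding sus_cells_def by auto
    then show ?thesis
    proof cases
      case (3 n \<phi>)
      then have "e = (Suc n, snd (sus_cell (n,\<phi>)))" by (simp add: sus_cell_def)
      then show ?thesis using cell [OF 3(1) refl] by simp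
    qed (simp_all only: prod.case, (rule pole, simp)+)
  qed
  moreover have "disjoint_family_on open_cell (sus_cells K)"
  proof -
    have L: "open_cell e \<subseteq> topspace L" if "e \<in> K" for e
      using finite_CW_structureD(4) [OF K] that by blast
    have sc: "open_cell (sus_cell e) = {pt y t | y t. y \<in> open_cell e \<and> 0 < t \<and> t < 1}" if "e \<in> K" for e
      using open_cell_sus_cell [of "fst e" "snd e"] that by simp
    have poles': "south \<notin> open_cell (sus_cell e)" "north \<notin> open_cell (sus_cell e)" if "e \<in> K" for e
    proof -
      have "height w \<noteq> 0 \<and> height w \<noteq> 1" if "w \<in> open_cell (sus_cell e)" for w
        using that L [OF \<open>e \<in> K\<close>] unfolding sc [OF \<open>e \<in> K\<close>] by auto
      from this [of south] this [of north] show "south \<notin> open_cell (sus_cell e)" "north \<notin> open_cell (sus_cell e)"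
        by auto
    qed
    have "open_cell (sus_cell e) \<inter> open_cell (sus_cell e') = {}" if e: "e \<in> K" "e' \<in> K" and ne: "sus_cell e \<noteq> sus_cell e'" for e e'
    proof -
      have "open_cell e \<inter> open_cell e' = {}"
      proof -
        have "e \<noteq> e'" using ne by blast
        then show ?thesis by (rule disjoint_family_onD [OF finite_CW_structureD(3) [OF K] e])
      qed
      then have "y \<noteq> y'" if "y \<in> open_cell e" "y' \<in> open_cell e'" for y y' using that by blast
      then show ?thesis
        unfolding sc [OF e(1)] sc [OF e(2)] using pt_inj L [OF e(1)] L [OF e(2)]
        by (smt (verit, best) disjoint_iff mem_Collect_eq subsetD)
    qed
    then show ?thesis
      using poles' unfolding disjoint_family_on_def sus_cells_def by (auto simp: open_cells_poles)
  qed
  moreover have "(\<Union>e\<in>sus_cells K. open_cell e) = topspace W"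
  proof -
    obtain N where N: "\<And>e. e \<in> K \<Longrightarrow> int (fst e) \<le> N" using finite_CW_structure_top [OF K] by blast
    let ?p = "max 0 (N + 1)"
    have "int (fst e) \<le> ?p" if "e \<in> sus_cells K" for e
      using that N unfolding sus_cells_def by (force simp: sus_cell_def)
    then have "{e \<in> sus_cells K. int (fst e) \<le> ?p} = sus_cells K" by blast
    then have "(\<Union>e\<in>sus_cells K. open_cell e) = skeleton (sus_cells K) ?p"
      unfolding skeleton_def by (rule arg_cong [OF sym])
    also have "\<dots> = sus (skeleton K (?p - 1))" by (rule skeleton_sus_cells) simp
    also have "skeleton K (?p - 1) = topspace L"
      using N by (intro skeleton_top [OF K]) fastforce
    finally show ?thesis by (simp only: sus_all)
  qed
  moreover have "finite (sus_cells K)" using finite_CW_structureD(2) [OF K] by (simp add: sus_cells_def)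
  ultimately show ?thesis
    unfolding finite_CW_structure_def using Hausdorff_W by blast
qed

end
end

section \<open>Cellular chains of the suspension\<close>

lemma mult_homology_classes:
  "homologous_rel_set p X S a \<otimes>\<^bsub>relative_homology_group (int p) X S\<^esub> homologous_rel_set p X S b
     = homologous_rel_set p X S (a + b)"
proof -
  have "\<exists>r s. x = r + s \<and> homologous_rel p X S a r \<and> homologous_rel p X S b s"
    if "homologous_rel p X S (a + b) x" for x
  proof (intro exI conjI)
    show "x = a + (x - a)" by simp
    show "homologous_rel p X S b (x - a)"
      using homologous_rel_diff [OF that homologous_rel_refl [of p X S a]] by simp
  qed simp
  then show ?thesis
    unfolding mult_relative_homology_group using homologous_rel_add by fastforce
qed

lemma int_pow_homology_class:
  assumes "singular_relcycle p X S c"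
  shows "homologous_rel_set p X S c [^]\<^bsub>relative_homology_group (int p) X S\<^esub> z
       = homologous_rel_set p X S (frag_cmul z c)"
proof -
  let ?G = "relative_homology_group (int p) X S"
  have car: "homologous_rel_set p X S (frag_cmul z c) \<in> carrier ?G" for z
    unfolding carrier_relative_homology_group by (rule imageI) (simp add: singular_relcycle_cmul [OF assms])
  interpret h: group_hom integer_group ?G "\<lambda>z. homologous_rel_set p X S (frag_cmul z c)"
    using car by (auto simp: group_hom_def group_hom_axioms_def hom_def mult_homology_classes frag_cmul_distrib)
  have "homologous_rel_set p X S (frag_cmul ((1::int) [^]\<^bsub>integer_group\<^esub> z) c)
      = homologous_rel_set p X S (frag_cmul 1 c) [^]\<^bsub>?G\<^esub> z"
    by (rule h.hom_int_pow) simp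
  then show ?thesis by simp
qed

lemma inv_homology_class:
  assumes "singular_relcycle p X S c"
  shows "inv\<^bsub>relative_homology_group (int p) X S\<^esub> (homologous_rel_set p X S c) = homologous_rel_set p X S (- c)"
proof (rule group.inv_equality)
  show "homologous_rel_set p X S (- c) \<otimes>\<^bsub>relative_homology_group (int p) X S\<^esub> homologous_rel_set p X S c
     = \<one>\<^bsub>relative_homology_group (int p) X S\<^esub>"
    by (simp only: mult_homology_classes one_relative_homology_group homologous_rel_set_eq_relboundary) simp
qed (use assms in \<open>auto simp: carrier_relative_homology_group singular_relcycle_minus\<close>)

text \<open>Needed to change the sign of an isomorphism between homology groups.\<close>

lemma (in comm_group) iso_inverse: "m_inv G \<in> iso G G"
proof (rule isoI)
  show "m_inv G \<in> hom G G" by (auto simp: hom_def inv_mult)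
  show "bij_betw (m_inv G) (carrier G) (carrier G)"
    by (rule bij_betw_byWitness [where f' = "m_inv G"]) auto
qed

text \<open>On representatives the cellular differential is the singular boundary.\<close>

lemma cellular_boundary_class:
  assumes c: "singular_relcycle (Suc m) (subtopology X (skeleton K (int (Suc m)) \<union> A)) (skeleton K (int m) \<union> A) c"
  shows "cellular_boundary X K A (int (Suc m))
           (homologous_rel_set (Suc m) (subtopology X (skeleton K (int (Suc m)) \<union> A)) (skeleton K (int m) \<union> A) c)
       = homologous_rel_set m (subtopology X (skeleton K (int m) \<union> A)) (skeleton K (int m - 1) \<union> A) (chain_boundary (Suc m) c)"
proof -
  let ?X = "subtopology X (skeleton K (int (Suc m)) \<union> A)" and ?Y = "subtopology X (skeleton K (int m) \<union> A)"
  let ?S = "skeleton K (int m) \<union> A"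
  have "skeleton K (int m) \<subseteq> skeleton K (int (Suc m))" by (rule skeleton_mono) simp
  then have Y: "subtopology ?X ?S = ?Y" by (intro nested_subtopology) blast
  have bc: "singular_chain m ?Y (chain_boundary (Suc m) c)"
    using c unfolding singular_relcycle Y by simp
  have "chain_boundary m (chain_boundary (Suc m) c) = 0"
    using c chain_boundary_boundary_alt unfolding singular_relcycle by blast
  then have bcyc: "singular_relcycle m ?Y {} (chain_boundary (Suc m) c)"
    using bc by (simp add: singular_cycle)
  have b: "hom_boundary (int (Suc m)) ?X ?S (homologous_rel_set (Suc m) ?X ?S c) = homologous_rel_set m ?Y {} (chain_boundary (Suc m) c)"
    using hom_boundary_chain_boundary [OF c] unfolding Y by simp
  have eq: "int (Suc m) - 1 = int m" "int (Suc m) - 2 = int m - 1" by auto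
  have "hom_induced (int m) ?Y {} ?Y (skeleton K (int m - 1) \<union> A) id (homologous_rel_set m ?Y {} (chain_boundary (Suc m) c))
      = homologous_rel_set m ?Y (skeleton K (int m - 1) \<union> A) (chain_map m id (chain_boundary (Suc m) c))"
    by (rule hom_induced_chain_map [OF _ _ bcyc]) auto
  then show ?thesis
    unfolding cellular_boundary_def eq o_def b chain_map_ident [OF bc] .
qed

lemma chain_map_const_0:
  "chain_map 0 (\<lambda>_. s) a = frag_cmul (coefficient_sum a) (frag_of (restrict (\<lambda>_. s) (standard_simplex 0)))"
proof -
  have "Poly_Mapping.keys a \<subseteq> UNIV" by simp
  then show ?thesis
  proof (induction a rule: frag_induction)
    case (one \<sigma>)
    then show ?case by (simp add: simplex_map_def o_def restrict_def)
  next
    case (diff a b)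
    then show ?case by (simp add: chain_map_diff frag_cmul_diff_distrib)
  qed simp
qed

text \<open>Excising the second point leaves a single point, whose homology in degree 0 is generated by its vertex.\<close>

lemma iso_integer_pair:
  assumes "Hausdorff_space W" and s: "s \<in> topspace W" and n: "n \<in> topspace W" and "s \<noteq> n"
  shows "(\<lambda>z. homologous_rel_set 0 (subtopology W {s,n}) {n} (frag_cmul z (frag_of (restrict (\<lambda>_. s) (standard_simplex 0)))))
     \<in> iso integer_group (relative_homology_group 0 (subtopology W {s,n}) {n})"
proof -
  let ?X = "subtopology W {s,n}" and ?Y = "subtopology W {s}"
  let ?\<sigma> = "restrict (\<lambda>_. s) (standard_simplex 0)"
  have T1: "t1_space W" using assms(1) by (rule Hausdorff_imp_t1_space)
  have cl: "closedin ?X {x}" if "x \<in> {s,n}" for x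
    using T1 that s n by (intro closedin_subset_topspace) (auto simp: closedin_t1_singleton)
  have "topspace ?X - {s} = {n}" using s n \<open>s \<noteq> n\<close> by auto
  then have op: "openin ?X {n}" using cl [of s] by (metis closedin_def insertI1)
  have "?X closure_of {n} \<subseteq> ?X interior_of {n}"
    using cl [of n] op by (simp add: closure_of_closedin interior_of_openin)
  from homology_excision_axiom [OF this, of "{s,n}" 0]
  have "hom_induced 0 (subtopology ?X ({s,n} - {n})) ({n} - {n}) (subtopology ?X {s,n}) {n} id
     \<in> iso (relative_homology_group 0 (subtopology ?X ({s,n} - {n})) ({n} - {n})) (relative_homology_group 0 (subtopology ?X {s,n}) {n})"
    by simp
  moreover have "{s,n} - {n} = {s}" using \<open>s \<noteq> n\<close> by auto
  moreover have "subtopology ?X {s} = ?Y" "subtopology ?X {s,n} = ?X"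
    by (rule nested_subtopology; simp)+
  ultimately have exc: "hom_induced 0 ?Y {} ?X {n} id \<in> iso (homology_group 0 ?Y) (relative_homology_group 0 ?X {n})"
    by simp
  have \<sigma>: "singular_simplex 0 ?Y ?\<sigma>"
    using s by (simp add: singular_simplex_def continuous_map_in_subtopology)
  have path: "path_connected_space ?Y"
    using s path_connectedin_singleton [of W s] by (simp add: path_connectedin_def)
  have cyc: "singular_relcycle 0 ?Y {} (frag_cmul z (frag_of ?\<sigma>))" for z
    using \<sigma> by (intro singular_relcycle_cmul) (simp add: singular_cycle singular_chain_of chain_boundary_def)
  have "hom_induced 0 ?Y {} ?X {n} id \<circ> pow (homology_group 0 ?Y) (homologous_rel_set 0 ?Y {} (frag_of ?\<sigma>))
     \<in> iso integer_group (relative_homology_group 0 ?X {n})"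
    by (rule iso_set_trans [OF iso_integer_zeroth_homology_group [OF path \<sigma>] exc])
  moreover have "(hom_induced 0 ?Y {} ?X {n} id \<circ> pow (homology_group 0 ?Y) (homologous_rel_set 0 ?Y {} (frag_of ?\<sigma>))) z
    = homologous_rel_set 0 ?X {n} (frag_cmul z (frag_of ?\<sigma>))" for z
  proof -
    have "hom_induced (int 0) ?Y {} ?X {n} id (homologous_rel_set 0 ?Y {} (frag_cmul z (frag_of ?\<sigma>)))
       = homologous_rel_set 0 ?X {n} (chain_map 0 id (frag_cmul z (frag_of ?\<sigma>)))"
      by (rule hom_induced_chain_map [OF _ _ cyc]) (auto simp: continuous_map_in_subtopology)
    moreover have "chain_map 0 id (frag_cmul z (frag_of ?\<sigma>)) = frag_cmul z (frag_of ?\<sigma>)"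
      using cyc [of z] by (intro chain_map_ident [of 0 ?Y]) (simp add: singular_relcycle)
    ultimately show ?thesis
      using int_pow_homology_class [OF cyc [of 1], of z] by simp
  qed
  ultimately show ?thesis by (simp add: o_def)
qed

context suspension_coordinates
begin

lemma signed_suspension_iso:
  fixes e :: int
  assumes "B \<subseteq> A" "A \<subseteq> topspace L" "e = 1 \<or> e = - 1"
  obtains \<Phi> where "\<Phi> \<in> iso (relative_homology_group (int k) (subtopology L A) B)
                              (relative_homology_group (int k + 1) (subtopology W (sus A)) (sus B))"
    "\<And>c. singular_relcycle k (subtopology L A) B c \<Longrightarrow>
       \<Phi> (homologous_rel_set k (subtopology L A) B c)
         = homologous_rel_set (Suc k) (subtopology W (sus A)) (sus B) (frag_cmul e (cone_chain 1 k c))"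
proof -
  obtain \<Phi> where \<Phi>: "\<Phi> \<in> iso (relative_homology_group (int k) (subtopology L A) B)
                              (relative_homology_group (int k + 1) (subtopology W (sus A)) (sus B))"
    "\<And>c. singular_relcycle k (subtopology L A) B c \<Longrightarrow>
       \<Phi> (homologous_rel_set k (subtopology L A) B c)
         = homologous_rel_set (Suc k) (subtopology W (sus A)) (sus B) (cone_chain 1 k c)"
    using suspension_iso [OF assms(1,2)] by metis
  show thesis
  proof (cases "e = 1")
    case True
    then show thesis using that \<Phi> by simp
  next
    case False
    then have e: "e = - 1" using assms by simp
    let ?G = "relative_homology_group (int k) (subtopology L A) B"
    interpret comm_group ?G by simp
    show thesis
    proof (rule that)
      show "\<Phi> \<circ> m_inv ?G \<in> iso ?G (relative_homology_group (int k + 1) (subtopology W (sus A)) (sus B))"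
        by (rule iso_set_trans [OF iso_inverse \<Phi>(1)])
      fix c assume c: "singular_relcycle k (subtopology L A) B c"
      then have "\<Phi> (homologous_rel_set k (subtopology L A) B (- c))
           = homologous_rel_set (Suc k) (subtopology W (sus A)) (sus B) (cone_chain 1 k (- c))"
        by (intro \<Phi>(2)) (simp add: singular_relcycle_minus)
      moreover have "cone_chain 1 k (- c) = frag_cmul e (cone_chain 1 k c)"
        using cone_chain_simps(4) [of 1 k "-1" c] by (simp add: e)
      ultimately show "(\<Phi> \<circ> m_inv ?G) (homologous_rel_set k (subtopology L A) B c)
         = homologous_rel_set (Suc k) (subtopology W (sus A)) (sus B) (frag_cmul e (cone_chain 1 k c))"
        by (simp add: inv_homology_class [OF c])
    qed
  qed
qed

lemma singular_chain_north:
  assumes "singular_chain k X c"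
  shows "singular_chain k (subtopology W (sus B)) (chain_map k (\<lambda>x. pt x 1) c)"
proof -
  have "continuous_map X (subtopology W (sus B)) (\<lambda>x. north)"
    by (auto simp: continuous_map_in_subtopology sus_def)
  from singular_chain_chain_map [OF assms this] show ?thesis by simp
qed

text \<open>The boundary of the suspension of a relative cycle consists of a chain at the north pole and a chain over
\<open>B\<close>.\<close>

lemma cone_relcycle:
  assumes "singular_relcycle k (subtopology L A) B c"
  shows "singular_relcycle (Suc k) (subtopology W (sus A)) (sus B) (cone_chain 1 k c)"
proof -
  have cc: "singular_chain k (subtopology L A) c" using assms by (simp add: singular_relcycle)
  obtain e where e: "chain_boundary (Suc k) (cone_chain 1 k c) = chain_map k (\<lambda>x. pt x 1) c - e"
    "singular_chain k (subtopology W (band B {0..1})) e"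
    using boundary_cone_relcycle [OF assms, of 1] by auto
  have eW: "singular_chain k W e" and e': "singular_chain k (subtopology W (sus B)) e"
    using e(2) singular_chain_mono [of k W "band B {0..1}" e "sus B"]
    by (auto simp: singular_chain_subtopology band_def)
  have "singular_chain (Suc k) (subtopology W (sus A)) (cone_chain 1 k c)"
    using singular_chain_cone [OF cc, of 1] by (rule singular_chain_mono) (auto simp: band_def)
  moreover have "singular_chain k (subtopology W (sus B)) (chain_boundary (Suc k) (cone_chain 1 k c))"
    unfolding e(1) by (intro singular_chain_diff singular_chain_north [OF cc] e')
  moreover then have "singular_chain k (subtopology (subtopology W (sus A)) (sus B)) (chain_boundary (Suc k) (cone_chain 1 k c))"
    using singular_chain_boundary_alt [OF \<open>singular_chain (Suc k) (subtopology W (sus A)) (cone_chain 1 k c)\<close>]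
    by (auto simp: singular_chain_subtopology)
  ultimately show ?thesis by (simp add: singular_relcycle)
qed

context
  fixes K :: "'a cell set"
  assumes K: "finite_CW_structure L K"
begin

text \<open>Adding the north pole changes only the skeleta of negative degree.\<close>

lemma skeleton_sus_cells_with_north: "insert north (skeleton (sus_cells K) p) = (if p < 0 then {north} else sus (skeleton K (p - 1)))"
  by (auto simp: skeleton_sus_cells [OF K] skeleton_negative) (auto simp: sus_def)

lemma chain_group_sus_cells:
  "0 \<le> k \<Longrightarrow> cellular_chain_group W (sus_cells K) {north} (k + 1)
     = relative_homology_group (k + 1) (subtopology W (sus (skeleton K k))) (sus (skeleton K (k - 1)))"
  by (simp add: cellular_chain_group_def skeleton_sus_cells_with_north)

lemma chain_group_sus_cells_0:
  "cellular_chain_group W (sus_cells K) {north} 0 = relative_homology_group 0 (subtopology W {south, north}) {north}"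
  by (simp add: cellular_chain_group_def skeleton_sus_cells_with_north skeleton_negative sus_empty)

lemma boundary_sus_cells:
  assumes c: "singular_relcycle (Suc m) (subtopology W (sus (skeleton K (int m)))) (sus (skeleton K (int m - 1))) c"
  shows "cellular_boundary W (sus_cells K) {north} (int m + 1)
           (homologous_rel_set (Suc m) (subtopology W (sus (skeleton K (int m)))) (sus (skeleton K (int m - 1))) c)
       = homologous_rel_set m (subtopology W (sus (skeleton K (int m - 1))))
           (if m = 0 then {north} else sus (skeleton K (int m - 2))) (chain_boundary (Suc m) c)"
  using cellular_boundary_class [of m W "sus_cells K" "{north}" c] c
  by (simp add: skeleton_sus_cells_with_north add.commute)

text \<open>The map \<open>\<theta> k\<close> is the inverse of \<open>\<Phi> k\<close>, which sends the class of \<open>c\<close> to \<open>(-1)\<^sup>k\<^sup>+\<^sup>1\<close> times the class of its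
suspension. With this sign the relation between suspension and boundary, which is an anticommutation,
becomes commutation. It also makes the boundary of a suspended vertex
the south pole minus the north pole, so that the class of a 0-chain goes to its coefficient sum.\<close>

theorem cellular_chains_sus_cells:
  obtains \<theta>\<^sub>0 \<theta> where
    "\<theta>\<^sub>0 \<in> iso (cellular_chain_group W (sus_cells K) {north} 0) integer_group"
    "\<theta>\<^sub>0 (vertex_class W (sus_cells K) {north} south) = 1"
    "\<And>k. 0 \<le> k \<Longrightarrow> \<theta> k \<in> iso (cellular_chain_group W (sus_cells K) {north} (k + 1)) (cellular_chain_group L K {} k)"
    "\<And>x. x \<in> carrier (cellular_chain_group W (sus_cells K) {north} 1) \<Longrightarrow>
       \<theta>\<^sub>0 (cellular_boundary W (sus_cells K) {north} 1 x) = cellular_augmentation (\<theta> 0 x)"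
    "\<And>k x. \<lbrakk>1 \<le> k; x \<in> carrier (cellular_chain_group W (sus_cells K) {north} (k + 1))\<rbrakk> \<Longrightarrow>
       \<theta> (k - 1) (cellular_boundary W (sus_cells K) {north} (k + 1) x) = cellular_boundary L K {} k (\<theta> k x)"
proof -
  let ?M = "sus_cells K" and ?L = "\<lambda>k::int. subtopology L (skeleton K k)" and ?W = "\<lambda>k::int. subtopology W (sus (skeleton K k))"
  let ?CW = "\<lambda>k. cellular_chain_group W ?M {north} k" and ?CL = "\<lambda>k. cellular_chain_group L K {} k"
  let ?e = "\<lambda>k::nat. (-1::int) ^ Suc k"
  let ?s = "frag_of (restrict (\<lambda>_. south) (standard_simplex 0))"
  have CL: "?CL k = relative_homology_group k (?L k) (skeleton K (k - 1))" for k
    by (simp add: cellular_chain_group_def)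
  have "\<exists>\<Phi>. \<Phi> \<in> iso (?CL (int k)) (?CW (int k + 1)) \<and>
    (\<forall>c. singular_relcycle k (?L (int k)) (skeleton K (int k - 1)) c \<longrightarrow>
       \<Phi> (homologous_rel_set k (?L (int k)) (skeleton K (int k - 1)) c)
         = homologous_rel_set (Suc k) (?W (int k)) (sus (skeleton K (int k - 1))) (frag_cmul (?e k) (cone_chain 1 k c)))" for k
  proof -
    have 1: "skeleton K (int k - 1) \<subseteq> skeleton K (int k)" by (rule skeleton_mono) simp
    have 2: "?e k = 1 \<or> ?e k = - 1" by (cases "even k") auto
    show ?thesis
      unfolding CL chain_group_sus_cells [OF of_nat_0_le_iff]
      by (rule signed_suspension_iso [OF 1 skeleton_subset [OF K] 2, of k]) blast
  qed
  then obtain \<Phi> where \<Phi>: "\<And>k. \<Phi> k \<in> iso (?CL (int k)) (?CW (int k + 1))"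
    and \<Phi>_class: "\<And>k c. singular_relcycle k (?L (int k)) (skeleton K (int k - 1)) c \<Longrightarrow>
       \<Phi> k (homologous_rel_set k (?L (int k)) (skeleton K (int k - 1)) c)
         = homologous_rel_set (Suc k) (?W (int k)) (sus (skeleton K (int k - 1))) (frag_cmul (?e k) (cone_chain 1 k c))"
    by metis
  define \<theta> where "\<theta> k = inv_into (carrier (?CL k)) (\<Phi> (nat k))" for k :: int
  have grL: "group (?CL k)" for k by (simp add: CL)
  have \<theta>: "\<theta> k \<in> iso (?CW (k + 1)) (?CL k)" if "0 \<le> k" for k
    using group.iso_set_sym [OF grL \<Phi> [of "nat k"]] that by (simp add: \<theta>_def)
  have \<theta>\<Phi>: "\<theta> (int k) (\<Phi> k y) = y" if "y \<in> carrier (?CL (int k))" for k y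
    using \<Phi> [of k] that by (simp add: \<theta>_def iso_iff inv_into_f_f)
  have rep: "\<exists>c. singular_relcycle k (?L (int k)) (skeleton K (int k - 1)) c \<and>
       x = \<Phi> k (homologous_rel_set k (?L (int k)) (skeleton K (int k - 1)) c)"
    if "x \<in> carrier (?CW (int k + 1))" for k x
  proof -
    have "x \<in> \<Phi> k ` carrier (?CL (int k))" using \<Phi> [of k] that by (simp add: iso_iff)
    then show ?thesis by (auto simp: CL carrier_relative_homology_group)
  qed
  have class_carrier: "homologous_rel_set k (?L (int k)) (skeleton K (int k - 1)) c \<in> carrier (?CL (int k))"
    if "singular_relcycle k (?L (int k)) (skeleton K (int k - 1)) c" for k c
    using that by (auto simp: CL carrier_relative_homology_group)
  have cone_cyc: "singular_relcycle (Suc k) (?W (int k)) (sus (skeleton K (int k - 1))) (frag_cmul (?e k) (cone_chain 1 k c))"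
    if "singular_relcycle k (?L (int k)) (skeleton K (int k - 1)) c" for k c
    by (rule singular_relcycle_cmul [OF cone_relcycle [OF that]])
  define \<Psi> where "\<Psi> z = homologous_rel_set 0 (subtopology W {south, north}) {north} (frag_cmul z ?s)" for z
  have \<Psi>: "\<Psi> \<in> iso integer_group (?CW 0)"
    using iso_integer_pair [OF Hausdorff_W poles(1,2) south_ne_north] unfolding \<Psi>_def chain_group_sus_cells_0 .
  define \<theta>\<^sub>0 where "\<theta>\<^sub>0 = inv_into (carrier integer_group) \<Psi>"
  have \<theta>\<^sub>0\<Psi>: "\<theta>\<^sub>0 (\<Psi> z) = z" for z
    using \<Psi> unfolding \<theta>\<^sub>0_def by (intro inv_into_f_f) (auto simp: iso_iff)
  show thesis
  proof (rule that)
    show "\<theta>\<^sub>0 \<in> iso (?CW 0) integer_group"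
      unfolding \<theta>\<^sub>0_def by (rule group.iso_set_sym [OF group_integer_group \<Psi>])
    have "vertex_class W ?M {north} south = \<Psi> 1"
      by (simp add: vertex_class_def \<Psi>_def skeleton_sus_cells_with_north skeleton_negative sus_empty)
    then show "\<theta>\<^sub>0 (vertex_class W ?M {north} south) = 1" by (simp add: \<theta>\<^sub>0\<Psi>)
    show "\<theta> k \<in> iso (?CW (k + 1)) (?CL k)" if "0 \<le> k" for k by (rule \<theta> [OF that])
    show "\<theta>\<^sub>0 (cellular_boundary W ?M {north} 1 x) = cellular_augmentation (\<theta> 0 x)"
      if x: "x \<in> carrier (?CW 1)" for x
    proof -
      obtain c where c: "singular_relcycle 0 (?L (int 0)) (skeleton K (int 0 - 1)) c"
        and xc: "x = \<Phi> 0 (homologous_rel_set 0 (?L (int 0)) (skeleton K (int 0 - 1)) c)"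
        using rep [of x 0] x by auto
      have "cellular_boundary W ?M {north} (int 0 + 1) x
        = homologous_rel_set 0 (subtopology W {south, north}) {north} (chain_boundary (Suc 0) (frag_cmul (?e 0) (cone_chain 1 0 c)))"
        unfolding xc \<Phi>_class [OF c] boundary_sus_cells [OF cone_cyc [OF c]] by (simp add: skeleton_negative sus_empty)
      also have "chain_boundary (Suc 0) (frag_cmul (?e 0) (cone_chain 1 0 c))
          = chain_map 0 (\<lambda>_. south) c - chain_map 0 (\<lambda>x. pt x 1) c"
        by (simp add: chain_boundary_minus boundary_cone_chain_0)
      also have "homologous_rel_set 0 (subtopology W {south, north}) {north} (chain_map 0 (\<lambda>_. south) c - chain_map 0 (\<lambda>x. pt x 1) c)
         = homologous_rel_set 0 (subtopology W {south, north}) {north} (chain_map 0 (\<lambda>_. south) c)"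
      proof -
        have "continuous_map (?L 0) (subtopology (subtopology W {south,north}) {north}) (\<lambda>_. north)"
          by (simp add: continuous_map_in_subtopology)
        moreover have "singular_chain 0 (?L 0) c" using c by (simp add: singular_relcycle)
        ultimately have "singular_chain 0 (subtopology (subtopology W {south,north}) {north}) (chain_map 0 (\<lambda>_. north) c)"
          by (intro singular_chain_chain_map)
        then show ?thesis
          by (intro homology_class_eqI) (simp add: singular_chain_minus)
      qed
      also have "\<dots> = \<Psi> (coefficient_sum c)" by (simp add: \<Psi>_def chain_map_const_0)
      finally have "\<theta>\<^sub>0 (cellular_boundary W ?M {north} 1 x) = coefficient_sum c" by (simp add: \<theta>\<^sub>0\<Psi>)
      moreover have "\<theta> 0 x = homologous_rel_set 0 (?L 0) {} c"
        using \<theta>\<Phi> [OF class_carrier [OF c]] xc by (simp add: skeleton_negative)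
      ultimately show ?thesis by (simp add: cellular_augmentation)
    qed
    show "\<theta> (k - 1) (cellular_boundary W ?M {north} (k + 1) x) = cellular_boundary L K {} k (\<theta> k x)"
      if k: "1 \<le> k" and x: "x \<in> carrier (?CW (k + 1))" for k x
    proof -
      have "k = int (Suc (nat (k - 1)))" using k by simp
      then obtain l where kl: "k = int (Suc l)" by blast
      obtain c where c: "singular_relcycle (Suc l) (?L (int (Suc l))) (skeleton K (int (Suc l) - 1)) c"
        and xc: "x = \<Phi> (Suc l) (homologous_rel_set (Suc l) (?L (int (Suc l))) (skeleton K (int (Suc l) - 1)) c)"
        using rep [of x "Suc l"] x unfolding kl by blast
      have l: "int (Suc l) - 1 = int l" "int (Suc l) - 2 = int l - 1" by auto
      let ?b = "chain_boundary (Suc l) c"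
      have cc: "singular_chain (Suc l) (?L (int (Suc l))) c" using c by (simp add: singular_relcycle)
      have dL: "cellular_boundary L K {} (int (Suc l)) (homologous_rel_set (Suc l) (?L (int (Suc l))) (skeleton K (int (Suc l) - 1)) c)
          = homologous_rel_set l (?L (int l)) (skeleton K (int l - 1)) ?b"
        using cellular_boundary_class [of l L K "{}" c] c unfolding l by simp
      have "skeleton K (int l) \<subseteq> skeleton K (int (Suc l))" by (rule skeleton_mono) simp
      then have "subtopology (?L (int (Suc l))) (skeleton K (int l)) = ?L (int l)" by (rule nested_subtopology)
      then have "singular_chain l (?L (int l)) ?b" using c unfolding l by (simp add: singular_relcycle)
      moreover have "chain_boundary l ?b = 0" using cc chain_boundary_boundary_alt by blast
      ultimately have b: "singular_relcycle l (?L (int l)) (skeleton K (int l - 1)) ?b"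
        by (simp add: singular_relcycle)
      let ?S = "sus (skeleton K (int l - 1))"
      have "cellular_boundary W ?M {north} (int (Suc l) + 1) x
        = homologous_rel_set (Suc l) (?W (int l)) ?S (chain_boundary (Suc (Suc l)) (frag_cmul (?e (Suc l)) (cone_chain 1 (Suc l) c)))"
        unfolding xc unfolding \<Phi>_class [OF c] unfolding boundary_sus_cells [OF cone_cyc [OF c]] unfolding l by simp
      also have "chain_boundary (Suc (Suc l)) (frag_cmul (?e (Suc l)) (cone_chain 1 (Suc l) c))
         = frag_cmul (?e (Suc l)) (chain_map (Suc l) (\<lambda>x. pt x 1) c) + frag_cmul (?e l) (cone_chain 1 l ?b)"
      proof -
        have "frag_cmul a (x - y) = frag_cmul a x + frag_cmul (- a) y" for a and x y :: "'w chain"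
          using frag_cmul_distrib2 [of a x "- y"] frag_cmul_cmul [of a "-1" y] by (simp del: frag_cmul_cmul)
        then show ?thesis by (simp add: chain_boundary_cmul boundary_cone_chain_Suc)
      qed
      also have "homologous_rel_set (Suc l) (?W (int l)) ?S \<dots>
         = homologous_rel_set (Suc l) (?W (int l)) ?S (frag_cmul (?e l) (cone_chain 1 l ?b))"
      proof -
        have "sus (skeleton K (int l - 1)) \<subseteq> sus (skeleton K (int l))"
          by (intro sus_mono skeleton_mono) simp
        then have "subtopology (?W (int l)) ?S = subtopology W ?S" by (rule nested_subtopology)
        then have "singular_chain (Suc l) (subtopology (?W (int l)) ?S) (frag_cmul (?e (Suc l)) (chain_map (Suc l) (\<lambda>x. pt x 1) c))"
          using singular_chain_north [OF cc] by (intro singular_chain_cmul) (simp only:)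
        then show ?thesis
          by (intro homology_class_eqI) (simp only: add_diff_cancel_right')
      qed
      also have "\<dots> = \<Phi> l (homologous_rel_set l (?L (int l)) (skeleton K (int l - 1)) ?b)"
        by (rule \<Phi>_class [OF b, symmetric])
      finally have "\<theta> (int l) (cellular_boundary W ?M {north} (int (Suc l) + 1) x)
          = homologous_rel_set l (?L (int l)) (skeleton K (int l - 1)) ?b"
        using \<theta>\<Phi> [OF class_carrier [OF b]] by simp
      also have "\<dots> = cellular_boundary L K {} (int (Suc l)) (\<theta> (int (Suc l)) x)"
        unfolding xc \<theta>\<Phi> [OF class_carrier [OF c]] dL ..
      finally show ?thesis unfolding kl l .
    qed
  qed
qed

end

section \<open>Homology and homeomorphism type of the suspension\<close>

lemma middle_band_homotopy_equivalent:
  "subtopology W (band (topspace L) {1/2..<3/4}) homotopy_equivalent_space L"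
  unfolding homotopy_equivalent_space_def
proof (intro exI conjI)
  let ?R = "band (topspace L) {1/2..<3/4}" and ?m = "\<lambda>x. pt x (1/2)"
  have R: "?R \<subseteq> {w \<in> topspace W. 0 < height w \<and> height w < 1}" by (auto simp: band_def sus_def)
  show "continuous_map (subtopology W ?R) L base"
    by (rule continuous_map_from_subtopology_mono [OF continuous_base R])
  show "continuous_map L (subtopology W ?R) ?m"
    by (auto simp: continuous_map_in_subtopology continuous_pt_at band_def sus_def)
  have "homotopic_with (\<lambda>h. h \<in> {} \<rightarrow> {}) (subtopology W ?R) (subtopology W ?R) (slide clamp) id"
    by (intro slide_homotopic_id clamp slide_mix_band) (auto simp: clamp_def)
  then have "homotopic_with (\<lambda>h. True) (subtopology W ?R) (subtopology W ?R) (slide clamp) id" by simp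
  then show "homotopic_with (\<lambda>x. True) (subtopology W ?R) (subtopology W ?R) (?m \<circ> base) id"
  proof (rule homotopic_with_eq)
    fix w assume "w \<in> topspace (subtopology W ?R)"
    then have "clamp (height w) = 1/2" by (auto simp: band_def clamp_def)
    then show "(?m \<circ> base) w = slide clamp w" by (simp only: slide_def o_def)
  qed auto
  have "homotopic_with (\<lambda>x. True) L L id id" by simp
  then show "homotopic_with (\<lambda>x. True) L L (base \<circ> ?m) id"
    by (rule homotopic_with_eq) auto
qed

text \<open>The upper half retracts to the north pole and its top part is excised. What is left is a contractible
cone relative to a band homotopy equivalent to \<open>L\<close>.\<close>

theorem homology_suspension_mod_pole:
  "relative_homology_group i W {north} \<cong> reduced_homology_group (i - 1) L"
proof -
  let ?T = "band (topspace L) {1/2..}" and ?P = "band (topspace L) {..<3/4}" and ?R = "band (topspace L) {1/2..<3/4}"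
  have "hom_induced i (subtopology W (sus (topspace L))) ?T (subtopology W (sus (topspace L))) {north} (slide stretch)
     \<in> iso (relative_homology_group i (subtopology W (sus (topspace L))) ?T)
           (relative_homology_group i (subtopology W (sus (topspace L))) {north})"
  proof (rule iso_stretch)
    show "slide (\<lambda>t. (1 - s) * t + s * stretch t) w \<in> ?T" if "0 \<le> s" "s \<le> 1" "w \<in> ?T" for s w
      using that stretch by (intro slide_mix_band) (auto simp: stretch_def)
    show "slide stretch \<in> ?T \<rightarrow> {north}" by (auto simp: slide_def stretch_def band_def)
    show "slide (\<lambda>t. (1 - s) * t + s * stretch t) w \<in> {north}" if "w \<in> {north}" for s w
      using that by (simp add: slide_def stretch_def)
  qed (auto simp: band_def sus_def)
  then have a: "relative_homology_group i W ?T \<cong> relative_homology_group i W {north}"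
    unfolding sus_all subtopology_topspace by (rule is_isoI)
  have "{w \<in> ?T. height w < 3/4} = ?R" by (auto simp: band_def)
  moreover have "?T \<subseteq> sus (topspace L)" by (auto simp: band_def)
  ultimately have "hom_induced i (subtopology W ?P) ?R (subtopology W (sus (topspace L))) ?T id
     \<in> iso (relative_homology_group i (subtopology W ?P) ?R) (relative_homology_group i (subtopology W (sus (topspace L))) ?T)"
    using iso_excise_top [of ?T "topspace L" i] by simp
  then have b: "relative_homology_group i (subtopology W ?P) ?R \<cong> relative_homology_group i W ?T"
    unfolding sus_all subtopology_topspace by (rule is_isoI)
  obtain x where "x \<in> topspace L" using base_nonempty by blast
  then have "pt x (1/2) \<in> topspace (subtopology W ?P) \<inter> ?R" by (auto simp: band_def sus_def)
  then have "relative_homology_group i (subtopology W ?P) ?R \<cong> reduced_homology_group (i - 1) (subtopology (subtopology W ?P) ?R)"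
    by (intro isomorphic_group_relative_homology_of_contractible contractible_lower) blast
  moreover have "subtopology (subtopology W ?P) ?R = subtopology W ?R"
    by (rule nested_subtopology) (auto simp: band_def)
  ultimately have c: "relative_homology_group i (subtopology W ?P) ?R \<cong> reduced_homology_group (i - 1) (subtopology W ?R)"
    by simp
  have d: "reduced_homology_group (i - 1) (subtopology W ?R) \<cong> reduced_homology_group (i - 1) L"
    by (rule homotopy_equivalent_space_imp_isomorphic_reduced_homology_groups [OF middle_band_homotopy_equivalent])
  have "relative_homology_group i W {north} \<cong> relative_homology_group i (subtopology W ?P) ?R"
    by (rule group.iso_sym [OF group_relative_homology_group iso_trans [OF b a]])
  then show ?thesis
    by (rule iso_trans [OF _ iso_trans [OF c d]])
qed

text \<open>Both spaces are quotients of \<open>L \<times> [0,1]\<close> with the same fibres.\<close>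

lemma homeomorphic_suspension: "W homeomorphic_space suspension L"
proof -
  let ?P = "prod_topology L (top_of_set {0..1::real})"
  let ?q = "collapse_class ?P {topspace L \<times> {0}, topspace L \<times> {1}}" and ?p = "\<lambda>(x,t). pt x t"
  have qS: "quotient_map ?P (suspension L) ?q"
    unfolding suspension_def collapse_topology_def by (rule quotient_map_final_topology)
  have q: "?q (x,t) = (if t = 0 then topspace L \<times> {0} else if t = 1 then topspace L \<times> {1} else {(x,t)})"
    if "x \<in> topspace L" "0 \<le> t" "t \<le> 1" for x t
    using that by (cases "t = 0"; cases "t = 1") (auto simp: collapse_class_def)
  have pq: "?p z = ?p z' \<longleftrightarrow> ?q z = ?q z'" if "z \<in> topspace ?P" "z' \<in> topspace ?P" for z z'
  proof -
    obtain x t where z1: "z = (x,t)" by (cases z)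
    obtain y s where z2: "z' = (y,s)" by (cases z')
    note z = z1 z2
    have xt: "x \<in> topspace L" "0 \<le> t" "t \<le> 1" "y \<in> topspace L" "0 \<le> s" "s \<le> 1"
      using that unfolding z by auto
    have sets: "{(x,t)} \<noteq> topspace L \<times> {r}" if "t \<noteq> r" for x :: 'a and t r :: real
    proof
      assume "{(x,t)} = topspace L \<times> {r}"
      then have "(x,t) \<in> topspace L \<times> {r}" by blast
      then show False using that by simp
    qed
    have ends: "topspace L \<times> {0::real} \<noteq> topspace L \<times> {1}"
    proof
      assume eq: "topspace L \<times> {0::real} = topspace L \<times> {1}"
      have "(x,0) \<in> topspace L \<times> {0::real}" using xt(1) by simp
      then show False unfolding eq by simp
    qed
    consider "0 < t" "t < 1" | "0 < s" "s < 1" | "t = 0 \<or> t = 1" "s = 0 \<or> s = 1" using xt by fastforce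
    then show ?thesis
    proof cases
      case 1
      have "pt x t = pt y s \<longleftrightarrow> x = y \<and> t = s"
        using pt_inj [OF xt(1,4) 1 xt(5,6)] by auto
      moreover have "?q (x,t) = ?q (y,s) \<longleftrightarrow> x = y \<and> t = s"
        using 1 sets [of t 0 x] sets [of t 1 x] by (simp add: q xt)
      ultimately show ?thesis by (simp add: z)
    next
      case 2
      have "pt x t = pt y s \<longleftrightarrow> x = y \<and> t = s"
        using pt_inj [OF xt(4,1) 2 xt(2,3)] by auto
      moreover have "?q (x,t) = ?q (y,s) \<longleftrightarrow> x = y \<and> t = s"
        using 2 sets [of s 0 y, THEN not_sym] sets [of s 1 y, THEN not_sym] by (simp add: q xt)
      ultimately show ?thesis by (simp add: z)
    next
      case 3
      then show ?thesis unfolding z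
        by (elim disjE) (simp_all add: q xt not_sym [OF south_ne_north] ends ends [THEN not_sym])
    qed
  qed
  obtain g where g: "continuous_map W (suspension L) g" "\<And>z. z \<in> topspace ?P \<Longrightarrow> g (?p z) = ?q z"
    by (rule quotient_map_lift_exists [OF quotient_pt quotient_imp_continuous_map [OF qS]]) (use pq in blast)+
  obtain h where h: "continuous_map (suspension L) W h" "\<And>z. z \<in> topspace ?P \<Longrightarrow> h (?q z) = ?p z"
    by (rule quotient_map_lift_exists [OF qS quotient_imp_continuous_map [OF quotient_pt]]) (use pq in blast)+
  have "homeomorphic_maps W (suspension L) g h"
    unfolding homeomorphic_maps_def
  proof (intro conjI ballI g h)
    fix w assume "w \<in> topspace W"
    then obtain z where "z \<in> topspace ?P" "w = ?p z"
      unfolding quotient_imp_surjective_map [OF quotient_pt, symmetric] by blast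
    then show "h (g w) = w" using g h by simp
  next
    fix w assume "w \<in> topspace (suspension L)"
    then obtain z where "z \<in> topspace ?P" "w = ?q z"
      unfolding quotient_imp_surjective_map [OF qS, symmetric] by blast
    then show "g (h w) = w" using g h by simp
  qed
  then show ?thesis using homeomorphic_space_def by blast
qed

end

section \<open>The compactified infinite cone\<close>

abbreviation half_cylinder :: "'a topology \<Rightarrow> ('a \<times> real) topology" where
  "half_cylinder L \<equiv> prod_topology L (top_of_set {0..})"

definition cone_class :: "'a topology \<Rightarrow> 'a \<times> real \<Rightarrow> ('a \<times> real) set" where
  "cone_class L = collapse_class (half_cylinder L) {topspace L \<times> {0}}"

text \<open>Height \<open>t\<close> corresponds to the cone parameter \<open>t / (1 - t)\<close>. Between the poles the class of a point is the
singleton of its representative.\<close>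

definition compactified_cone_point :: "'a topology \<Rightarrow> 'a \<Rightarrow> real \<Rightarrow> ('a \<times> real) set option" where
  "compactified_cone_point L x t =
     (if t \<le> 0 then Some (cone_apex L) else if 1 \<le> t then None else Some {(x, t / (1 - t))})"

definition cone_height :: "('a \<times> real) set \<Rightarrow> real" where
  "cone_height c = snd (SOME z. z \<in> c)"

lemma quotient_cone_class: "quotient_map (half_cylinder L) (infinite_cone L) (cone_class L)"
  unfolding infinite_cone_def cone_class_def collapse_topology_def by (rule quotient_map_final_topology)

lemma cone_class_eq:
  "\<lbrakk>x \<in> topspace L; 0 \<le> t\<rbrakk> \<Longrightarrow> cone_class L (x,t) = (if t = 0 then cone_apex L else {(x,t)})"
  by (auto simp: cone_class_def collapse_class_def cone_apex_def)

lemma cone_point_cases: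
  assumes "c \<in> topspace (infinite_cone L)"
  obtains x t where "x \<in> topspace L" "0 \<le> t" "c = cone_class L (x,t)"
proof -
  have "c \<in> cone_class L ` topspace (half_cylinder L)"
    using assms unfolding quotient_imp_surjective_map [OF quotient_cone_class] .
  then obtain z where z: "z \<in> topspace (half_cylinder L)" "c = cone_class L z" by blast
  obtain x t where "z = (x,t)" by (cases z)
  then show thesis using z that [of x t] by simp
qed

lemma cone_class_in:
  assumes "x \<in> topspace L" "0 \<le> t" shows "cone_class L (x,t) \<in> topspace (infinite_cone L)"
proof -
  have "cone_class L (x,t) \<in> cone_class L ` topspace (half_cylinder L)"
    by (rule imageI) (simp add: assms)
  then show ?thesis unfolding quotient_imp_surjective_map [OF quotient_cone_class] .
qed

lemma cone_height:
  assumes "x \<in> topspace L" "0 \<le> t" shows "cone_height (cone_class L (x,t)) = t"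
proof -
  have mem: "z \<in> cone_class L (x,t) \<Longrightarrow> snd z = t" for z
    using assms by (cases "t = 0") (auto simp: cone_class_eq cone_apex_def)
  have "(x,t) \<in> cone_class L (x,t)"
    using assms by (cases "t = 0") (auto simp: cone_class_eq cone_apex_def)
  then have "(SOME z. z \<in> cone_class L (x,t)) \<in> cone_class L (x,t)" by (rule someI)
  then show ?thesis unfolding cone_height_def by (rule mem)
qed

lemma continuous_cone_height: "continuous_map (infinite_cone L) euclideanreal cone_height"
proof (rule continuous_compose_quotient_map [OF quotient_cone_class])
  have "continuous_map (half_cylinder L) euclideanreal snd"
    using continuous_map_into_fulltopology continuous_map_snd by blast
  then show "continuous_map (half_cylinder L) euclideanreal (cone_height \<circ> cone_class L)"
    by (rule continuous_map_eq) (auto simp: cone_height)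
qed

text \<open>Points at different distances from the apex are separated by that distance. Points at the same distance, if distinct,
are away from the apex and are separated by open cones without apex.\<close>

lemma Hausdorff_infinite_cone:
  assumes L: "Hausdorff_space L" shows "Hausdorff_space (infinite_cone L)"
  unfolding Hausdorff_space_def
proof (intro allI impI)
  fix c c' assume c: "c \<in> topspace (infinite_cone L) \<and> c' \<in> topspace (infinite_cone L) \<and> c \<noteq> c'"
  show "\<exists>U V. openin (infinite_cone L) U \<and> openin (infinite_cone L) V \<and> c \<in> U \<and> c' \<in> V \<and> disjnt U V"
  proof (cases "cone_height c = cone_height c'")
    case False
    then obtain S T :: "real set" where "open S" "open T" "cone_height c \<in> S" "cone_height c' \<in> T" "S \<inter> T = {}"
      using hausdorff by metis
    then show ?thesis
      using openin_continuous_map_preimage [OF continuous_cone_height, of S L]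
        openin_continuous_map_preimage [OF continuous_cone_height, of T L] c
      by (intro exI [of _ "{c \<in> topspace (infinite_cone L). cone_height c \<in> S}"]
          exI [of _ "{c \<in> topspace (infinite_cone L). cone_height c \<in> T}"]) (auto simp: disjnt_def)
  next
    case True
    obtain x t where x: "x \<in> topspace L" "0 \<le> t" "c = cone_class L (x,t)" using c cone_point_cases by blast
    obtain y s where y: "y \<in> topspace L" "0 \<le> s" "c' = cone_class L (y,s)" using c cone_point_cases by blast
    have st: "s = t" using True x y by (simp add: cone_height)
    then have "t > 0" "x \<noteq> y" using c x y by (auto simp: cone_class_eq)
    then obtain U V where UV: "openin L U" "openin L V" "x \<in> U" "y \<in> V" "disjnt U V"
      using L x y unfolding Hausdorff_space_def by metis
    have op: "openin (infinite_cone L) (cone_class L ` (U \<times> {0<..}))" if "openin L U" for U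
    proof -
      have U: "U \<subseteq> topspace L" using that by (rule openin_subset)
      have eq: "{z \<in> topspace (half_cylinder L). cone_class L z \<in> cone_class L ` (U \<times> {0<..})} = U \<times> {0<..}"
      proof (intro Set.set_eqI iffI)
        fix z assume z: "z \<in> {z \<in> topspace (half_cylinder L). cone_class L z \<in> cone_class L ` (U \<times> {0<..})}"
        obtain a r where ar: "z = (a,r)" "a \<in> topspace L" "0 \<le> r" using z by auto
        obtain b u where bu: "b \<in> U" "0 < u" "cone_class L (a,r) = cone_class L (b,u)" using z ar by auto
        have "r = u" using cone_height [of a L r] cone_height [of b L u] ar bu U by auto
        then show "z \<in> U \<times> {0<..}" using ar bu U cone_class_eq [of a L r] cone_class_eq [of b L u] by auto
      qed (use U in auto)
      have cyl: "openin (half_cylinder L) (U \<times> {0<..})"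
      proof -
        have "openin (top_of_set {0..}) ({0..} \<inter> ({0<..} :: real set))" by (rule openin_open_Int) simp
        moreover have "{0..} \<inter> ({0<..} :: real set) = {0<..}" by auto
        ultimately show ?thesis using that by (simp add: openin_prod_Times_iff)
      qed
      have sub: "cone_class L ` (U \<times> {0<..}) \<subseteq> topspace (infinite_cone L)"
        using U by (auto intro!: cone_class_in)
      have "\<forall>V. V \<subseteq> topspace (infinite_cone L) \<longrightarrow>
          openin (half_cylinder L) {z \<in> topspace (half_cylinder L). cone_class L z \<in> V} = openin (infinite_cone L) V"
        using quotient_cone_class [of L] unfolding quotient_map_def by (rule conjunct2)
      from this [rule_format, OF sub] show ?thesis
        unfolding eq using cyl by (rule iffD1)
    qed
    have "disjnt (cone_class L ` (U \<times> {0<..})) (cone_class L ` (V \<times> {0<..}))"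
      using UV openin_subset [OF UV(1)] openin_subset [OF UV(2)]
      by (auto simp: disjnt_iff cone_class_eq subset_iff)
    then show ?thesis
      using op [OF UV(1)] op [OF UV(2)] UV(3,4) x(3) y(3) st \<open>t > 0\<close> by blast
  qed
qed

lemma compactin_cone_below:
  assumes "compact_space L" shows "compactin (infinite_cone L) (cone_class L ` (topspace L \<times> {0..r}))"
proof (rule image_compactin)
  show "compactin (half_cylinder L) (topspace L \<times> {0..r})"
    using assms by (auto simp: compactin_Times compact_space_def compactin_subtopology)
  show "continuous_map (half_cylinder L) (infinite_cone L) (cone_class L)"
    by (rule quotient_imp_continuous_map [OF quotient_cone_class])
qed

text \<open>Bounded parts of the cone are compact because \<open>L\<close> is.\<close>

lemma locally_compact_infinite_cone:
  assumes "compact_space L" shows "locally_compact_space (infinite_cone L)"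
  unfolding locally_compact_space_def
proof
  fix c assume c: "c \<in> topspace (infinite_cone L)"
  let ?U = "{d \<in> topspace (infinite_cone L). cone_height d \<in> {..<cone_height c + 1}}"
  have "openin (infinite_cone L) ?U"
    by (rule openin_continuous_map_preimage [OF continuous_cone_height]) auto
  moreover have "?U \<subseteq> cone_class L ` (topspace L \<times> {0..cone_height c + 1})"
  proof
    fix d assume d: "d \<in> ?U"
    then obtain x t where "x \<in> topspace L" "0 \<le> t" "d = cone_class L (x,t)" using cone_point_cases by blast
    then show "d \<in> cone_class L ` (topspace L \<times> {0..cone_height c + 1})" using d by (auto simp: cone_height)
  qed
  ultimately show "\<exists>U K. openin (infinite_cone L) U \<and> compactin (infinite_cone L) K \<and> c \<in> U \<and> U \<subseteq> K"
    using compactin_cone_below [OF assms] c by (intro exI conjI) auto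
qed

text \<open>At the added point: a compact subset of the cone has bounded distance from the apex, so it is reached only at heights at
most some \<open>u < 1\<close>, where the coordinates are continuous.\<close>

lemma continuous_compactified_cone_point:
  assumes L: "compact_space L" "Hausdorff_space L"
  shows "continuous_map (prod_topology L (top_of_set {0..1})) (Alexandroff_compactification (infinite_cone L))
           (\<lambda>(x,t). compactified_cone_point L x t)"
proof -
  let ?P = "prod_topology L (top_of_set {0..1::real})" and ?A = "Alexandroff_compactification (infinite_cone L)"
  let ?p = "\<lambda>(x,t). compactified_cone_point L x t" and ?r = "\<lambda>(x,t). cone_class L (x, t / (1 - t))"
  have p: "?p (x,t) = (if t = 1 then None else Some (?r (x,t)))" if "x \<in> topspace L" "0 \<le> t" "t \<le> 1" for x t
    using that by (simp add: compactified_cone_point_def cone_class_eq)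
  have r: "continuous_map (prod_topology L (top_of_set S)) (infinite_cone L) ?r" if S: "S \<subseteq> {0..<1}" for S
  proof -
    have "continuous_on S (\<lambda>t::real. t / (1 - t))" using S by (intro continuous_intros) auto
    then have "continuous_map (top_of_set S) (top_of_set {0..}) (\<lambda>t. t / (1 - t))"
      using S by (auto simp: continuous_map_in_subtopology)
    from continuous_map_compose [OF continuous_map_snd this]
    have "continuous_map (prod_topology L (top_of_set S)) (top_of_set {0..}) (\<lambda>z. snd z / (1 - snd z))"
      by (simp add: o_def)
    then have "continuous_map (prod_topology L (top_of_set S)) (half_cylinder L) (\<lambda>z. (fst z, snd z / (1 - snd z)))"
      by (intro continuous_map_pairedI continuous_map_fst)
    from continuous_map_compose [OF this quotient_imp_continuous_map [OF quotient_cone_class]]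
    show ?thesis by (simp add: o_def case_prod_unfold)
  qed
  have sub: "prod_topology L (top_of_set S) = subtopology ?P (topspace L \<times> S)" if "S \<subseteq> {0..1}" for S
    using that by (simp add: subtopology_Times subtopology_subtopology Int_absorb1)
  have "openin ?P {z \<in> topspace ?P. ?p z \<in> V}" if V: "openin ?A V" for V
    using V unfolding openin_Alexandroff_compactification
  proof
    assume "\<exists>U. openin (infinite_cone L) U \<and> V = Some ` U"
    then obtain U where U: "openin (infinite_cone L) U" "V = Some ` U" by blast
    let ?Q = "prod_topology L (top_of_set {0..<1::real})"
    have o: "openin ?Q {z \<in> topspace ?Q. ?r z \<in> U}"
      by (rule openin_continuous_map_preimage [OF r U(1)]) simp
    have Q: "?Q = subtopology ?P (topspace L \<times> {0..<1})" by (rule sub) auto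
    have "openin (top_of_set {0..1}) ({0..1} \<inter> ({..<1} :: real set))" by (rule openin_open_Int) simp
    moreover have "{0..1} \<inter> ({..<1} :: real set) = {0..<1}" by auto
    ultimately have "openin ?P (topspace L \<times> {0..<1})" by (simp add: openin_prod_Times_iff)
    from openin_trans_full [OF o [unfolded Q] this]
    have "openin ?P {z \<in> topspace ?Q. ?r z \<in> U}" unfolding Q .
    moreover have "{z \<in> topspace ?P. ?p z \<in> V} = {z \<in> topspace ?Q. ?r z \<in> U}"
    proof -
      have "compactified_cone_point L x t \<in> V \<longleftrightarrow> t < 1 \<and> cone_class L (x, t / (1 - t)) \<in> U"
        if "x \<in> topspace L" "0 \<le> t" "t \<le> 1" for x t
        using p [OF that] that by (auto simp: U(2))
      then show ?thesis by auto
    qed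
    ultimately show ?thesis by simp
  next
    assume "\<exists>C. compactin (infinite_cone L) C \<and> closedin (infinite_cone L) C \<and> V = insert None (Some ` (topspace (infinite_cone L) - C))"
    then obtain C where C: "compactin (infinite_cone L) C" "closedin (infinite_cone L) C"
      and V: "V = insert None (Some ` (topspace (infinite_cone L) - C))" by blast
    have "compactin euclideanreal (cone_height ` C)"
      by (rule image_compactin [OF C(1) continuous_cone_height])
    then have "bounded (cone_height ` C)" by (simp add: compact_imp_bounded)
    then obtain b where b: "\<And>c. c \<in> C \<Longrightarrow> \<bar>cone_height c\<bar> \<le> b" by (auto simp: bounded_iff)
    define u where "u = \<bar>b\<bar> / (1 + \<bar>b\<bar>)"
    have u: "0 \<le> u" "u < 1" by (auto simp: u_def)
    let ?Q = "prod_topology L (top_of_set {0..u})"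
    have c: "closedin ?Q {z \<in> topspace ?Q. ?r z \<in> C}"
      by (rule closedin_continuous_map_preimage [OF r C(2)]) (use u in auto)
    have Q: "?Q = subtopology ?P (topspace L \<times> {0..u})" by (rule sub) (use u in auto)
    have "closedin (top_of_set {0..1}) {0..u}" using u by (simp add: closed_subset)
    then have "closedin ?P (topspace L \<times> {0..u})" by (simp add: closedin_prod_Times_iff)
    from closedin_trans_full [OF c [unfolded Q] this]
    have cl: "closedin ?P {z \<in> topspace ?Q. ?r z \<in> C}" unfolding Q .
    have bound: "t \<le> u" if "x \<in> topspace L" "0 \<le> t" "t < 1" "cone_class L (x, t / (1 - t)) \<in> C" for x t
    proof -
      have "cone_height (cone_class L (x, t / (1 - t))) = t / (1 - t)" using that by (intro cone_height) auto
      then have "t / (1 - t) \<le> \<bar>b\<bar>" using b [OF that(4)] by linarith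
      then have "t \<le> \<bar>b\<bar> * (1 - t)" using that by (simp add: pos_divide_le_eq)
      then have "t * (1 + \<bar>b\<bar>) \<le> \<bar>b\<bar>" by (simp add: algebra_simps)
      then show ?thesis by (simp add: u_def pos_le_divide_eq)
    qed
    have "compactified_cone_point L x t \<in> V \<longleftrightarrow> \<not> (t \<le> u \<and> cone_class L (x, t / (1 - t)) \<in> C)"
      if "x \<in> topspace L" "0 \<le> t" "t \<le> 1" for x t
    proof (cases "t = 1")
      case True
      then show ?thesis using p [OF that] u by (simp add: V)
    next
      case False
      have "cone_class L (x, t / (1 - t)) \<in> topspace (infinite_cone L)" using that by (intro cone_class_in) auto
      then show ?thesis using p [OF that] bound [of x t] False that by (auto simp: V)
    qed
    then have "{z \<in> topspace ?P. ?p z \<in> V} = topspace ?P - {z \<in> topspace ?Q. ?r z \<in> C}"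
      using u by auto
    then show ?thesis using openin_diff [OF openin_topspace cl] by (simp only:)
  qed
  moreover have "?p \<in> topspace ?P \<rightarrow> topspace ?A"
  proof -
    have in_A: "compactified_cone_point L x t \<in> topspace ?A" if "x \<in> topspace L" "0 \<le> t" "t \<le> 1" for x t
    proof (cases "t = 1")
      case False
      have "cone_class L (x, t / (1 - t)) \<in> topspace (infinite_cone L)" using that by (intro cone_class_in) auto
      then show ?thesis using p [OF that] False by simp
    qed (use p [OF that] in simp)
    show ?thesis
    proof (rule Pi_I)
      fix z assume "z \<in> topspace ?P"
      then obtain x t where z: "z = (x,t)" "x \<in> topspace L" "0 \<le> t" "t \<le> 1" by auto
      show "?p z \<in> topspace ?A" using in_A [OF z(2-4)] by (simp only: z(1) prod.case)
    qed
  qed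
  ultimately show ?thesis unfolding continuous_map_def by blast
qed

lemma suspension_coordinates_infinite_cone:
  assumes L: "compact_space L" "Hausdorff_space L" "topspace L \<noteq> {}"
  shows "suspension_coordinates L (Alexandroff_compactification (infinite_cone L)) (compactified_cone_point L) (Some (cone_apex L)) None"
proof
  let ?A = "Alexandroff_compactification (infinite_cone L)"
  show "Hausdorff_space ?A"
    unfolding Hausdorff_space_Alexandroff_compactification
    using Hausdorff_infinite_cone locally_compact_infinite_cone L by blast
  show cont: "continuous_map (prod_topology L (top_of_set {0..1})) ?A (\<lambda>(x,t). compactified_cone_point L x t)"
    by (rule continuous_compactified_cone_point [OF L(1,2)])
  show "(\<lambda>(x,t). compactified_cone_point L x t) ` (topspace L \<times> {0..1}) = topspace ?A"
  proof
    show "(\<lambda>(x,t). compactified_cone_point L x t) ` (topspace L \<times> {0..1}) \<subseteq> topspace ?A"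
      using continuous_map_image_subset_topspace [OF cont] by simp
    show "topspace ?A \<subseteq> (\<lambda>(x,t). compactified_cone_point L x t) ` (topspace L \<times> {0..1})"
    proof
      fix w assume "w \<in> topspace ?A"
      then consider "w = None" | c where "c \<in> topspace (infinite_cone L)" "w = Some c" by auto
      then show "w \<in> (\<lambda>(x,t). compactified_cone_point L x t) ` (topspace L \<times> {0..1})"
      proof cases
        case 1
        obtain x where "x \<in> topspace L" using L(3) by blast
        moreover have "w = compactified_cone_point L x 1" by (simp add: 1 compactified_cone_point_def)
        ultimately show ?thesis by force
      next
        case 2
        then obtain x t where x: "x \<in> topspace L" "0 \<le> t" "c = cone_class L (x,t)" using cone_point_cases by blast
        have "t / (1 + t) / (1 - t / (1 + t)) = t" using x by (simp add: field_simps)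
        then have "w = compactified_cone_point L x (t / (1 + t))"
          using x 2 by (auto simp: compactified_cone_point_def cone_class_eq field_simps)
        moreover have "0 \<le> t / (1 + t)" "t / (1 + t) \<le> 1" using x by auto
        ultimately show ?thesis using x by force
      qed
    qed
  qed
  fix x y t s assume *: "x \<in> topspace L" "y \<in> topspace L" "0 < t" "t < 1" "0 \<le> s" "s \<le> 1"
    "compactified_cone_point L x t = compactified_cone_point L y s"
  have "(x, t / (1 - t)) \<notin> cone_apex L" using * by (simp add: cone_apex_def)
  then have s: "0 < s" "s < 1" using * by (auto simp: compactified_cone_point_def split: if_splits)
  then have "x = y" "t / (1 - t) = s / (1 - s)" using * by (auto simp: compactified_cone_point_def)
  then show "x = y \<and> t = s" using * s by (simp add: field_simps)
qed (use L in \<open>auto simp: compactified_cone_point_def\<close>)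

section \<open>The Borel--Moore model of the infinite cone\<close>

theorem proposition14p3:
  fixes L :: "'a topology" and K :: "'a cell set"
  assumes "finite_CW_structure L K" and "topspace L \<noteq> {}"
  shows "(\<exists>M. finite_BM_structure (infinite_cone L) M \<and>
           Some (cone_apex L) \<in> skeleton M 0 \<and>
           (\<exists>\<theta>\<^sub>0 \<theta>.
              \<theta>\<^sub>0 \<in> iso (BM_chain_group (infinite_cone L) M 0) integer_group \<and>
              \<theta>\<^sub>0 (vertex_class (Alexandroff_compactification (infinite_cone L)) M {None}
                     (Some (cone_apex L))) = 1 \<and>
              (\<forall>k\<ge>0. \<theta> k \<in> iso (BM_chain_group (infinite_cone L) M (k + 1))
                                (cellular_chain_group L K {} k)) \<and>
              (\<forall>x \<in> carrier (BM_chain_group (infinite_cone L) M 1).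
                 \<theta>\<^sub>0 (BM_boundary (infinite_cone L) M 1 x) = cellular_augmentation (\<theta> 0 x)) \<and>
              (\<forall>k\<ge>1. \<forall>x \<in> carrier (BM_chain_group (infinite_cone L) M (k + 1)).
                 \<theta> (k - 1) (BM_boundary (infinite_cone L) M (k + 1) x)
                   = cellular_boundary L K {} k (\<theta> k x))) \<and>
           (\<forall>i\<ge>1. complex_homology (BM_chain_group (infinite_cone L) M)
                     (BM_boundary (infinite_cone L) M) i
                   \<cong> reduced_homology_group (i - 1) L) \<and>
           trivial_group (complex_homology (BM_chain_group (infinite_cone L) M)
                     (BM_boundary (infinite_cone L) M) 0))
       \<and> Alexandroff_compactification (infinite_cone L) homeomorphic_space suspension L"
proof -
  let ?W = "Alexandroff_compactification (infinite_cone L)"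
  have L: "compact_space L" "Hausdorff_space L"
    using compact_space_finite_CW finite_CW_structureD(1) assms(1) by blast+
  interpret S: suspension_coordinates L ?W "compactified_cone_point L" "Some (cone_apex L)" None
    by (rule suspension_coordinates_infinite_cone [OF L assms(2)])
  let ?M = "S.sus_cells K"
  have cw: "finite_CW_structure ?W ?M"
    by (rule S.finite_CW_sus_cells [OF assms(1)])
  have skel0: "skeleton ?M 0 = {Some (cone_apex L), None}"
    unfolding S.skeleton_sus_cells [OF assms(1) order_refl]
    by (simp add: skeleton_negative S.sus_empty)
  obtain \<theta>\<^sub>0 \<theta> where \<theta>:
    "\<theta>\<^sub>0 \<in> iso (cellular_chain_group ?W ?M {None} 0) integer_group"
    "\<theta>\<^sub>0 (vertex_class ?W ?M {None} (Some (cone_apex L))) = 1"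
    "\<And>k. 0 \<le> k \<Longrightarrow> \<theta> k \<in> iso (cellular_chain_group ?W ?M {None} (k + 1)) (cellular_chain_group L K {} k)"
    "\<And>x. x \<in> carrier (cellular_chain_group ?W ?M {None} 1) \<Longrightarrow>
       \<theta>\<^sub>0 (cellular_boundary ?W ?M {None} 1 x) = cellular_augmentation (\<theta> 0 x)"
    "\<And>k x. \<lbrakk>1 \<le> k; x \<in> carrier (cellular_chain_group ?W ?M {None} (k + 1))\<rbrakk> \<Longrightarrow>
       \<theta> (k - 1) (cellular_boundary ?W ?M {None} (k + 1) x) = cellular_boundary L K {} k (\<theta> k x)"
    by (rule S.cellular_chains_sus_cells [OF assms(1)]; rule that; assumption)
  have "closedin ?W {None}"
    using finite_CW_structureD(1) [OF cw] by (intro closedin_Hausdorff_singleton) auto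
  then have H: "group (complex_homology (cellular_chain_group ?W ?M {None}) (cellular_boundary ?W ?M {None}) i)"
    "complex_homology (cellular_chain_group ?W ?M {None}) (cellular_boundary ?W ?M {None}) i \<cong> reduced_homology_group (i - 1) L" for i
    using cellular_homology [OF cw, of "{None}" i] iso_trans [OF _ S.homology_suspension_mod_pole [of i]] skel0
    by blast+
  have triv: "trivial_group (complex_homology (cellular_chain_group ?W ?M {None}) (cellular_boundary ?W ?M {None}) 0)"
    using H [of 0] trivial_reduced_homology_group [of "-1" L] isomorphic_group_triviality by fastforce
  then show ?thesis
    using \<theta> H(2) triv cw skel0 S.homeomorphic_suspension
    unfolding finite_BM_structure_def BM_chain_group_def BM_boundary_def
    by (intro conjI exI [of _ ?M] exI [of _ \<theta>\<^sub>0] exI [of _ \<theta>] allI impI ballI) auto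
qed

end
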